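(* Let $q$ be a real-valued, $1$-periodic function with $q\in L_1[0,1]$ and $\int_0^1 q(x)\,dx=0$. Let $m\ge2$ be an integer, and let $\lambda_{n,j}$, $A_m$, $B_m$, $E_{n,j,m}$ be as defined in the context. (a) Suppose there exist $\varepsilon>0$ and $N$ such that $$|q_{2n}+B_m(\lambda_{n,j})|\ge\frac{\varepsilon}{n^m}\qquad(n\ge N,\ j=1,2).$$ Then $$\lambda_{n,j}=E_{n,j,m}+O\left(\left(\frac{\ln n}{n}\right)^{m+1}\right)\quad(j=1,2)$$ and the length $|\Delta_n|=\lambda_{n,2}-\lambda_{n,1}$ of the gap $\Delta_n=(\lambda_{n,1},\lambda_{n,2})$ satisfies $$|\Delta_n|=E_{n,2,m}-E_{n,1,m}+O\left(\left(\frac{\ln n}{n}\right)^{m+1}\right).$$ Moreover, these conclusions remain valid if, instead of the inequality $|q_{2n}+B_m(\lambda_{n,j})|\ge\frac{\varepsilon}{n^m}$ ($n\ge N$, $j=1,2$), at least one of the following inequalities is satisfied for all $n\ge N$ with some $\varepsilon>0$: $$|q_{2n}|\ge\frac{\varepsilon}{n},\qquad |q_{2n}-S_{2n}+2Q_0Q_{2n}|\ge\frac{\varepsilon}{n^2}.$$ (b) If $q_{2n}+B_m(\lambda_{n,j})=O(n^{-m})$ for $j=1,2$, then $|\Delta_n|=O(n^{-m})$; if $q_{2n}+B_m(\lambda_{n,j})=o(n^{-m})$ for $j=1,2$, then $|\Delta_n|=o(n^{-m})$.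
   Context: $L_0(q)$ is the operator in $L_2[0,1]$ generated by $-y''+qy$ with periodic boundary conditions $y(1)=y(0)$, $y'(1)=y'(0)$. Its large eigenvalues, counted with multiplicity, form two sequences $\lambda_{n,1}\le\lambda_{n,2}$ ($n\ge N_0$, $N_0$ a sufficiently large integer) with $\lambda_{n,j}=(2\pi n)^2+O(n^{1/2})$. For a function $f$ put $f_k=\int_0^1f(x)e^{-2\pi ikx}dx$; this gives $q_k,Q_k,S_k$, where $Q(x)=\int_0^xq(t)\,dt$ and $S(x)=Q(x)^2$. For real $\lambda$ near $(2\pi n)^2$ and $k\ge1$ let $$a_k(\lambda)=\sum_{n_1,\dots,n_k}\frac{q_{n_1}q_{n_2}\cdots q_{n_k}q_{-n_1-n_2-\cdots-n_k}}{\prod_{s=1}^k\left(\lambda-(2\pi(n-n_1-\cdots-n_s))^2\right)},$$ $$b_k(\lambda)=\sum_{n_1,\dots,n_k}\frac{q_{n_1}q_{n_2}\cdots q_{n_k}q_{2n-n_1-n_2-\cdots-n_k}}{\prod_{s=1}^k\left(\lambda-(2\pi(n-n_1-\cdots-n_s))^2\right)},$$ where the sums are over integers with $n_s\ne0$ and $n_1+\cdots+n_s\ne0,2n$ for $s=1,\dots,k$ (these functions depend on $n$). Put $A_m=\sum_{k=1}^ma_k$, $B_m=\sum_{k=1}^mb_k$. Define successively $E_{n,j,0}=(2\pi n)^2$ and, for $k\ge1$, $$E_{n,j,k}=(2\pi n)^2+A_k(E_{n,j,k-1})+(-1)^j\left|q_{2n}+B_k(E_{n,j,k-1})\right|.$$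 *)

theory Defs
  imports "HOL-Analysis.Analysis" "HOL-Library.Function_Algebras" "HOL-Library.Landau_Symbols"
begin

subsection \<open>The periodic operator and its eigenvalues\<close>

text \<open>
  \<open>hill_op q y f\<close> says that \<open>y\<close> lies in the domain of \<open>L\<^sub>0(q)\<close> and \<open>L\<^sub>0(q) y = f\<close>: the function
  \<open>y\<close> is continuously differentiable, its derivative \<open>y'\<close> is absolutely continuous with
  almost-everywhere derivative \<open>y''\<close>, the boundary conditions are periodic, and
  \<open>f = -y'' + q y\<close> almost everywhere with \<open>f\<close> in \<open>L\<^sub>2[0,1]\<close>.  Absolute continuity of \<open>y'\<close> is
  expressed by saying that \<open>y'\<close> is the indefinite integral of the integrable function \<open>y''\<close>.
\<close>

definition hill_op :: "(real \<Rightarrow> real) \<Rightarrow> (real \<Rightarrow> complex) \<Rightarrow> (real \<Rightarrow> complex) \<Rightarrow> bool" where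
  "hill_op q y f \<longleftrightarrow>
     (\<exists>y' y''.
        (\<forall>x\<in>{0..1}. (y has_vector_derivative y' x) (at x within {0..1})) \<and>
        set_integrable lebesgue {0..1} y'' \<and>
        (\<forall>x\<in>{0..1}. y' x = y' 0 + (LINT t:{0..x}|lebesgue. y'' t)) \<and>
        y 1 = y 0 \<and> y' 1 = y' 0 \<and>
        set_borel_measurable lebesgue {0..1} f \<and>
        set_integrable lebesgue {0..1} (\<lambda>x. (cmod (f x))\<^sup>2) \<and>
        (AE x in lebesgue. x \<in> {0..1} \<longrightarrow> f x = - y'' x + of_real (q x) * y x))"

text \<open>
  Functions on \<open>[0,1]\<close> are represented by functions on the real line vanishing outside \<open>[0,1]\<close>,
  so that the dimension below is the dimension of the eigenspace in \<open>L\<^sub>2[0,1]\<close>.  For real \<open>q\<close> the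
  operator is self-adjoint, so real \<open>\<mu>\<close> suffice and algebraic and geometric multiplicity agree.
  The multiplicity is \<open>0\<close> if \<open>\<mu>\<close> is not an eigenvalue.
\<close>

definition hill_eigenspace :: "(real \<Rightarrow> real) \<Rightarrow> real \<Rightarrow> (real \<Rightarrow> complex) set" where
  "hill_eigenspace q \<mu> =
     {y. (\<forall>x. x \<notin> {0..1} \<longrightarrow> y x = 0) \<and> hill_op q y (\<lambda>x. of_real \<mu> * y x)}"

definition hill_mult :: "(real \<Rightarrow> real) \<Rightarrow> real \<Rightarrow> nat" where
  "hill_mult q \<mu> =
     vector_space.dim (\<lambda>(c::complex) (y::real \<Rightarrow> complex) x. c * y x) (hill_eigenspace q \<mu>)"

text \<open>
  \<open>lam n 1 \<le> lam n 2\<close> for \<open>n \<ge> N0\<close> list, with multiplicity, exactly the eigenvalues that are at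
  least \<open>R\<close>.  The asymptotic formula fixes the numbering.  Values \<open>lam n j\<close> with \<open>n < N0\<close> or
  \<open>j \<notin> {1, 2}\<close> are irrelevant.
\<close>

definition hill_eigenvalue_sequences ::
    "(real \<Rightarrow> real) \<Rightarrow> nat \<Rightarrow> (nat \<Rightarrow> nat \<Rightarrow> real) \<Rightarrow> bool" where
  "hill_eigenvalue_sequences q N0 lam \<longleftrightarrow>
     (\<forall>n\<ge>N0. lam n 1 \<le> lam n 2) \<and>
     (\<exists>R. (\<forall>n\<ge>N0. \<forall>j\<in>{1,2}. R \<le> lam n j) \<and>
          (\<forall>\<mu>\<ge>R. hill_mult q \<mu> = card {(n, j). N0 \<le> n \<and> j \<in> {1,2} \<and> lam n j = \<mu>})) \<and>
     (\<forall>j\<in>{1,2}. (\<lambda>n. lam n j - (2 * pi * real n)\<^sup>2) \<in> O(\<lambda>n. sqrt (real n)))"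


subsection \<open>Fourier coefficients and the functions \<open>Q\<close> and \<open>S\<close>\<close>

definition fourier :: "(real \<Rightarrow> real) \<Rightarrow> int \<Rightarrow> complex" where
  "fourier f k = (LINT x:{0..1}|lebesgue. of_real (f x) * exp (- 2 * pi * \<i> * of_int k * of_real x))"

text \<open>Only the values of \<open>Q\<close> and \<open>S\<close> on \<open>[0,1]\<close> are used.\<close>

definition primitive :: "(real \<Rightarrow> real) \<Rightarrow> real \<Rightarrow> real" where
  "primitive q x = (LINT t:{0..x}|lebesgue. q t)"

definition primitive_sq :: "(real \<Rightarrow> real) \<Rightarrow> real \<Rightarrow> real" where
  "primitive_sq q x = (primitive q x)\<^sup>2"


subsection \<open>The functions \<open>a\<^sub>k\<close>, \<open>b\<^sub>k\<close>, \<open>A\<^sub>m\<close>, \<open>B\<^sub>m\<close> and the approximations \<open>E\<close>\<close>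

text \<open>
  The list \<open>ns\<close> stands for \<open>(n\<^sub>1, \<dots>, n\<^sub>k)\<close>, so \<open>n\<^sub>s\<close> is \<open>ns ! (s - 1)\<close> and
  \<open>sum_list (take s ns)\<close> is \<open>n\<^sub>1 + \<dots> + n\<^sub>s\<close>.
\<close>

definition hill_indices :: "nat \<Rightarrow> nat \<Rightarrow> int list set" where
  "hill_indices n k =
     {ns. length ns = k \<and>
          (\<forall>s\<in>{1..k}. ns ! (s - 1) \<noteq> 0 \<and> sum_list (take s ns) \<noteq> 0 \<and>
                      sum_list (take s ns) \<noteq> 2 * int n)}"

definition hill_denom :: "nat \<Rightarrow> nat \<Rightarrow> real \<Rightarrow> int list \<Rightarrow> real" where
  "hill_denom n k \<mu> ns =
     (\<Prod>s=1..k. \<mu> - (2 * pi * of_int (int n - sum_list (take s ns)))\<^sup>2)"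

definition hill_a :: "(real \<Rightarrow> real) \<Rightarrow> nat \<Rightarrow> nat \<Rightarrow> real \<Rightarrow> complex" where
  "hill_a q n k \<mu> =
     (\<Sum>\<^sub>\<infinity>ns\<in>hill_indices n k.
        (\<Prod>i\<leftarrow>ns. fourier q i) * fourier q (- sum_list ns) / of_real (hill_denom n k \<mu> ns))"

definition hill_b :: "(real \<Rightarrow> real) \<Rightarrow> nat \<Rightarrow> nat \<Rightarrow> real \<Rightarrow> complex" where
  "hill_b q n k \<mu> =
     (\<Sum>\<^sub>\<infinity>ns\<in>hill_indices n k.
        (\<Prod>i\<leftarrow>ns. fourier q i) * fourier q (2 * int n - sum_list ns) / of_real (hill_denom n k \<mu> ns))"

definition hill_A :: "(real \<Rightarrow> real) \<Rightarrow> nat \<Rightarrow> nat \<Rightarrow> real \<Rightarrow> complex" where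
  "hill_A q n m \<mu> = (\<Sum>k=1..m. hill_a q n k \<mu>)"

definition hill_B :: "(real \<Rightarrow> real) \<Rightarrow> nat \<Rightarrow> nat \<Rightarrow> real \<Rightarrow> complex" where
  "hill_B q n m \<mu> = (\<Sum>k=1..m. hill_b q n k \<mu>)"

text \<open>
  For real \<open>q\<close> and real \<open>\<mu>\<close> the number \<open>hill_A q n m \<mu>\<close> is real (lemma \<open>hill_A_real\<close> below), so
  \<open>Re\<close> only changes its type.
\<close>

primrec hill_E :: "(real \<Rightarrow> real) \<Rightarrow> nat \<Rightarrow> nat \<Rightarrow> nat \<Rightarrow> real" where
  "hill_E q n j 0 = (2 * pi * real n)\<^sup>2"
| "hill_E q n j (Suc k) =
     (2 * pi * real n)\<^sup>2 + Re (hill_A q n (Suc k) (hill_E q n j k)) +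
     (-1) ^ j * cmod (fourier q (2 * int n) + hill_B q n (Suc k) (hill_E q n j k))"

lemma cnj_fourier: "cnj (fourier f k) = fourier f (- k)"
  unfolding fourier_def set_lebesgue_integral_def
  by (subst Bochner_Integration.integral_cnj[symmetric], rule Bochner_Integration.integral_cong) (auto simp: exp_cnj)

definition rev_path :: "int list \<Rightarrow> int list" where
  "rev_path ns = map uminus (rev (tl (ns @ [- sum_list ns])))"

lemma sum_list_map_uminus: "sum_list (map uminus (xs :: int list)) = - sum_list xs"
  by (induction xs) auto

lemma sum_list_rev_path:
  assumes "ns \<noteq> []"
  shows "sum_list (rev_path ns) = hd ns"
  using assms by (cases ns) (auto simp: rev_path_def sum_list_map_uminus)

lemma rev_path_rev_path:
  assumes "ns \<noteq> []"
  shows "rev_path (rev_path ns) = ns"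
proof -
  obtain x xs where ns: "ns = x # xs" using assms by (cases ns) auto
  have "rev_path ns = (x + sum_list xs) # map uminus (rev xs)"
    by (simp add: rev_path_def ns)
  moreover have "sum_list (rev_path ns) = x"
    using sum_list_rev_path[OF assms] by (simp add: ns)
  ultimately show ?thesis
    by (simp add: rev_path_def ns rev_map o_def)
qed

lemma sum_take_rev_path:
  assumes "length ns = k" and s: "s \<in> {1..k}"
  shows "sum_list (take s (rev_path ns)) = sum_list (take (Suc k - s) ns)"
proof -
  obtain x xs where ns: "ns = x # xs" using assms by (cases ns) auto
  have eq: "rev_path ns = (x + sum_list xs) # map uminus (rev xs)"
    by (simp add: rev_path_def ns)
  obtain t where t: "s = Suc t" using s by (cases s) auto
  have len: "length xs = k - 1" "t \<le> k - 1" using assms ns t by auto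
  have "sum_list (take t (map uminus (rev xs))) = - sum_list (drop (length xs - t) xs)"
    by (simp add: take_map take_rev sum_list_map_uminus)
  moreover have "sum_list xs =
      sum_list (take (length xs - t) xs) + sum_list (drop (length xs - t) xs)"
    by (metis append_take_drop_id sum_list_append)
  moreover have "Suc k - s = Suc (length xs - t)" using len t s by auto
  ultimately show ?thesis unfolding eq by (simp add: t ns)
qed

lemma rev_path_in:
  assumes "ns \<in> hill_indices n k" "1 \<le> k"
  shows "rev_path ns \<in> hill_indices n k"
proof -
  have len: "length ns = k" using assms by (simp add: hill_indices_def)
  obtain x xs where ns: "ns = x # xs" using assms len by (cases ns) auto
  have eq: "rev_path ns = (x + sum_list xs) # map uminus (rev xs)"
    by (simp add: rev_path_def ns)
  have nz: "y \<noteq> 0" if y: "y \<in> set ns" for y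
  proof -
    obtain i where "i < k" "ns ! i = y" using y len by (auto simp: in_set_conv_nth)
    moreover have "Suc i \<in> {1..k}" using \<open>i < k\<close> by simp
    moreover have "\<forall>s\<in>{1..k}. ns ! (s - 1) \<noteq> 0"
      using assms(1) by (simp add: hill_indices_def)
    ultimately show ?thesis by force
  qed
  have "\<forall>s\<in>{1..k}. sum_list (take s ns) \<noteq> 0"
    using assms(1) by (simp add: hill_indices_def)
  then have "sum_list (take k ns) \<noteq> 0" using assms(2) by simp
  then have "y \<noteq> 0" if "y \<in> set (rev_path ns)" for y
    using that nz len unfolding eq unfolding ns by auto
  moreover have len': "length (rev_path ns) = k" using len by (simp add: rev_path_def)
  ultimately have "rev_path ns ! (s - 1) \<noteq> 0" if "s \<in> {1..k}" for s
    using that nth_mem[of "s - 1" "rev_path ns"] by fastforce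
  moreover have "sum_list (take s (rev_path ns)) \<notin> {0, 2 * int n}" if "s \<in> {1..k}" for s
  proof -
    have "Suc k - s \<in> {1..k}" using that by auto
    then show ?thesis using assms(1) that len
      by (auto simp: sum_take_rev_path hill_indices_def)
  qed
  ultimately show ?thesis using len' by (auto simp: hill_indices_def)
qed

lemma hill_denom_rev_path:
  assumes "length ns = k"
  shows "hill_denom n k \<mu> (rev_path ns) = hill_denom n k \<mu> ns"
  unfolding hill_denom_def
  by (rule prod.reindex_bij_witness[of _ "\<lambda>s. Suc k - s" "\<lambda>s. Suc k - s"])
     (use assms in \<open>auto simp: sum_take_rev_path\<close>)

lemma prod_list_rev_path:
  assumes "ns \<noteq> []"
  shows "(\<Prod>i\<leftarrow>rev_path ns. fourier q i) * fourier q (- sum_list (rev_path ns)) =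
         cnj ((\<Prod>i\<leftarrow>ns. fourier q i) * fourier q (- sum_list ns))"
proof -
  obtain x xs where ns: "ns = x # xs" using assms by (cases ns) auto
  have eq: "rev_path ns = (x + sum_list xs) # map uminus (rev xs)"
    by (simp add: rev_path_def ns)
  have "cnj (\<Prod>i\<leftarrow>xs. fourier q i) = (\<Prod>i\<leftarrow>map uminus (rev xs). fourier q i)"
    by (induction xs) (simp_all add: cnj_fourier)
  then show ?thesis
    unfolding sum_list_rev_path[OF assms] unfolding eq by (simp add: ns cnj_fourier mult_ac add_ac)
qed

lemma hill_a_real:
  assumes "1 \<le> k"
  shows "hill_a q n k \<mu> \<in> \<real>"
proof -
  have ne: "ns \<noteq> []" "length ns = k" if "ns \<in> hill_indices n k" for ns
    using that assms by (auto simp: hill_indices_def)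
  have "cnj (hill_a q n k \<mu>) = hill_a q n k \<mu>"
    unfolding hill_a_def infsum_cnj[symmetric]
  proof (rule infsum_reindex_bij_witness[where i = rev_path and j = rev_path])
    fix ns assume ns: "ns \<in> hill_indices n k"
    show "(\<Prod>i\<leftarrow>rev_path ns. fourier q i) * fourier q (- sum_list (rev_path ns)) /
            of_real (hill_denom n k \<mu> (rev_path ns)) =
          cnj ((\<Prod>i\<leftarrow>ns. fourier q i) * fourier q (- sum_list ns) /
            of_real (hill_denom n k \<mu> ns))"
      unfolding prod_list_rev_path[OF ne(1)[OF ns]] hill_denom_rev_path[OF ne(2)[OF ns]] by simp
  qed (use assms ne in \<open>auto simp: rev_path_rev_path rev_path_in\<close>)
  then show ?thesis by (simp add: Reals_cnj_iff)
qed

lemma hill_A_real: "hill_A q n m \<mu> \<in> \<real>"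
  unfolding hill_A_def by (intro sum_in_Reals hill_a_real) auto

end

theory Submission
  imports Defs
begin

text \<open>
  The Fourier coefficients \<open>u\<^sub>k\<close> of an eigenfunction for \<open>\<lambda>\<close> satisfy
  \<open>(\<lambda> - (2 \<pi> k)\<^sup>2) u\<^sub>k = \<Sum>\<^sub>i q\<^sub>i u\<^sub>k\<^sub>-\<^sub>i\<close>. Starting at \<open>k = \<plusminus>n\<close> and substituting the equation into all
  terms other than \<open>u\<^sub>n\<close> and \<open>u\<^sub>-\<^sub>n\<close>, one gets after \<open>m + 1\<close> steps a Hermitian two by two system with
  diagonal \<open>D = \<lambda> - (2 \<pi> n)\<^sup>2 - A\<^sub>m(\<lambda>)\<close>, coupling \<open>\<beta> = q\<^sub>2\<^sub>n + B\<^sub>m(\<lambda>)\<close> and an error that is a power of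
  \<open>\<Sum>\<^sub>j 1 / |j (2 n - j)| = O(ln n / n)\<close>. Hence \<open>|D| = |\<beta>| + O((ln n / n)\<^sup>m\<^sup>+\<^sup>1)\<close>, which gives part (b).
  If both eigenvalues had the same sign of \<open>D\<close>, they would agree up to the error, and as the two vectors
  \<open>(u\<^sub>n, u\<^sub>-\<^sub>n)\<close> are nearly orthogonal, \<open>\<beta>\<close> itself would be of the size of the error. So the signs
  are \<open>(-1)\<^sup>j\<close>, and the fixed point iteration defining \<open>E\<close> contracts by \<open>O((ln n / n)\<^sup>2)\<close> per step.

  For the alternative hypotheses the leading terms \<open>b\<^sub>1, b\<^sub>2\<close> must be \<open>o(1/n), o(1/n\<^sup>2)\<close> without logarithms: they are
  multilinear in \<open>q\<close>, bounded by \<open>O(1/n), O(1/n\<^sup>2)\<close> in the norm of \<open>L\<^sub>1\<close>, and vanish for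
  trigonometric polynomials and large \<open>n\<close>.
\<close>

subsection \<open>Fourier coefficients on the unit interval\<close>

text \<open>As \<open>q\<close> is only integrable, its Fourier coefficients are merely bounded. All
  decay must come from the denominators, and the series in the eigenvalue equation converge because
  eigenfunctions have coefficients of order 1/k^2. Identities between functions and coefficients are
  proved by density: both sides are linear and bounded in one L1 argument, so exponentials suffice.
  The two by two system controls only the modulus of D, and orthogonality decides the signs only for
  distinct eigenvalues. If they coincide, the two-dimensional eigenspace contains a nonzero
  eigenfunction with \<open>u\<^sub>-\<^sub>n = 0\<close>, which again makes \<beta> as small as the
  error. The error (ln n / n)^(m+1) is o(n^(-m)). Hence a lower bound \<epsilon> / n^m for |\<beta>|
  eventually exceeds any fixed multiple of the error, and in part (b) the error is absorbed. The
  alternative hypotheses are reduced to such a lower bound: at (2 pi n)^2 the coefficient b_1 equals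
  -S_{2n} + 2 Q_0 Q_{2n} exactly.\<close>

abbreviation M01 :: "real measure" where "M01 \<equiv> lebesgue_on {0..1}"

definition expi :: "int \<Rightarrow> real \<Rightarrow> complex" where
  "expi k x = cis (2 * pi * of_int k * x)"

lemma expi_0 [simp]: "expi 0 x = 1"
  by (simp add: expi_def)

lemma expi_add: "expi (a + b) x = expi a x * expi b x"
  by (simp add: expi_def cis_mult algebra_simps)

lemma norm_expi [simp]: "norm (expi k x) = 1"
  by (simp add: expi_def)

lemma continuous_on_expi [continuous_intros]: "continuous_on S (expi k)"
  unfolding expi_def by (intro continuous_intros)

lemma expi_at_0 [simp]: "expi k 0 = 1"
  by (simp add: expi_def)

lemma expi_at_1 [simp]: "expi k 1 = 1"
  by (metis cis_multiple_2pi expi_def Ints_of_int mult.assoc mult.right_neutral)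

abbreviation L1 :: "(real \<Rightarrow> complex) \<Rightarrow> real" where
  "L1 f \<equiv> LINT x|M01. norm (f x)"

lemma finite_measure_M01: "finite_measure M01"
  by (rule finite_measureI) (simp add: emeasure_restrict_space)

interpretation M01: finite_measure M01
  by (rule finite_measure_M01)

lemma measure_M01 [simp]: "measure M01 {0..1} = 1"
  by (simp add: measure_restrict_space)

lemma M01_measurable_continuous:
  "continuous_on {0..1} (f :: real \<Rightarrow> 'a::{second_countable_topology,banach}) \<Longrightarrow> f \<in> borel_measurable M01"
  by (rule continuous_imp_measurable_on_sets_lebesgue) auto

lemma M01_continuous_bounded:
  assumes "continuous_on {0..1} (f :: real \<Rightarrow> 'a::{second_countable_topology,banach})"
  obtains B where "B \<ge> 0" "\<And>x. x \<in> {0..1} \<Longrightarrow> norm (f x) \<le> B"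
proof -
  have "bounded (f ` {0..1})"
    using assms by (intro compact_imp_bounded compact_continuous_image) auto
  then obtain B where "B > 0" "\<forall>y\<in>f ` {0..1}. norm y \<le> B"
    by (auto simp: bounded_pos)
  then show ?thesis by (intro that[of B]) auto
qed

lemma M01_integrable_continuous:
  assumes "continuous_on {0..1} (f :: real \<Rightarrow> 'a::{second_countable_topology,banach})"
  shows "integrable M01 f"
proof -
  obtain B where "\<And>x. x \<in> {0..1} \<Longrightarrow> norm (f x) \<le> B"
    using M01_continuous_bounded[OF assms] by metis
  then show ?thesis
    using assms by (intro M01.integrable_const_bound[where B = B] M01_measurable_continuous AE_I2) auto
qed

lemma M01_integrable_mult:
  assumes f: "integrable M01 (f :: real \<Rightarrow> complex)" and g: "continuous_on {0..1} g"
  shows "integrable M01 (\<lambda>x. f x * g x)"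
proof -
  obtain B where "B \<ge> 0" and B: "\<And>x. x \<in> {0..1} \<Longrightarrow> norm (g x) \<le> B"
    using M01_continuous_bounded[OF g] by metis
  show ?thesis
  proof (rule Bochner_Integration.integrable_bound)
    show "integrable M01 (\<lambda>x. B * norm (f x))"
      using f by (intro integrable_mult_right integrable_norm)
    show "(\<lambda>x. f x * g x) \<in> borel_measurable M01"
      using f g by (intro borel_measurable_times M01_measurable_continuous borel_measurable_integrable)
    show "AE x in M01. norm (f x * g x) \<le> norm (B * norm (f x))"
      using B \<open>B \<ge> 0\<close> by (intro AE_I2) (auto simp: norm_mult mult.commute[of B] intro!: mult_left_mono)
  qed
qed

lemma L1_mult_le:
  assumes f: "integrable M01 (f :: real \<Rightarrow> complex)" and g: "continuous_on {0..1} g"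
    and B: "\<And>x. x \<in> {0..1} \<Longrightarrow> norm (g x) \<le> B"
  shows "(LINT x|M01. norm (f x * g x)) \<le> B * L1 f"
proof -
  have "(LINT x|M01. norm (f x * g x)) \<le> (LINT x|M01. B * norm (f x))"
    using B f g by (intro integral_mono integrable_norm M01_integrable_mult integrable_mult_right)
      (auto simp: norm_mult mult.commute[of B] intro!: mult_left_mono)
  then show ?thesis by simp
qed

lemma M01_norm_integral_mult_le:
  assumes "integrable M01 (f :: real \<Rightarrow> complex)" "continuous_on {0..1} g"
    and "\<And>x. x \<in> {0..1} \<Longrightarrow> norm (g x) \<le> B"
  shows "norm (LINT x|M01. f x * g x) \<le> B * L1 f"
  by (rule order_trans[OF integral_norm_bound L1_mult_le[OF assms]])

lemma M01_norm_integral_mult_expi_le: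
  assumes f: "integrable M01 (f :: real \<Rightarrow> complex)"
  shows "norm (LINT x|M01. f x * expi k x) \<le> L1 f"
  using M01_norm_integral_mult_le[OF f continuous_on_expi, of k 1] by simp

text \<open>In contrast to \<open>fourier\<close> the argument is complex valued, as needed for
  eigenfunctions, their derivatives and trigonometric polynomials.\<close>

definition fcoeff :: "(real \<Rightarrow> complex) \<Rightarrow> int \<Rightarrow> complex" where
  "fcoeff f k = (LINT x|M01. f x * expi (- k) x)"

lemma integral_M01: "(LINT x|M01. f x) = (LINT x:{0..1}|lebesgue. (f x :: 'a::{second_countable_topology,banach}))"
  by (simp add: integral_restrict_space set_lebesgue_integral_def)

lemma integrable_M01: "integrable M01 f \<longleftrightarrow> set_integrable lebesgue {0..1} (f :: real \<Rightarrow> 'a::{second_countable_topology,banach})"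
  by (simp add: integrable_restrict_space set_integrable_def)

lemma fourier_eq_fcoeff: "fourier f k = fcoeff (\<lambda>x. of_real (f x)) k"
  unfolding fourier_def fcoeff_def integral_M01[symmetric]
  by (rule Bochner_Integration.integral_cong) (auto simp: expi_def cis_conv_exp mult_ac)

lemma has_integral_expi:
  assumes "k \<noteq> 0" "x \<ge> 0"
  shows "(expi k has_integral (expi k x - 1) / (2 * pi * \<i> * k)) {0..x}"
proof -
  have "(expi k has_integral (\<lambda>x. expi k x / (2 * pi * \<i> * k)) x - (\<lambda>x. expi k x / (2 * pi * \<i> * k)) 0) {0..x}"
  proof (rule fundamental_theorem_of_calculus)
    fix x :: real
    have "((\<lambda>z. exp (2 * pi * \<i> * k * z) / (2 * pi * \<i> * k)) has_field_derivative
            exp (2 * pi * \<i> * k * of_real x)) (at (of_real x))"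
      using assms by (auto intro!: derivative_eq_intros simp: field_simps)
    from has_vector_derivative_real_field[OF this]
    show "((\<lambda>x. expi k x / (2 * pi * \<i> * k)) has_vector_derivative expi k x) (at x within {0..y})" for y
      by (simp add: expi_def cis_conv_exp mult_ac)
  qed (use assms in auto)
  then show ?thesis by (simp add: diff_divide_distrib)
qed

lemma integral_expi: "(LINT x|M01. expi k x) = (if k = 0 then 1 else 0)"
proof (cases "k = 0")
  case False
  have "integral\<^sup>L M01 (expi k) = integral {0..1} (expi k)"
    by (intro lebesgue_integral_eq_integral M01_integrable_continuous continuous_intros) auto
  then show ?thesis using has_integral_expi[OF False, of 1] False by (simp add: integral_unique)
qed simp

lemma fcoeff_expi: "fcoeff (expi a) b = (if a = b then 1 else 0)"
  unfolding fcoeff_def expi_add[symmetric] by (simp add: integral_expi)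

lemma fcoeff_add:
  assumes "integrable M01 f" "integrable M01 g"
  shows "fcoeff (\<lambda>x. f x + g x) k = fcoeff f k + fcoeff g k"
  unfolding fcoeff_def distrib_right
  using assms by (intro Bochner_Integration.integral_add M01_integrable_mult continuous_intros)

lemma fcoeff_diff:
  assumes "integrable M01 f" "integrable M01 g"
  shows "fcoeff (\<lambda>x. f x - g x) k = fcoeff f k - fcoeff g k"
  unfolding fcoeff_def left_diff_distrib
  using assms by (intro Bochner_Integration.integral_diff M01_integrable_mult continuous_intros)

lemma fcoeff_cmult: "fcoeff (\<lambda>x. c * f x) k = c * fcoeff f k"
  unfolding fcoeff_def mult.assoc by simp

lemma norm_fcoeff_le:
  "integrable M01 f \<Longrightarrow> norm (fcoeff f k) \<le> L1 f"
  unfolding fcoeff_def by (rule M01_norm_integral_mult_expi_le)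

lemma fcoeff_mult_expi: "fcoeff (\<lambda>x. f x * expi a x) k = fcoeff f (k - a)"
  unfolding fcoeff_def mult.assoc expi_add[symmetric] by (simp add: algebra_simps)

lemma fcoeff_cong: "(\<And>x. x \<in> {0..1} \<Longrightarrow> f x = g x) \<Longrightarrow> fcoeff f k = fcoeff g k"
  unfolding fcoeff_def by (rule Bochner_Integration.integral_cong) auto

subsection \<open>Density of trigonometric polynomials\<close>

text \<open>Trigonometric polynomials as a closure: products, continuity and the vanishing of high
  coefficients follow by rule induction, without explicit coefficient lists.\<close>

inductive trig :: "(real \<Rightarrow> complex) \<Rightarrow> bool" where
  expi: "trig (expi k)"
| cmult: "trig f \<Longrightarrow> trig (\<lambda>x. c * f x)"
| add: "trig f \<Longrightarrow> trig g \<Longrightarrow> trig (\<lambda>x. f x + g x)"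

lemma trig_mult_expi: "trig f \<Longrightarrow> trig (\<lambda>x. expi k x * f x)"
proof (induction rule: trig.induct)
  case (expi l)
  then show ?case using trig.expi[of "k + l"] by (simp add: expi_add[abs_def])
next
  case (cmult f c)
  then show ?case using trig.cmult[OF cmult.IH, of c] by (simp add: mult_ac)
next
  case (add f g)
  then show ?case using trig.add[OF add.IH] by (simp add: distrib_left)
qed

lemma trig_mult: "trig f \<Longrightarrow> trig g \<Longrightarrow> trig (\<lambda>x. f x * g x)"
proof (induction rule: trig.induct)
  case (expi l)
  then show ?case by (rule trig_mult_expi)
next
  case (cmult f c)
  then show ?case using trig.cmult[OF cmult.IH, of c] by (simp add: mult_ac)
next
  case (add f h)
  then show ?case using trig.add[OF add.IH] by (simp add: distrib_right)
qed

lemma trig_continuous: "trig f \<Longrightarrow> continuous_on S f"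
  by (induction rule: trig.induct) (intro continuous_intros; assumption)+

lemma trig_integrable: "trig f \<Longrightarrow> integrable M01 f"
  by (intro M01_integrable_continuous trig_continuous)

lemma trig_const: "trig (\<lambda>x. c)"
  using trig.cmult[OF trig.expi[of 0], of c] by simp

lemma trig_coeffs_finite: "trig f \<Longrightarrow> \<exists>N::int. \<forall>k. \<bar>k\<bar> > N \<longrightarrow> fcoeff f k = 0"
proof (induction rule: trig.induct)
  case (expi l)
  then show ?case by (intro exI[of _ "\<bar>l\<bar>"]) (auto simp: fcoeff_expi)
next
  case (cmult f c)
  then show ?case by (auto simp: fcoeff_cmult)
next
  case (add f g)
  then obtain N1 N2 where "\<forall>k. \<bar>k\<bar> > N1 \<longrightarrow> fcoeff f k = 0" "\<forall>k. \<bar>k\<bar> > N2 \<longrightarrow> fcoeff g k = 0" by blast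
  then show ?case using add.hyps by (intro exI[of _ "max N1 N2"]) (auto simp: fcoeff_add trig_integrable)
qed

text \<open>Stone-Weierstrass on the unit circle, where periodicity is built in: the functions whose
  pull-back is in \<open>trig\<close> form an algebra containing the constants and both coordinates,
  which separate points.\<close>

lemma trig_approx_circle:
  fixes f :: "complex \<Rightarrow> real"
  assumes "continuous_on (sphere 0 1) f" "e > 0"
  shows "\<exists>g. trig g \<and> (\<forall>x. norm (of_real (f (cis (2 * pi * x))) - g x) < e)"
proof -
  define P where "P g \<longleftrightarrow> continuous_on (sphere 0 1) g \<and> trig (\<lambda>x. of_real (g (cis (2 * pi * x))))"
    for g :: "complex \<Rightarrow> real"
  have cos: "trig (\<lambda>x. of_real (Re (cis (2 * pi * x))))"
  proof -
    have "trig (\<lambda>x. (1/2) * expi 1 x + (1/2) * expi (-1) x)"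
      by (intro trig.intros)
    moreover have "(1/2) * expi 1 x + (1/2) * expi (-1) x = of_real (Re (cis (2 * pi * x)))" for x
      by (auto simp: expi_def complex_eq_iff)
    ultimately show ?thesis by simp
  qed
  have sin: "trig (\<lambda>x. of_real (Im (cis (2 * pi * x))))"
  proof -
    have "trig (\<lambda>x. (-\<i>/2) * expi 1 x + (\<i>/2) * expi (-1) x)"
      by (intro trig.intros)
    moreover have "(-\<i>/2) * expi 1 x + (\<i>/2) * expi (-1) x = of_real (Im (cis (2 * pi * x)))" for x
      by (auto simp: expi_def complex_eq_iff)
    ultimately show ?thesis by simp
  qed
  have "\<exists>g. P g \<and> (\<forall>x\<in>sphere 0 1. \<bar>f x - g x\<bar> < e)"
  proof (rule Stone_Weierstrass_HOL)
    show "P (\<lambda>x. c)" for c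
      by (auto simp: P_def intro: trig_const)
    show "P (\<lambda>x. f x + g x)" "P (\<lambda>x. f x * g x)" if "P f \<and> P g" for f g
      using that by (auto simp: P_def intro!: continuous_intros trig_mult trig.add)
    show "\<exists>f. P f \<and> f x \<noteq> f y" if "x \<in> sphere 0 1 \<and> y \<in> sphere 0 1 \<and> x \<noteq> y" for x y
    proof -
      have "P Re" "P Im" using cos sin by (auto simp: P_def intro!: continuous_intros)
      then show ?thesis using that complex_eq_iff by blast
    qed
  qed (use assms in \<open>auto simp: P_def\<close>)
  then obtain g where g: "P g" "\<And>x. x \<in> sphere 0 1 \<Longrightarrow> \<bar>f x - g x\<bar> < e" by blast
  have "norm (complex_of_real (f (cis (2 * pi * x))) - of_real (g (cis (2 * pi * x)))) < e" for x
    using g(2)[of "cis (2 * pi * x)"] by (simp flip: of_real_diff)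
  then show ?thesis using g(1) unfolding P_def by blast
qed

text \<open>The parametrization of the circle identifies only 0 and 1, so it suffices that one of
  the two points is interior.\<close>

lemma cis_2pi_inj:
  assumes "cis (2 * pi * x) = cis (2 * pi * y)" "x \<in> {0<..<1}" "y \<in> {0..1}"
  shows "x = y"
proof -
  have e1: "exp (\<i> * (2 * complex_of_real pi)) = 1"
    using exp_two_pi_i' by (subst mult.commute[of 2])
  have "Arg2pi (cis (2 * pi * x)) = 2 * pi * x"
    using assms(2) by (intro Arg2pi_unique[of 1]) (auto simp: cis_conv_exp)
  moreover have "Arg2pi (cis (2 * pi * y)) = (if y = 1 then 0 else 2 * pi * y)"
    using assms(3) e1 by (intro Arg2pi_unique[of 1]) (auto simp: cis_conv_exp)
  ultimately have "2 * pi * x = (if y = 1 then 0 else 2 * pi * y)"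
    using assms(1) by metis
  then show ?thesis using assms(2) by (auto split: if_splits)
qed

text \<open>Up to the end points, which the circle identifies, \<open>A\<close> lies between a
  closed \<open>K\<close> and an open \<open>U\<close> with small differences. The images of
  \<open>K\<close> and of the complement of \<open>U\<close> on the circle are disjoint and compact.
  A Urysohn function for them agrees with the indicator outside a small set and is uniformly close
  to some \<open>trig\<close> function.\<close>

lemma trig_dense_indicator:
  assumes A: "A \<in> sets M01" and e: "e > 0"
  shows "\<exists>g. trig g \<and> (LINT x|M01. norm (indicator A x - g x)) < e"
proof -
  define A' where "A' = A \<inter> {0<..<1}"
  have A': "A' \<in> sets lebesgue" and AI: "A \<subseteq> {0..1}"
    using A by (auto simp: A'_def sets_restrict_space intro!: sets.Int)
  obtain K where K: "closed K" "K \<subseteq> A'" "A' - K \<in> lmeasurable" "emeasure lebesgue (A' - K) < ennreal (e/4)"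
    using sets_lebesgue_inner_closed[OF A', of "e/4"] e by auto
  obtain U where U: "open U" "A' \<subseteq> U" "U - A' \<in> lmeasurable" "emeasure lebesgue (U - A') < ennreal (e/4)"
    using sets_lebesgue_outer_open[OF A', of "e/4"] e by auto
  have cK: "compact K"
    using K(1,2) by (intro compact_eq_bounded_closed[THEN iffD2] conjI bounded_subset[OF bounded_closed_interval[of 0 1]])
      (auto simp: A'_def)
  define U' where "U' = U \<inter> {0<..<1}"
  define S where "S = (\<lambda>x. cis (2 * pi * x)) ` K"
  define T where "T = (\<lambda>x. cis (2 * pi * x)) ` ({0..1} - U')"
  have cT': "compact ({0..1::real} - U')"
    using U(1) by (auto simp: U'_def intro!: compact_diff)
  have "compact S" "compact T"
    unfolding S_def T_def using cK cT' by (auto intro!: compact_continuous_image continuous_intros)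
  then have "closed S" "closed T" by (auto intro: compact_imp_closed)
  moreover have "S \<inter> T = {}"
  proof -
    have False if "x \<in> K" "y \<in> {0..1} - U'" "cis (2 * pi * x) = cis (2 * pi * y)" for x y
    proof -
      have "x \<in> U'" "x \<in> {0<..<1}" using that(1) K(2) U(2) by (auto simp: A'_def U'_def)
      with cis_2pi_inj[OF that(3)] that(2) show False by auto
    qed
    then show ?thesis unfolding S_def T_def by blast
  qed
  ultimately obtain f :: "complex \<Rightarrow> real" where f: "continuous_on UNIV f"
      "\<And>x. f x \<in> closed_segment 1 0" "\<And>x. x \<in> S \<Longrightarrow> f x = 1" "\<And>x. x \<in> T \<Longrightarrow> f x = 0"
    using Urysohn[of S T "1::real" 0] by metis
  have f01: "0 \<le> f x" "f x \<le> 1" for x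
    using f(2)[of x] by (auto simp: closed_segment_eq_real_ivl)
  obtain g where g: "trig g" "\<And>x. norm (of_real (f (cis (2 * pi * x))) - g x) < e/4"
    using trig_approx_circle[OF continuous_on_subset[OF f(1)], of "e/4"] e by auto
  \<comment> \<open>The only interior points where the Urysohn function may differ from the
    indicator. They cost e/2 in measure, the uniform approximation costs e/4.\<close>
  define B where "B = ((A' - K) \<union> (U - A')) \<inter> {0..1}"
  have Bm2: "A' - K \<in> sets lebesgue" "U - A' \<in> sets lebesgue"
    by (rule fmeasurableD[OF K(3)], rule fmeasurableD[OF U(3)])
  have "B \<in> sets lebesgue"
    unfolding B_def by (intro sets.Int sets.Un Bm2) auto
  then have Bm: "B \<in> sets M01"
    by (subst sets_restrict_space_iff) (auto simp: B_def)
  have mB: "measure M01 B \<le> e/2"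
  proof -
    have "measure M01 B = measure lebesgue B"
      by (intro measure_restrict_space) (auto simp: B_def)
    also have "\<dots> \<le> measure lebesgue ((A' - K) \<union> (U - A'))"
      by (intro measure_mono_fmeasurable fmeasurable.Un K U \<open>B \<in> sets lebesgue\<close>) (auto simp: B_def)
    also have "\<dots> \<le> measure lebesgue (A' - K) + measure lebesgue (U - A')"
      by (intro measure_Un_le Bm2)
    also have "\<dots> \<le> e/4 + e/4"
      using K(3,4) U(3,4) e by (intro add_mono) (auto simp: emeasure_eq_measure2 ennreal_less_iff)
    finally show ?thesis by simp
  qed
  have pt: "norm (indicator A x - g x) \<le> indicator B x + e/4" if x: "x \<in> {0<..<1}" for x
  proof -
    have "norm (indicator A x - of_real (f (cis (2 * pi * x))) :: complex) \<le> indicator B x"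
    proof (cases "x \<in> B")
      case True
      have "norm (indicator A x - of_real (f (cis (2 * pi * x))) :: complex)
            = \<bar>indicator A x - f (cis (2 * pi * x))\<bar>"
        by (metis of_real_indicator norm_of_real of_real_diff)
      also have "\<dots> \<le> 1" using f01[of "cis (2 * pi * x)"] by (auto simp: indicator_def abs_if)
      finally show ?thesis using True by simp
    next
      case False
      then consider "x \<in> K" | "x \<notin> U" using x by (auto simp: B_def)
      then show ?thesis
      proof cases
        case 1
        then have "f (cis (2 * pi * x)) = 1" "x \<in> A" using K(2) by (auto intro!: f(3) simp: S_def A'_def)
        then show ?thesis by simp
      next
        case 2
        then have "f (cis (2 * pi * x)) = 0" "x \<notin> A" using U(2) x by (auto intro!: f(4) simp: T_def A'_def U'_def)
        then show ?thesis by simp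
      qed
    qed
    moreover have "norm (indicator A x - g x) \<le>
       norm (indicator A x - of_real (f (cis (2 * pi * x))) :: complex) + norm (of_real (f (cis (2 * pi * x))) - g x)"
      using norm_triangle_ineq[of "indicator A x - of_real (f (cis (2 * pi * x)))" "of_real (f (cis (2 * pi * x))) - g x"]
      by simp
    ultimately show ?thesis using g(2)[of x] by linarith
  qed
  have iA: "integrable M01 (indicator A :: real \<Rightarrow> complex)"
    using A by (intro M01.integrable_const_bound[where B=1] AE_I2) (auto simp: indicator_def)
  have iB: "integrable M01 (indicator B :: real \<Rightarrow> real)"
    using Bm by (intro M01.integrable_const_bound[where B=1] AE_I2) (auto simp: indicator_def)
  have "(LINT x|M01. norm (indicator A x - g x)) \<le> (LINT x|M01. indicator B x + e/4)"
  proof (rule integral_mono_AE)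
    show "integrable M01 (\<lambda>x. norm (indicator A x - g x))"
      using iA trig_integrable[OF g(1)] by (intro integrable_norm Bochner_Integration.integrable_diff)
    show "integrable M01 (\<lambda>x. indicator B x + e/4)"
      using iB by (intro Bochner_Integration.integrable_add) auto
    have "AE x in lebesgue. x \<noteq> (0::real) \<and> x \<noteq> 1"
      using AE_completion[OF AE_lborel_singleton[of "0::real"]] AE_completion[OF AE_lborel_singleton[of "1::real"]]
      by (rule AE_conjI)
    then have "AE x in M01. x \<noteq> 0 \<and> x \<noteq> 1"
      by (subst AE_restrict_space_iff) (auto elim: AE_mp)
    then show "AE x in M01. norm (indicator A x - g x) \<le> indicator B x + e/4"
      using AE_space by eventually_elim (intro pt, auto)
  qed
  also have "\<dots> = measure M01 B + e/4"
    using iB by (subst Bochner_Integration.integral_add) (auto simp: B_def Int_assoc)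
  also have "\<dots> < e" using mB e by simp
  finally show ?thesis using g(1) by blast
qed

lemma trig_dense:
  fixes f :: "real \<Rightarrow> complex"
  assumes "integrable M01 f"
  shows "\<forall>e>0. \<exists>g. trig g \<and> (LINT x|M01. norm (f x - g x)) < e"
  using assms
proof (induction rule: integrable_induct)
  case (base A c)
  show ?case
  proof (intro allI impI)
    fix e :: real assume "e > 0"
    then have "e / (norm c + 1) > 0" by (simp add: add_nonneg_pos)
    then obtain g where g: "trig g" "(LINT x|M01. norm (indicator A x - g x)) < e / (norm c + 1)"
      using trig_dense_indicator[OF base(1)] by blast
    have "(LINT x|M01. norm (indicator A x *\<^sub>R c - c * g x)) = (LINT x|M01. norm c * norm (indicator A x - g x))"
      by (intro Bochner_Integration.integral_cong refl)
        (auto simp: norm_mult[symmetric] scaleR_conv_of_real of_real_indicator algebra_simps)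
    also have "\<dots> = norm c * (LINT x|M01. norm (indicator A x - g x))" by simp
    also have "\<dots> \<le> norm c * (e / (norm c + 1))"
      using g(2) by (intro mult_left_mono) auto
    also have "\<dots> < e"
    proof -
      have "norm c * e < e * (norm c + 1)" using \<open>e > 0\<close> by (simp add: algebra_simps)
      then show ?thesis by (simp add: pos_divide_less_eq add_nonneg_pos)
    qed
    finally show "\<exists>g. trig g \<and> (LINT x|M01. norm (indicator A x *\<^sub>R c - g x)) < e"
      using trig.cmult[OF g(1)] by blast
  qed
next
  case (add f h)
  show ?case
  proof (intro allI impI)
    fix e :: real assume "e > 0"
    then have "e / 2 > 0" by simp
    then obtain g1 g2 where g: "trig g1" "(LINT x|M01. norm (f x - g1 x)) < e / 2"
        "trig g2" "(LINT x|M01. norm (h x - g2 x)) < e / 2"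
      using add.IH by meson
    have int: "integrable M01 (\<lambda>x. f x - g1 x)" "integrable M01 (\<lambda>x. h x - g2 x)"
      using add.hyps g by (auto intro: trig_integrable)
    have "(LINT x|M01. norm (f x + h x - (g1 x + g2 x))) \<le>
          (LINT x|M01. norm (f x - g1 x) + norm (h x - g2 x))"
      using int add.hyps trig_integrable[OF g(1)] trig_integrable[OF g(3)]
      by (intro integral_mono integrable_norm Bochner_Integration.integrable_add Bochner_Integration.integrable_diff)
        (auto simp: add_diff_add intro: norm_triangle_ineq)
    also have "\<dots> = (LINT x|M01. norm (f x - g1 x)) + (LINT x|M01. norm (h x - g2 x))"
      using int by (intro Bochner_Integration.integral_add integrable_norm)
    also have "\<dots> < e" using g by simp
    finally show "\<exists>g. trig g \<and> (LINT x|M01. norm (f x + h x - g x)) < e"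
      using trig.add[OF g(1,3)] by blast
  qed
next
  case (lim f s)
  show ?case
  proof (intro allI impI)
    fix e :: real assume "e > 0"
    have "(\<lambda>i. LINT x|M01. norm (f x - s i x)) \<longlonglongrightarrow> (LINT x|M01. 0)"
    proof (rule integral_dominated_convergence)
      show "integrable M01 (\<lambda>x. 3 * norm (f x))" using lim.hyps by auto
      show "AE x in M01. (\<lambda>i. norm (f x - s i x)) \<longlonglongrightarrow> 0"
        proof (rule AE_I2)
        fix x assume "x \<in> space M01"
        from tendsto_norm[OF tendsto_diff[OF tendsto_const lim.hyps(2)[OF this]], of "f x"]
        show "(\<lambda>i. norm (f x - s i x)) \<longlonglongrightarrow> 0" by simp
      qed
      show "AE x in M01. norm (norm (f x - s i x)) \<le> 3 * norm (f x)" for i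
      proof (rule AE_I2)
        fix x assume "x \<in> space M01"
        from lim.hyps(3)[OF this, of i] norm_triangle_ineq4[of "f x" "s i x"]
        show "norm (norm (f x - s i x)) \<le> 3 * norm (f x)" by simp
      qed
    qed (use lim.hyps in auto)
    then have "(\<lambda>i. LINT x|M01. norm (f x - s i x)) \<longlonglongrightarrow> 0" by simp
    then have "\<forall>\<^sub>F i in sequentially. (LINT x|M01. norm (f x - s i x)) < e/2"
      using \<open>e > 0\<close> by (intro order_tendstoD) auto
    then obtain i where i: "(LINT x|M01. norm (f x - s i x)) < e/2"
      by (auto simp: eventually_sequentially)
    obtain g where g: "trig g" "(LINT x|M01. norm (s i x - g x)) < e/2"
      using lim.IH[of i] \<open>e > 0\<close> by (meson half_gt_zero)
    have int: "integrable M01 (\<lambda>x. f x - s i x)" "integrable M01 (\<lambda>x. s i x - g x)"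
      using lim.hyps g by (auto intro: trig_integrable)
    have "(LINT x|M01. norm (f x - g x)) \<le> (LINT x|M01. norm (f x - s i x) + norm (s i x - g x))"
      using int lim.hyps(4) lim.hyps(1)[of i] trig_integrable[OF g(1)]
      by (intro integral_mono integrable_norm Bochner_Integration.integrable_add Bochner_Integration.integrable_diff)
        (auto intro: order_trans[OF _ norm_triangle_ineq])
    also have "\<dots> = (LINT x|M01. norm (f x - s i x)) + (LINT x|M01. norm (s i x - g x))"
      using int by (intro Bochner_Integration.integral_add integrable_norm)
    also have "\<dots> < e" using g i by simp
    finally show "\<exists>g. trig g \<and> (LINT x|M01. norm (f x - g x)) < e" using g(1) by blast
  qed
qed

text \<open>The density principle behind the coefficient identities: \<open>L\<close> is taken as
  the difference of the two sides. It vanishes on \<open>trig\<close> by linearity, and the L1 bound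
  carries this over to the limit.\<close>

lemma L1_functional_eq_0:
  fixes L :: "(real \<Rightarrow> complex) \<Rightarrow> complex"
  assumes add: "\<And>f g. integrable M01 f \<Longrightarrow> integrable M01 g \<Longrightarrow> L (\<lambda>x. f x + g x) = L f + L g"
    and cmult: "\<And>f c. integrable M01 f \<Longrightarrow> L (\<lambda>x. c * f x) = c * L f"
    and bound: "\<And>f. integrable M01 f \<Longrightarrow> norm (L f) \<le> C * L1 f"
    and expi: "\<And>k. L (expi k) = 0"
    and f: "integrable M01 f"
  shows "L f = 0"
proof -
  have trig0: "L g = 0" if "trig g" for g
    using that
  proof (induction rule: trig.induct)
    case (cmult f c)
    then show ?case using assms(2)[of f c] trig_integrable by simp
  next
    case (add f g)
    then show ?case using assms(1)[of f g] trig_integrable by simp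
  qed (rule expi)
  have "norm (L f) \<le> e" if "e > 0" for e
  proof -
    have "e / (\<bar>C\<bar> + 1) > 0" using that by (simp add: add_nonneg_pos)
    then obtain g where g: "trig g" "(LINT x|M01. norm (f x - g x)) < e / (\<bar>C\<bar> + 1)"
      using trig_dense[OF f] by blast
    have int: "integrable M01 (\<lambda>x. f x - g x)" using f g by (auto intro: trig_integrable)
    have "L (\<lambda>x. (f x - g x) + g x) = L (\<lambda>x. f x - g x) + L g"
      by (rule add) (use int g in \<open>auto intro: trig_integrable\<close>)
    then have "norm (L f) = norm (L (\<lambda>x. f x - g x))" using trig0[OF g(1)] by simp
    also have "\<dots> \<le> C * (LINT x|M01. norm (f x - g x))" by (rule bound[OF int])
    also have "\<dots> \<le> (\<bar>C\<bar> + 1) * (LINT x|M01. norm (f x - g x))"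
      by (intro mult_right_mono integral_nonneg_AE) auto
    also have "\<dots> \<le> e" using g(2) by (simp add: field_simps add_nonneg_pos)
    finally show ?thesis .
  qed
  then have "norm (L f) \<le> 0" by (rule field_le_epsilon[of _ 0, simplified])
  then show ?thesis by simp
qed

subsection \<open>Products and primitives\<close>

abbreviation abs_summable :: "('i \<Rightarrow> 'a::real_normed_vector) \<Rightarrow> 'i set \<Rightarrow> bool" where
  "abs_summable f A \<equiv> (\<lambda>i. norm (f i)) summable_on A"

lemma bij_minus_int: "bij_betw (\<lambda>i::int. s - i) UNIV UNIV"
  by (rule bij_betwI[of _ _ _ "\<lambda>i. s - i"]) auto

lemma abs_summable_reflect:
  fixes b :: "int \<Rightarrow> 'a::real_normed_vector"
  shows "abs_summable (\<lambda>i. b (k - i)) UNIV \<longleftrightarrow> abs_summable b UNIV"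
    and "(\<Sum>\<^sub>\<infinity>i. b (k - i)) = (\<Sum>\<^sub>\<infinity>i. b i)"
proof -
  show "abs_summable (\<lambda>i. b (k - i)) UNIV \<longleftrightarrow> abs_summable b UNIV"
    using summable_on_reindex_bij_betw[OF bij_minus_int, of "\<lambda>i. norm (b i)"] by simp
  show "(\<Sum>\<^sub>\<infinity>i. b (k - i)) = (\<Sum>\<^sub>\<infinity>i. b i)"
    using infsum_reindex_bij_betw[OF bij_minus_int, of b] by simp
qed

lemma abs_summable_bounded_mult:
  fixes a b :: "'i \<Rightarrow> complex"
  assumes "\<And>i. i \<in> A \<Longrightarrow> norm (a i) \<le> C" "abs_summable b A"
  shows "abs_summable (\<lambda>i. a i * b i) A"
    and "norm (\<Sum>\<^sub>\<infinity>i\<in>A. a i * b i) \<le> C * (\<Sum>\<^sub>\<infinity>i\<in>A. norm (b i))"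
proof -
  have C: "(\<lambda>i. C * norm (b i)) summable_on A"
    using assms(2) by (rule summable_on_cmult_right)
  have le: "norm (a i * b i) \<le> C * norm (b i)" if "i \<in> A" for i
    using assms(1)[OF that] by (simp add: norm_mult mult_right_mono)
  show s: "abs_summable (\<lambda>i. a i * b i) A"
    by (rule Infinite_Sum.abs_summable_on_comparison_test'[OF C]) (rule le)
  have "norm (\<Sum>\<^sub>\<infinity>i\<in>A. a i * b i) \<le> (\<Sum>\<^sub>\<infinity>i\<in>A. norm (a i * b i))"
    by (rule norm_infsum_bound[OF s])
  also have "\<dots> \<le> (\<Sum>\<^sub>\<infinity>i\<in>A. C * norm (b i))"
    by (rule infsum_mono[OF s C]) (rule le)
  also have "\<dots> = C * (\<Sum>\<^sub>\<infinity>i\<in>A. norm (b i))"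
    by (rule infsum_cmult_right')
  finally show "norm (\<Sum>\<^sub>\<infinity>i\<in>A. a i * b i) \<le> C * (\<Sum>\<^sub>\<infinity>i\<in>A. norm (b i))" .
qed

lemma infsum_single:
  fixes f :: "'i \<Rightarrow> 'a::{topological_comm_monoid_add, t2_space}"
  assumes "a \<in> A" "\<And>i. i \<in> A \<Longrightarrow> i \<noteq> a \<Longrightarrow> f i = 0"
  shows "(\<Sum>\<^sub>\<infinity>i\<in>A. f i) = f a"
proof -
  have "(\<Sum>\<^sub>\<infinity>i\<in>A. f i) = (\<Sum>\<^sub>\<infinity>i\<in>{a}. f i)"
    by (rule infsum_cong_neutral) (use assms in auto)
  then show ?thesis by simp
qed

text \<open>The coefficients of \<open>f\<close> are only bounded, so those of \<open>g\<close> have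
  to be summable. Both sides are then bounded by a multiple of the L1 norm of \<open>f\<close>, and
  for \<open>f = expi a\<close> the sum has a single term.\<close>

theorem fcoeff_mult:
  assumes f: "integrable M01 f" and g: "continuous_on {0..1} g" and gs: "abs_summable (fcoeff g) UNIV"
  shows "fcoeff (\<lambda>x. f x * g x) k = (\<Sum>\<^sub>\<infinity>i. fcoeff f i * fcoeff g (k - i))"
proof -
  define L where "L f = fcoeff (\<lambda>x. f x * g x) k - (\<Sum>\<^sub>\<infinity>i. fcoeff f i * fcoeff g (k - i))" for f
  have gs': "abs_summable (\<lambda>i. fcoeff g (k - i)) UNIV"
    using gs by (simp add: abs_summable_reflect)
  have s: "(\<lambda>i. fcoeff f i * fcoeff g (k - i)) summable_on UNIV" if "integrable M01 f" for f
    by (rule abs_summable_summable, rule abs_summable_bounded_mult[OF _ gs'])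
      (rule norm_fcoeff_le[OF that])
  obtain B where B: "\<And>x. x \<in> {0..1} \<Longrightarrow> norm (g x) \<le> B"
    using M01_continuous_bounded[OF g] by metis
  have "L f = 0"
  proof (rule L1_functional_eq_0[where C = "B + (\<Sum>\<^sub>\<infinity>i. norm (fcoeff g i))", OF _ _ _ _ f])
    fix f h :: "real \<Rightarrow> complex" assume fh: "integrable M01 f" "integrable M01 h"
    have "fcoeff (\<lambda>x. (f x + h x) * g x) k = fcoeff (\<lambda>x. f x * g x) k + fcoeff (\<lambda>x. h x * g x) k"
      unfolding distrib_right by (intro fcoeff_add M01_integrable_mult fh g)
    moreover have "(\<Sum>\<^sub>\<infinity>i. fcoeff (\<lambda>x. f x + h x) i * fcoeff g (k - i)) =
        (\<Sum>\<^sub>\<infinity>i. fcoeff f i * fcoeff g (k - i)) + (\<Sum>\<^sub>\<infinity>i. fcoeff h i * fcoeff g (k - i))"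
      unfolding fcoeff_add[OF fh] distrib_right by (intro infsum_add s fh)
    ultimately show "L (\<lambda>x. f x + h x) = L f + L h" by (simp add: L_def)
  next
    fix f c
    show "L (\<lambda>x. c * f x) = c * L f"
      unfolding L_def fcoeff_cmult mult.assoc infsum_cmult_right' right_diff_distrib by simp
  next
    fix f :: "real \<Rightarrow> complex" assume f: "integrable M01 f"
    have 1: "norm (fcoeff (\<lambda>x. f x * g x) k) \<le> B * L1 f"
      unfolding fcoeff_def mult.assoc
      by (rule M01_norm_integral_mult_le[OF f]) (use B in \<open>auto simp: norm_mult intro!: continuous_intros g\<close>)
    have "norm (\<Sum>\<^sub>\<infinity>i. fcoeff f i * fcoeff g (k - i))
        \<le> L1 f * (\<Sum>\<^sub>\<infinity>i. norm (fcoeff g (k - i)))"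
      by (rule abs_summable_bounded_mult[OF _ gs']) (rule norm_fcoeff_le[OF f])
    also have "(\<Sum>\<^sub>\<infinity>i. norm (fcoeff g (k - i))) = (\<Sum>\<^sub>\<infinity>i. norm (fcoeff g i))"
      by (rule abs_summable_reflect(2))
    finally have 2: "norm (\<Sum>\<^sub>\<infinity>i. fcoeff f i * fcoeff g (k - i))
        \<le> L1 f * (\<Sum>\<^sub>\<infinity>i. norm (fcoeff g i))" .
    show "norm (L f) \<le> (B + (\<Sum>\<^sub>\<infinity>i. norm (fcoeff g i))) * L1 f"
      unfolding L_def using 1 2 norm_triangle_ineq4[of "fcoeff (\<lambda>x. f x * g x) k"]
      by (smt (verit) distrib_right mult.commute)
  next
    fix a
    have "(\<Sum>\<^sub>\<infinity>i. fcoeff (expi a) i * fcoeff g (k - i)) = fcoeff g (k - a)"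
      by (subst infsum_single[of a]) (auto simp: fcoeff_expi)
    then show "L (expi a) = 0"
      unfolding L_def by (simp add: mult.commute[of "expi a _"] fcoeff_mult_expi)
  qed
  then show ?thesis by (simp add: L_def)
qed

text \<open>By density the integral of \<open>h * g\<close> vanishes for all integrable
  \<open>h\<close>. The choice \<open>h = cnj g\<close> gives zero for the integral of |g|^2, and
  continuity makes this pointwise.\<close>

lemma fcoeff_eq_0_imp:
  assumes g: "continuous_on {0..1} g" and 0: "\<And>k. fcoeff g k = 0" and x: "x \<in> {0..1}"
  shows "g x = 0"
proof -
  obtain B where B: "\<And>x. x \<in> {0..1} \<Longrightarrow> norm (g x) \<le> B"
    using M01_continuous_bounded[OF g] by metis
  have gi: "integrable M01 (\<lambda>x. cnj (g x))"
    by (intro M01_integrable_continuous continuous_intros g)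
  have "(LINT x|M01. cnj (g x) * g x) = 0"
  proof (rule L1_functional_eq_0[where C = B, OF _ _ _ _ gi])
    fix f h :: "real \<Rightarrow> complex" assume fh: "integrable M01 f" "integrable M01 h"
    show "(LINT x|M01. (f x + h x) * g x) = (LINT x|M01. f x * g x) + (LINT x|M01. h x * g x)"
      unfolding distrib_right by (intro Bochner_Integration.integral_add M01_integrable_mult fh g)
  next
    show "(LINT x|M01. expi k x * g x) = 0" for k
      using 0[of "- k"] by (simp add: fcoeff_def mult.commute)
  next
    show "(LINT x|M01. c * f x * g x) = c * (LINT x|M01. f x * g x)" for c f
      by (simp add: mult.assoc)
  qed (use B g in \<open>auto intro: M01_norm_integral_mult_le\<close>)
  then have "(LINT x|M01. complex_of_real ((cmod (g x))\<^sup>2)) = 0"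
    by (simp add: complex_norm_square mult.commute[of "cnj _"] del: of_real_power)
  then have "(LINT x|M01. (cmod (g x))\<^sup>2) = 0"
    by (simp only: integral_complex_of_real of_real_eq_0_iff)
  moreover have c: "continuous_on {0..1} (\<lambda>x. (cmod (g x))\<^sup>2)"
    by (intro continuous_intros g)
  ultimately have "integral {0..1} (\<lambda>x. (cmod (g x))\<^sup>2) = 0"
    by (subst lebesgue_integral_eq_integral[symmetric]) (auto intro: M01_integrable_continuous)
  then have "((\<lambda>x. (cmod (g x))\<^sup>2) has_integral 0) (cbox 0 1)"
    using integrable_integral[OF integrable_continuous_interval[OF c]] by simp
  then have "(cmod (g x))\<^sup>2 = 0"
    by (rule has_integral_0_cbox_imp_0[rotated 2]) (use c x in auto)
  then show ?thesis by simp
qed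

section \<open>Primitives and periodic antiderivatives\<close>

definition prim :: "(real \<Rightarrow> complex) \<Rightarrow> real \<Rightarrow> complex" where
  "prim f x = (LINT t|M01. indicator {0..x} t * f t)"

lemma prim_integrable:
  fixes f :: "real \<Rightarrow> complex"
  assumes "integrable M01 f"
  shows "integrable M01 (\<lambda>t. indicator {0..x} t * f t)"
proof (rule Bochner_Integration.integrable_bound[OF assms])
  have "{0..1} \<inter> {0..x} \<in> sets lebesgue" by auto
  then have "(indicator {0..x} :: real \<Rightarrow> complex) \<in> borel_measurable M01"
    by (intro borel_measurable_indicator') (auto simp: sets_restrict_space intro!: exI[of _ "{0..x}"])
  then show "(\<lambda>t. indicator {0..x} t * f t) \<in> borel_measurable M01"
    using assms by auto
qed (auto simp: indicator_def)

lemma prim_eq_integral: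
  assumes f: "integrable M01 f" and x: "x \<in> {0..1}"
  shows "prim f x = integral {0..x} f"
proof -
  have "f absolutely_integrable_on {0..1}"
    using f unfolding integrable_M01 .
  then have a: "f absolutely_integrable_on {0..x}"
    by (rule set_integrable_subset) (use x in auto)
  have "prim f x = (LINT t:{0..1}|lebesgue. indicator {0..x} t * f t)"
    unfolding prim_def integral_M01 ..
  also have "\<dots> = (LINT t:{0..x}|lebesgue. f t)"
    unfolding set_lebesgue_integral_def
    by (rule Bochner_Integration.integral_cong) (use x in \<open>auto simp: indicator_def\<close>)
  also have "\<dots> = integral {0..x} f"
    by (rule set_lebesgue_integral_eq_integral[OF a])
  finally show ?thesis .
qed

lemma prim_eq_set_integral:
  assumes x: "x \<in> {0..1}"
  shows "prim f x = (LINT t:{0..x}|lebesgue. f t)"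
  unfolding prim_def integral_M01 set_lebesgue_integral_def
  by (rule Bochner_Integration.integral_cong) (use x in \<open>auto simp: indicator_def\<close>)

lemma continuous_on_prim [continuous_intros]:
  assumes f: "integrable M01 f"
  shows "continuous_on {0..1} (prim f)"
proof -
  have "f absolutely_integrable_on {0..1}"
    using f unfolding integrable_M01 .
  then have "f integrable_on {0..1}" by (rule set_lebesgue_integral_eq_integral)
  then have "continuous_on {0..1} (\<lambda>x. integral {0..x} f)"
    by (rule indefinite_integral_continuous_1)
  then show ?thesis using prim_eq_integral[OF f] continuous_on_cong by (metis (no_types, lifting))
qed

lemma norm_prim_le:
  assumes f: "integrable M01 f"
  shows "norm (prim f x) \<le> L1 f"
proof -
  have "norm (prim f x) \<le> (LINT t|M01. norm (indicator {0..x} t * f t))"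
    unfolding prim_def by (rule integral_norm_bound)
  also have "\<dots> \<le> L1 f"
    using f by (intro integral_mono integrable_norm prim_integrable) (auto simp: indicator_def)
  finally show ?thesis .
qed

lemma prim_0 [simp]: "prim f 0 = 0"
proof -
  have "AE x in lebesgue. indicat_real {0} x *\<^sub>R f x = 0"
    using AE_completion[OF AE_lborel_singleton[of "0::real"]] by eventually_elim auto
  then show ?thesis
    by (simp add: prim_eq_set_integral set_lebesgue_integral_def integral_eq_zero_AE)
qed

lemma prim_1: "prim f 1 = fcoeff f 0"
  unfolding prim_def fcoeff_def by (rule Bochner_Integration.integral_cong) auto

lemma prim_add:
  assumes "integrable M01 f" "integrable M01 g"
  shows "prim (\<lambda>x. f x + g x) x = prim f x + prim g x"
  unfolding prim_def distrib_left
  using assms by (intro Bochner_Integration.integral_add prim_integrable)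

lemma prim_cmult: "prim (\<lambda>x. c * f x) x = c * prim f x"
  unfolding prim_def by (simp add: mult.left_commute)

lemma prim_expi:
  assumes "x \<in> {0..1}"
  shows "prim (expi k) x = (if k = 0 then of_real x else (expi k x - 1) / (2 * pi * \<i> * k))"
proof (cases "k = 0")
  case True
  then have "prim (expi k) x = (LINT t:{0..x}|lebesgue. 1)"
    using assms by (simp add: prim_eq_set_integral)
  then show ?thesis using assms True by (simp add: set_integral_const of_real_def)
next
  case False
  have "prim (expi k) x = integral {0..x} (expi k)"
    using assms by (intro prim_eq_integral M01_integrable_continuous continuous_intros)
  then show ?thesis using has_integral_expi[of k x] False assms by (simp add: integral_unique)
qed

text \<open>The coefficient at \<open>0\<close> is removed twice, so that \<open>anti\<close> acts diagonally on the exponentials.\<close>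

definition anti0 :: "(real \<Rightarrow> complex) \<Rightarrow> real \<Rightarrow> complex" where
  "anti0 f x = prim f x - of_real x * fcoeff f 0"

definition anti :: "(real \<Rightarrow> complex) \<Rightarrow> real \<Rightarrow> complex" where
  "anti f x = anti0 f x - fcoeff (anti0 f) 0"

lemma continuous_on_anti0: "integrable M01 f \<Longrightarrow> continuous_on {0..1} (anti0 f)"
  unfolding anti0_def by (intro continuous_intros)

lemma continuous_on_anti [continuous_intros]: "integrable M01 f \<Longrightarrow> continuous_on {0..1} (anti f)"
  unfolding anti_def by (intro continuous_intros continuous_on_anti0)

lemma norm_anti0_le:
  assumes "integrable M01 f" "x \<in> {0..1}"
  shows "norm (anti0 f x) \<le> 2 * L1 f"
proof -
  have "norm (of_real x * fcoeff f 0) \<le> 1 * L1 f"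
    unfolding norm_mult using assms norm_fcoeff_le[OF assms(1), of 0] by (intro mult_mono) auto
  then show ?thesis
    unfolding anti0_def using norm_prim_le[OF assms(1), of x] norm_triangle_ineq4[of "prim f x"]
    by (smt (verit))
qed

lemma norm_anti_le:
  assumes "integrable M01 f" "x \<in> {0..1}"
  shows "norm (anti f x) \<le> 4 * L1 f"
proof -
  have i: "integrable M01 (anti0 f)"
    by (intro M01_integrable_continuous continuous_on_anti0 assms)
  have "norm (fcoeff (anti0 f) 0) \<le> (LINT x|M01. norm (anti0 f x))"
    by (rule norm_fcoeff_le[OF i])
  also have "\<dots> \<le> (LINT x|M01. 2 * L1 f)"
    using i norm_anti0_le[OF assms(1)] by (intro integral_mono integrable_norm) auto
  finally have "norm (fcoeff (anti0 f) 0) \<le> 2 * L1 f" by simp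
  then show ?thesis
    unfolding anti_def using norm_anti0_le[OF assms] norm_triangle_ineq4[of "anti0 f x"]
    by (smt (verit))
qed

lemma anti0_add:
  assumes "integrable M01 f" "integrable M01 g"
  shows "anti0 (\<lambda>x. f x + g x) = (\<lambda>x. anti0 f x + anti0 g x)"
  using assms by (auto simp: anti0_def prim_add fcoeff_add algebra_simps)

lemma anti_add:
  assumes "integrable M01 f" "integrable M01 g"
  shows "anti (\<lambda>x. f x + g x) = (\<lambda>x. anti f x + anti g x)"
  using assms by (auto simp: anti_def anti0_add fcoeff_add M01_integrable_continuous continuous_on_anti0)

lemma anti0_cmult: "anti0 (\<lambda>x. c * f x) = (\<lambda>x. c * anti0 f x)"
  by (auto simp: anti0_def prim_cmult fcoeff_cmult algebra_simps)

lemma anti_cmult: "anti (\<lambda>x. c * f x) = (\<lambda>x. c * anti f x)"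
  by (auto simp: anti_def anti0_cmult fcoeff_cmult algebra_simps)

lemma fcoeff_const: "fcoeff (\<lambda>x. c) k = (if k = 0 then c else 0)"
  using fcoeff_cmult[of c "expi 0" k] by (simp add: fcoeff_expi)

lemma anti_expi:
  assumes x: "x \<in> {0..1}"
  shows "anti (expi k) x = (if k = 0 then 0 else expi k x / (2 * pi * \<i> * k))"
proof (cases "k = 0")
  case True
  have "anti0 (expi 0) x = 0" if "x \<in> {0..1}" for x
    using that unfolding anti0_def by (simp add: prim_expi fcoeff_expi)
  moreover from this have "fcoeff (anti0 (expi 0)) 0 = fcoeff (\<lambda>x. 0) 0"
    by (intro fcoeff_cong)
  ultimately show ?thesis using x True by (simp add: anti_def fcoeff_const)
next
  case False
  define c where "c = 1 / (2 * pi * \<i> * k)"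
  have eq: "anti0 (expi k) x = c * expi k x - c" if "x \<in> {0..1}" for x
    using that False unfolding anti0_def by (simp add: prim_expi fcoeff_expi diff_divide_distrib c_def)
  then have "fcoeff (anti0 (expi k)) 0 = fcoeff (\<lambda>x. c * expi k x - c) 0"
    by (intro fcoeff_cong)
  also have "\<dots> = - c"
    using False by (subst fcoeff_diff)
      (auto simp: fcoeff_cmult fcoeff_expi fcoeff_const intro!: M01_integrable_continuous continuous_intros)
  finally show ?thesis using eq[OF x] False by (simp add: anti_def c_def)
qed

text \<open>Integration by parts for merely integrable \<open>f\<close>, by density. The constant 5
  is 4 from \<open>norm_anti_le\<close> plus 1, because |2 pi p| is at least 1 for p \<noteq>
  0.\<close>

theorem fcoeff_anti:
  assumes f: "integrable M01 f"
  shows "fcoeff (anti f) p = (if p = 0 then 0 else fcoeff f p / (2 * pi * \<i> * p))"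
proof -
  define L where "L f = fcoeff (anti f) p - (if p = 0 then 0 else fcoeff f p / (2 * pi * \<i> * p))" for f
  have "L f = 0"
  proof (rule L1_functional_eq_0[where C = 5, OF _ _ _ _ f])
    fix f h :: "real \<Rightarrow> complex" assume fh: "integrable M01 f" "integrable M01 h"
    then have "integrable M01 (anti f)" "integrable M01 (anti h)"
      by (auto intro!: M01_integrable_continuous continuous_intros)
    then show "L (\<lambda>x. f x + h x) = L f + L h"
      by (simp add: L_def anti_add fh fcoeff_add add_divide_distrib)
  next
    show "L (\<lambda>x. c * f x) = c * L f" for f c
      by (simp add: L_def anti_cmult fcoeff_cmult right_diff_distrib)
  next
    fix f :: "real \<Rightarrow> complex" assume f: "integrable M01 f"
    have i: "integrable M01 (anti f)" by (intro M01_integrable_continuous continuous_intros f)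
    have "norm (fcoeff (anti f) p) \<le> (LINT x|M01. norm (anti f x))"
      by (rule norm_fcoeff_le[OF i])
    also have "\<dots> \<le> (LINT x|M01. 4 * L1 f)"
      using i norm_anti_le[OF f] by (intro integral_mono integrable_norm) auto
    finally have 1: "norm (fcoeff (anti f) p) \<le> 4 * L1 f" by simp
    have 2: "norm (fcoeff f p / (2 * pi * \<i> * p)) \<le> L1 f" if "p \<noteq> 0"
    proof -
      have "1 * 1 \<le> (2 * pi) * \<bar>real_of_int p\<bar>"
        using that pi_gt3 by (intro mult_mono) auto
      then have "norm (fcoeff f p) / ((2 * pi) * \<bar>real_of_int p\<bar>) \<le> norm (fcoeff f p) / 1"
        by (intro divide_left_mono) auto
      then show ?thesis using norm_fcoeff_le[OF f, of p] by (simp add: norm_divide norm_mult)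
    qed
    show "norm (L f) \<le> 5 * L1 f"
    proof (cases "p = 0")
      case True
      have "0 \<le> L1 f" by (rule Bochner_Integration.integral_nonneg) simp
      moreover have "L f = fcoeff (anti f) p" using True by (simp add: L_def)
      ultimately show ?thesis using 1 by (simp only:)
    next
      case False
      then show ?thesis using 1 2[OF False] norm_triangle_ineq4[of "fcoeff (anti f) p" "fcoeff f p / (2 * pi * \<i> * p)"]
        by (simp add: L_def)
    qed
  next
    fix k
    have "fcoeff (anti (expi k)) p = fcoeff (\<lambda>x. (if k = 0 then 0 else 1 / (2 * pi * \<i> * k)) * expi k x) p"
      by (rule fcoeff_cong) (simp add: anti_expi)
    then show "L (expi k) = 0"
      by (simp add: L_def fcoeff_cmult fcoeff_expi)
  qed
  then show ?thesis by (simp add: L_def)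
qed

text \<open>Periodicity of \<open>F\<close> forces \<open>f\<close> to have mean zero, so
  \<open>F\<close> differs from \<open>anti f\<close> only by a constant, which affects only the
  coefficient at 0.\<close>

lemma fcoeff_primitive:
  assumes f: "integrable M01 f" and F: "\<And>x. x \<in> {0..1} \<Longrightarrow> F x = c + prim f x" and per: "F 1 = F 0"
  shows "continuous_on {0..1} F"
    and "fcoeff f 0 = 0"
    and "k \<noteq> 0 \<Longrightarrow> fcoeff F k = fcoeff f k / (2 * pi * \<i> * k)"
proof -
  have "continuous_on {0..1} (\<lambda>x. c + prim f x)" by (intro continuous_intros f)
  then show "continuous_on {0..1} F" using F continuous_on_cong by (metis (no_types, lifting))
  show f0: "fcoeff f 0 = 0" using F[of 0] F[of 1] per by (simp add: prim_1)
  assume k: "k \<noteq> 0"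
  define d where "d = c + fcoeff (anti0 f) 0"
  have "fcoeff F k = fcoeff (\<lambda>x. anti f x + d) k"
    by (rule fcoeff_cong) (simp add: F anti_def anti0_def f0 d_def)
  also have "\<dots> = fcoeff (anti f) k"
    using k by (subst fcoeff_add) (auto simp: fcoeff_const intro!: M01_integrable_continuous continuous_intros f)
  also have "\<dots> = fcoeff f k / (2 * pi * \<i> * k)" using k by (simp add: fcoeff_anti[OF f])
  finally show "fcoeff F k = fcoeff f k / (2 * pi * \<i> * k)" .
qed

lemma summable_inverse_square_int: "(\<lambda>k::int. (1 / max 1 \<bar>real_of_int k\<bar>)\<^sup>2) summable_on UNIV"
proof -
  let ?f = "\<lambda>k::int. (1 / max 1 \<bar>real_of_int k\<bar>)\<^sup>2"
  have "summable (\<lambda>n. inverse (real (Suc n) ^ 2))"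
    using inverse_power_summable[of 2, where 'a = real] by (subst summable_Suc_iff) simp
  then have "summable (\<lambda>n. (1 / max 1 \<bar>real_of_int (int (Suc n))\<bar>)\<^sup>2)"
    by (simp add: power_divide inverse_eq_divide max_def)
  then have "summable (\<lambda>n. (1 / max 1 \<bar>real_of_int (int n)\<bar>)\<^sup>2)"
    by (subst (asm) summable_Suc_iff[where f = "\<lambda>n. (1 / max 1 \<bar>real_of_int (int n)\<bar>)\<^sup>2"])
  then have n: "(\<lambda>n. ?f (int n)) summable_on UNIV"
    by (intro summable_nonneg_imp_summable_on) auto
  have 1: "?f summable_on range int"
    using n by (subst summable_on_reindex) (auto simp: o_def)
  have "?f summable_on range (\<lambda>n. - int n)"
    using n by (subst summable_on_reindex) (auto simp: o_def inj_on_def)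
  then have "?f summable_on (range int \<union> range (\<lambda>n. - int n))"
    using 1 by (intro summable_on_union)
  moreover have "range int \<union> range (\<lambda>n. - int n) = UNIV"
  proof -
    have "k \<in> range int \<union> range (\<lambda>n. - int n)" for k
      by (cases k rule: int_cases2) auto
    then show ?thesis by blast
  qed
  ultimately show ?thesis by simp
qed

lemma inverse_max_le_1: "1 / max 1 \<bar>x\<bar> \<le> (1::real)" "0 \<le> 1 / max 1 \<bar>x\<bar>"
  by (auto simp: divide_le_eq)

lemma norm_fcoeff_anti_le:
  assumes "integrable M01 f"
  shows "norm (fcoeff (anti f) p) \<le> L1 f * (1 / max 1 \<bar>real_of_int p\<bar>)"
proof (cases "p = 0")
  case False
  have p1: "max 1 \<bar>real_of_int p\<bar> = \<bar>real_of_int p\<bar>" using False by (auto simp: max_def)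
  have "1 * \<bar>real_of_int p\<bar> \<le> (2 * pi) * \<bar>real_of_int p\<bar>"
    using pi_gt3 by (intro mult_right_mono) auto
  then have "norm (fcoeff (anti f) p) \<le> norm (fcoeff f p) / \<bar>real_of_int p\<bar>"
    using False by (simp add: fcoeff_anti[OF assms] norm_divide norm_mult divide_left_mono)
  also have "\<dots> \<le> L1 f / \<bar>real_of_int p\<bar>"
    by (intro divide_right_mono norm_fcoeff_le assms) auto
  finally show ?thesis by (simp add: p1)
qed (simp add: fcoeff_anti[OF assms] Bochner_Integration.integral_nonneg)

text \<open>Complements \<open>fcoeff_mult\<close> for \<open>g\<close> whose coefficients are
  O(1/|k|) and possibly not summable: those of \<open>anti f\<close> decay at the same rate, and the
  product of two such sequences is summable. It will be applied to the square of
  \<open>anti f\<close>.\<close>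

theorem fcoeff_anti_mult:
  assumes f: "integrable M01 f" and g: "continuous_on {0..1} g"
    and gb: "\<And>k. norm (fcoeff g k) \<le> C * (1 / max 1 \<bar>real_of_int k\<bar>)"
  shows "fcoeff (\<lambda>x. anti f x * g x) m = (\<Sum>\<^sub>\<infinity>k. fcoeff (anti f) k * fcoeff g (m - k))"
proof -
  define v :: "int \<Rightarrow> real" where "v k = 1 / max 1 \<bar>real_of_int k\<bar>" for k
  have v0: "0 \<le> v k" for k by (simp add: v_def)
  have "norm (fcoeff g 0) \<le> C" using gb[of 0] by simp
  then have C: "C \<ge> 0" using norm_ge_zero order_trans by blast
  have v2: "(\<lambda>k. v k ^ 2) summable_on UNIV"
    using summable_inverse_square_int by (simp add: v_def)
  have v2': "(\<lambda>k. v (m - k) ^ 2) summable_on UNIV"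
    using abs_summable_reflect(1)[of "\<lambda>k. v k ^ 2" m] v2 by simp
  have vv: "(\<lambda>k. v k * v (m - k)) summable_on UNIV"
  proof (rule summable_on_comparison_test)
    show "(\<lambda>k. v k ^ 2 + v (m - k) ^ 2) summable_on UNIV"
      by (intro summable_on_add v2 v2')
    show "v k * v (m - k) \<le> v k ^ 2 + v (m - k) ^ 2" for k
      using sum_squares_bound[of "v k" "v (m - k)"] v0[of k] v0[of "m - k"]
        mult_nonneg_nonneg[OF v0[of k] v0[of "m - k"]] by linarith
  qed (use v0 in auto)
  define W where "W = (\<Sum>\<^sub>\<infinity>k. v k * v (m - k))"
  have le: "norm (fcoeff (anti f) k * fcoeff g (m - k)) \<le> (L1 f * C) * (v k * v (m - k))"
    if "integrable M01 f" for f k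
  proof -
    have "norm (fcoeff (anti f) k * fcoeff g (m - k)) \<le>
        (L1 f * v k) * (C * v (m - k))"
      unfolding norm_mult using norm_fcoeff_anti_le[OF that, of k] gb[of "m - k"] v0
      by (intro mult_mono) (auto simp: v_def intro!: mult_nonneg_nonneg Bochner_Integration.integral_nonneg)
    then show ?thesis by (simp add: mult_ac)
  qed
  have as: "abs_summable (\<lambda>k. fcoeff (anti f) k * fcoeff g (m - k)) UNIV" if "integrable M01 f" for f
    by (rule Infinite_Sum.abs_summable_on_comparison_test'[OF summable_on_cmult_right[OF vv] le[OF that]])
  note s = as[THEN abs_summable_summable]
  have bd: "norm (\<Sum>\<^sub>\<infinity>k. fcoeff (anti f) k * fcoeff g (m - k)) \<le> (L1 f * C) * W"
    if "integrable M01 f" for f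
  proof -
    have "norm (\<Sum>\<^sub>\<infinity>k. fcoeff (anti f) k * fcoeff g (m - k)) \<le>
        (\<Sum>\<^sub>\<infinity>k. (L1 f * C) * (v k * v (m - k)))"
      by (rule norm_infsum_le[OF _ _ le[OF that]])
        (auto intro!: has_sum_infsum s[OF that] summable_on_cmult_right vv)
    then show ?thesis by (simp add: infsum_cmult_right' W_def)
  qed
  obtain B where B: "\<And>x. x \<in> {0..1} \<Longrightarrow> norm (g x) \<le> B"
    using M01_continuous_bounded[OF g] by metis
  have B0: "B \<ge> 0" using B[of 0] by (auto intro: order_trans[OF norm_ge_zero])
  define L where "L f = fcoeff (\<lambda>x. anti f x * g x) m - (\<Sum>\<^sub>\<infinity>k. fcoeff (anti f) k * fcoeff g (m - k))" for f
  have "L f = 0"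
  proof (rule L1_functional_eq_0[where C = "4 * B + C * W", OF _ _ _ _ f])
    fix f h :: "real \<Rightarrow> complex" assume fh: "integrable M01 f" "integrable M01 h"
    have ai: "integrable M01 (anti f)" "integrable M01 (anti h)"
      by (auto intro!: M01_integrable_continuous continuous_intros fh)
    have "fcoeff (\<lambda>x. anti (\<lambda>x. f x + h x) x * g x) m = fcoeff (\<lambda>x. anti f x * g x) m + fcoeff (\<lambda>x. anti h x * g x) m"
      unfolding anti_add[OF fh] distrib_right by (intro fcoeff_add M01_integrable_mult ai g)
    moreover have "(\<Sum>\<^sub>\<infinity>k. fcoeff (anti (\<lambda>x. f x + h x)) k * fcoeff g (m - k)) =
        (\<Sum>\<^sub>\<infinity>k. fcoeff (anti f) k * fcoeff g (m - k)) + (\<Sum>\<^sub>\<infinity>k. fcoeff (anti h) k * fcoeff g (m - k))"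
      unfolding anti_add[OF fh] fcoeff_add[OF ai] distrib_right by (intro infsum_add s fh)
    ultimately show "L (\<lambda>x. f x + h x) = L f + L h" by (simp add: L_def)
  next
    fix f c
    show "L (\<lambda>x. c * f x) = c * L f"
      unfolding L_def anti_cmult fcoeff_cmult mult.assoc infsum_cmult_right' right_diff_distrib by simp
  next
    fix f :: "real \<Rightarrow> complex" assume f: "integrable M01 f"
    have ag: "continuous_on {0..1} (\<lambda>x. anti f x * g x)"
      by (intro continuous_intros f g)
    have "norm (fcoeff (\<lambda>x. anti f x * g x) m) \<le> (LINT x|M01. norm (anti f x * g x))"
      by (rule norm_fcoeff_le[OF M01_integrable_continuous[OF ag]])
    also have "\<dots> \<le> (LINT x|M01. (4 * L1 f) * B)"
      using norm_anti_le[OF f] B B0 by (intro integral_mono integrable_norm M01_integrable_continuous ag)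
        (auto simp: norm_mult intro!: mult_mono Bochner_Integration.integral_nonneg continuous_intros)
    finally have 1: "norm (fcoeff (\<lambda>x. anti f x * g x) m) \<le> 4 * B * L1 f"
      by (simp add: mult_ac)
    show "norm (L f) \<le> (4 * B + C * W) * L1 f"
      unfolding L_def using 1 bd[OF f] norm_triangle_ineq4[of "fcoeff (\<lambda>x. anti f x * g x) m"]
      by (smt (verit) distrib_right mult.commute mult.left_commute)
  next
    fix a :: int
    define c :: complex where "c = (if a = 0 then 0 else 1 / (2 * pi * \<i> * a))"
    have 1: "fcoeff (anti (expi a)) k = (if k = a then c else 0)" for k
      by (subst fcoeff_anti) (auto intro!: M01_integrable_continuous continuous_intros simp: fcoeff_expi c_def)
    have "(\<Sum>\<^sub>\<infinity>k. fcoeff (anti (expi a)) k * fcoeff g (m - k)) = c * fcoeff g (m - a)"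
      by (subst infsum_single[of a]) (auto simp: 1)
    moreover have "fcoeff (\<lambda>x. anti (expi a) x * g x) m = fcoeff (\<lambda>x. c * (g x * expi a x)) m"
      by (rule fcoeff_cong) (simp add: anti_expi c_def)
    ultimately show "L (expi a) = 0"
      unfolding L_def fcoeff_cmult fcoeff_mult_expi by simp
  qed
  then show ?thesis by (simp add: L_def)
qed

subsection \<open>The eigenvalue equation in Fourier coefficients\<close>

lemma integrable_of_real_M01:
  assumes "set_integrable lebesgue {0..1} q"
  shows "integrable M01 (\<lambda>x. complex_of_real (q x))"
  using assms unfolding integrable_M01[symmetric] by (rule integrable_of_real)

text \<open>Applying \<open>fcoeff_primitive\<close> to y'' and to y' turns differentiation into
  multiplication by 2 pi i k. As y'' has bounded coefficients, those of y are O(1/k^2). Their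
  summability is what permits \<open>fcoeff_mult\<close> for the product q y.\<close>

theorem hill_op_eigenfunction:
  assumes q: "set_integrable lebesgue {0..1} q" and y: "hill_op q y (\<lambda>x. of_real \<mu> * y x)"
  shows "continuous_on {0..1} y" and "abs_summable (fcoeff y) UNIV"
    and "of_real (\<mu> - (2 * pi * of_int k)\<^sup>2) * fcoeff y k = (\<Sum>\<^sub>\<infinity>i. fourier q i * fcoeff y (k - i))"
proof -
  obtain y' y'' where
    dy: "\<And>x. x \<in> {0..1} \<Longrightarrow> (y has_vector_derivative y' x) (at x within {0..1})" and
    iy: "set_integrable lebesgue {0..1} y''" and
    y': "\<And>x. x \<in> {0..1} \<Longrightarrow> y' x = y' 0 + (LINT t:{0..x}|lebesgue. y'' t)" and
    per: "y 1 = y 0" "y' 1 = y' 0" and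
    eq: "AE x in lebesgue. x \<in> {0..1} \<longrightarrow> of_real \<mu> * y x = - y'' x + of_real (q x) * y x"
    using y unfolding hill_op_def by blast
  have i2: "integrable M01 y''" using iy by (simp add: integrable_M01)
  have p1: "y' x = y' 0 + prim y'' x" if "x \<in> {0..1}" for x
    using y'[OF that] prim_eq_set_integral[OF that] by simp
  note F1 = fcoeff_primitive[OF i2 p1 per(2)]
  have i1: "integrable M01 y'" by (rule M01_integrable_continuous[OF F1(1)])
  have p0: "y x = y 0 + prim y' x" if x: "x \<in> {0..1}" for x
  proof -
    have "(y' has_integral y x - y 0) {0..x}"
    proof (rule fundamental_theorem_of_calculus)
      show "(y has_vector_derivative y' t) (at t within {0..x})" if "t \<in> {0..x}" for t
        using dy[of t] that x by (intro has_vector_derivative_within_subset[OF dy]) auto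
    qed (use x in auto)
    then show ?thesis using prim_eq_integral[OF i1 x] by (simp add: integral_unique)
  qed
  note F0 = fcoeff_primitive[OF i1 p0 per(1)]
  show yc: "continuous_on {0..1} y" by (rule F0(1))
  have coef: "fcoeff y'' k = - of_real ((2 * pi * of_int k)\<^sup>2) * fcoeff y k" for k
  proof (cases "k = 0")
    case True
    then show ?thesis using F1(2) by simp
  next
    case False
    then have "(2 * pi * \<i> * of_int k) \<noteq> 0" by simp
    with F0(3)[of k] F1(3)[of k] False have
      "fcoeff y'' k = (2 * pi * \<i> * of_int k) * ((2 * pi * \<i> * of_int k) * fcoeff y k)"
      by simp
    then show ?thesis by (simp add: power2_eq_square algebra_simps)
  qed
  show ys: "abs_summable (fcoeff y) UNIV"
  proof (rule Infinite_Sum.abs_summable_on_comparison_test')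
    let ?C = "L1 y'' + norm (fcoeff y 0)"
    show "(\<lambda>k::int. ?C * (1 / max 1 \<bar>real_of_int k\<bar>)\<^sup>2) summable_on UNIV"
      by (intro summable_on_cmult_right summable_inverse_square_int)
    have nn: "0 \<le> L1 y''" by (rule Bochner_Integration.integral_nonneg) simp
    show "norm (fcoeff y k) \<le> ?C * (1 / max 1 \<bar>real_of_int k\<bar>)\<^sup>2" for k
    proof (cases "k = 0")
      case True
      then show ?thesis using nn by simp
    next
      case False
      then have k: "max 1 \<bar>real_of_int k\<bar> = \<bar>real_of_int k\<bar>" by (auto simp: max_def)
      have "norm (fcoeff y'' k) = (2 * pi * of_int k)\<^sup>2 * norm (fcoeff y k)"
        unfolding coef by (simp add: norm_mult norm_power power_mult_distrib)
      moreover have "1 * (of_int k)\<^sup>2 \<le> (2 * pi)\<^sup>2 * (real_of_int k)\<^sup>2"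
        using one_le_power[of "2 * pi" 2] pi_gt3 by (intro mult_right_mono) (linarith, simp)
      ultimately have "(real_of_int k)\<^sup>2 * norm (fcoeff y k) \<le> norm (fcoeff y'' k)"
        by (simp add: power_mult_distrib mult_right_mono)
      also have "\<dots> \<le> ?C" using norm_fcoeff_le[OF i2, of k] by (simp add: add_increasing2)
      finally show ?thesis unfolding k using False
        by (simp add: power_divide field_simps)
    qed
  qed
  have qi: "integrable M01 (\<lambda>x. complex_of_real (q x))" by (rule integrable_of_real_M01[OF q])
  have yi: "integrable M01 y" by (rule M01_integrable_continuous[OF yc])
  have "AE x in M01. of_real \<mu> * y x = of_real (q x) * y x - y'' x"
    using eq by (subst AE_restrict_space_iff) (auto elim!: AE_mp)
  moreover have "integrable M01 (\<lambda>x. of_real \<mu> * y x * expi (- k) x)"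
    by (rule M01_integrable_mult[OF integrable_mult_right[OF yi] continuous_on_expi])
  moreover have "integrable M01 (\<lambda>x. (of_real (q x) * y x - y'' x) * expi (- k) x)"
    by (rule M01_integrable_mult[OF Bochner_Integration.integrable_diff[OF M01_integrable_mult[OF qi yc] i2] continuous_on_expi])
  ultimately have "fcoeff (\<lambda>x. of_real \<mu> * y x) k = fcoeff (\<lambda>x. of_real (q x) * y x - y'' x) k"
    unfolding fcoeff_def by (intro integral_cong_AE borel_measurable_integrable) auto
  then have "of_real \<mu> * fcoeff y k = fcoeff (\<lambda>x. of_real (q x) * y x) k - fcoeff y'' k"
    using fcoeff_diff[OF M01_integrable_mult[OF qi yc] i2] by (simp add: fcoeff_cmult)
  also have "fcoeff (\<lambda>x. of_real (q x) * y x) k = (\<Sum>\<^sub>\<infinity>i. fourier q i * fcoeff y (k - i))"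
    unfolding fourier_eq_fcoeff by (rule fcoeff_mult[OF qi yc ys])
  finally show "of_real (\<mu> - (2 * pi * of_int k)\<^sup>2) * fcoeff y k = (\<Sum>\<^sub>\<infinity>i. fourier q i * fcoeff y (k - i))"
    by (simp add: coef algebra_simps)
qed

subsection \<open>The weights\<close>

text \<open>Division by zero makes the weight vanish at the resonant values \<open>j = 0\<close> and
  \<open>j = 2n\<close>, so the sum over all integers is the sum over the admissible ones.\<close>

definition wgt :: "nat \<Rightarrow> int \<Rightarrow> real" where
  "wgt n j = 1 / (\<bar>real_of_int j\<bar> * \<bar>real_of_int (2 * int n - j)\<bar>)"

definition wsum :: "nat \<Rightarrow> real" where
  "wsum n = (\<Sum>\<^sub>\<infinity>j. wgt n j)"

lemma wgt_nonneg: "0 \<le> wgt n j"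
  by (simp add: wgt_def)

text \<open>From (|j| - 1)(|2n - j| - 1) \<ge> 0 the product is at least |j| + |2n - j| - 1. The sum
  of moduli is at least 2n and at least 2, hence at least the mean n + 1.\<close>

lemma abs_mult_ge:
  fixes j :: int
  assumes "j \<noteq> 0" "j \<noteq> 2 * int n"
  shows "real n \<le> \<bar>real_of_int j\<bar> * \<bar>real_of_int (2 * int n - j)\<bar>"
proof -
  have "(\<bar>j\<bar> - 1) * (\<bar>2 * int n - j\<bar> - 1) \<ge> 0"
    using assms by (intro mult_nonneg_nonneg) auto
  then have "\<bar>j\<bar> * \<bar>2 * int n - j\<bar> \<ge> \<bar>j\<bar> + \<bar>2 * int n - j\<bar> - 1"
    by (simp add: algebra_simps)
  moreover have "\<bar>j\<bar> + \<bar>2 * int n - j\<bar> \<ge> 2 * int n" "\<bar>j\<bar> + \<bar>2 * int n - j\<bar> \<ge> 2"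
    using assms by auto
  ultimately have "int n \<le> \<bar>j\<bar> * \<bar>2 * int n - j\<bar>" by linarith
  then have "real_of_int (int n) \<le> real_of_int (\<bar>j\<bar> * \<bar>2 * int n - j\<bar>)"
    by (simp only: of_int_le_iff)
  then show ?thesis by (simp only: of_int_mult of_int_abs of_int_of_nat_eq)
qed

lemma wgt_le: "n \<ge> 1 \<Longrightarrow> wgt n j \<le> 1 / real n"
proof (cases "j = 0 \<or> j = 2 * int n")
  case False
  assume "n \<ge> 1"
  with False abs_mult_ge[of j n] show ?thesis
    unfolding wgt_def by (intro divide_left_mono) auto
qed (auto simp: wgt_def)

lemma freq_diff:
  "(2 * pi * real n)\<^sup>2 - (2 * pi * of_int (int n - j))\<^sup>2 = 4 * pi\<^sup>2 * (real_of_int j * real_of_int (2 * int n - j))"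
  by (simp add: power2_eq_square algebra_simps)

text \<open>With p = |j (2n - j)| the unperturbed denominator has modulus 4 pi^2 p \<ge> 2p, and
  moving \<mu> by at most n \<le> p costs at most p.\<close>

lemma inverse_denominator_le:
  assumes n: "n \<ge> 1" and \<mu>: "\<bar>\<mu> - (2 * pi * real n)\<^sup>2\<bar> \<le> real n" and j: "j \<noteq> 0" "j \<noteq> 2 * int n"
  shows "\<mu> - (2 * pi * of_int (int n - j))\<^sup>2 \<noteq> 0"
    and "1 / \<bar>\<mu> - (2 * pi * of_int (int n - j))\<^sup>2\<bar> \<le> wgt n j"
proof -
  let ?p = "\<bar>real_of_int j\<bar> * \<bar>real_of_int (2 * int n - j)\<bar>"
  have p: "real n \<le> ?p" by (rule abs_mult_ge[OF j])
  have "\<bar>(2 * pi * real n)\<^sup>2 - (2 * pi * of_int (int n - j))\<^sup>2\<bar> = 4 * pi\<^sup>2 * ?p"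
    unfolding freq_diff by (simp add: abs_mult)
  moreover have "2 * ?p \<le> 4 * pi\<^sup>2 * ?p"
    using pi_gt3 one_le_power[of pi 2] by (intro mult_right_mono) (linarith, simp)
  ultimately have d: "?p \<le> \<bar>\<mu> - (2 * pi * of_int (int n - j))\<^sup>2\<bar>"
    using \<mu> p by linarith
  moreover have "0 < ?p" using n p by linarith
  ultimately show "\<mu> - (2 * pi * of_int (int n - j))\<^sup>2 \<noteq> 0"
    and "1 / \<bar>\<mu> - (2 * pi * of_int (int n - j))\<^sup>2\<bar> \<le> wgt n j"
    unfolding wgt_def by (auto intro!: divide_left_mono)
qed

section \<open>The sum of the weights is O(ln n / n)\<close>

lemma harm_le_ln: "n \<ge> 1 \<Longrightarrow> harm n \<le> 1 + ln (real n)"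
proof -
  assume "n \<ge> 1"
  then obtain m where m: "n = Suc m" by (cases n) auto
  have "harm (Suc m) - ln (Suc m) \<le> harm (Suc 0) - ln (Suc 0)"
    using decseqD[OF decseq_harm_diff_ln, of 0 m] by simp
  then show ?thesis by (simp add: m harm_def)
qed

text \<open>By partial fractions the sum is (H_N - (H_{N+2n} - H_{2n})) / (2n), with H the harmonic
  numbers, and H_N \<le> H_{N+2n}.\<close>

lemma sum_telescope_harm:
  assumes "n \<ge> 1"
  shows "(\<Sum>i=1..N. 1 / (real i * (real i + 2 * real n))) \<le> harm (2 * n) / (2 * real n)"
proof -
  have "(\<Sum>i=1..N. 1 / (real i + 2 * real n)) = harm (N + 2 * n) - harm (2 * n)"
    by (induction N) (auto simp: harm_Suc inverse_eq_divide algebra_simps)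
  moreover have "(\<Sum>i=1..N. 1 / real i) = harm N"
    by (simp add: harm_def inverse_eq_divide)
  moreover have "harm N \<le> (harm (N + 2 * n) :: real)"
    by (rule harm_mono) simp
  ultimately have "(\<Sum>i=1..N. 1 / real i - 1 / (real i + 2 * real n)) \<le> harm (2 * n)"
    by (simp add: sum_subtractf)
  moreover have "1 / (real i * (real i + 2 * real n)) = (1 / real i - 1 / (real i + 2 * real n)) / (2 * real n)"
    if "i \<in> {1..N}" for i
  proof -
    have "1 / (a * (a + b)) = (1 / a - 1 / (a + b)) / b" if "a > 0" "b > 0" for a b :: real
    proof -
      have "1 / a - 1 / (a + b) = b / (a * (a + b))" using that by (simp add: field_simps)
      then show ?thesis using that by simp
    qed
    from this[of "real i" "2 * real n"] show ?thesis using that assms by simp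
  qed
  ultimately show ?thesis
    using assms by (simp add: sum_divide_distrib[symmetric] divide_right_mono)
qed

text \<open>The ranges j < 0 and j > 2n are mirror images, each at most H_{2n} / (2n) by
  telescoping. Partial fractions on 0 < j < 2n give two harmonic sums over 2n, hence 4 H_{2n} / (2n)
  in all.\<close>

lemma sum_wgt_le:
  assumes n: "n \<ge> 1" and F: "finite F"
  shows "sum (wgt n) F \<le> 2 * harm (2 * n) / real n"
proof -
  define N where "N = nat (\<Sum>j\<in>F. \<bar>j\<bar>) + 2 * n"
  have jN: "\<bar>j\<bar> \<le> int N" if "j \<in> F" for j
  proof -
    have "\<bar>j\<bar> \<le> (\<Sum>j\<in>F. \<bar>j\<bar>)" using that F by (intro member_le_sum) auto
    then show ?thesis by (simp add: N_def)
  qed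
  define A where "A = (\<lambda>i. - int i) ` {1..N}"
  define B where "B = (\<lambda>i. 2 * int n + int i) ` {1..N}"
  define C where "C = int ` {1..2 * n - 1}"
  have cov: "F - {0, 2 * int n} \<subseteq> A \<union> B \<union> C"
  proof
    fix j assume j: "j \<in> F - {0, 2 * int n}"
    then have b: "\<bar>j\<bar> \<le> int N" by (auto intro: jN)
    consider "j < 0" | "j > 2 * int n" | "0 < j" "j < 2 * int n" using j by force
    then show "j \<in> A \<union> B \<union> C"
    proof cases
      case 1
      then have "j \<in> A" unfolding A_def using b by (intro image_eqI[of _ _ "nat (- j)"]) auto
      then show ?thesis by blast
    next
      case 2
      then have "j \<in> B" unfolding B_def using b by (intro image_eqI[of _ _ "nat (j - 2 * int n)"]) auto
      then show ?thesis by blast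
    next
      case 3
      then have "j \<in> C" unfolding C_def by (intro image_eqI[of _ _ "nat j"]) auto
      then show ?thesis by blast
    qed
  qed
  have fin: "finite A" "finite B" "finite C" by (auto simp: A_def B_def C_def)
  have "sum (wgt n) F = sum (wgt n) (F - {0, 2 * int n})"
    using F by (intro sum.mono_neutral_right) (auto simp: wgt_def)
  also have "\<dots> \<le> sum (wgt n) (A \<union> B \<union> C)"
    using cov fin by (intro sum_mono2) (auto simp: wgt_nonneg)
  also have "\<dots> \<le> sum (wgt n) A + sum (wgt n) B + sum (wgt n) C"
  proof -
    have "sum (wgt n) (A \<union> B \<union> C) \<le> sum (wgt n) (A \<union> B) + sum (wgt n) C"
      using fin by (subst sum.union_inter[symmetric]) (auto intro!: sum_nonneg wgt_nonneg)
    moreover have "sum (wgt n) (A \<union> B) \<le> sum (wgt n) A + sum (wgt n) B"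
      using fin by (subst sum.union_inter[symmetric]) (auto intro!: sum_nonneg wgt_nonneg)
    ultimately show ?thesis by linarith
  qed
  also have "sum (wgt n) A = (\<Sum>i=1..N. 1 / (real i * (real i + 2 * real n)))"
    unfolding A_def by (subst sum.reindex) (auto simp: inj_on_def wgt_def intro!: sum.cong)
  also have "sum (wgt n) B = (\<Sum>i=1..N. 1 / (real i * (real i + 2 * real n)))"
    unfolding B_def by (subst sum.reindex) (auto simp: inj_on_def wgt_def intro!: sum.cong)
  also have "sum (wgt n) C = (\<Sum>i=1..2*n-1. wgt n (int i))"
    unfolding C_def by (subst sum.reindex) auto
  also have "\<dots> = (\<Sum>i=1..2*n-1. (1 / real i + 1 / real (2 * n - i)) / (2 * real n))"
  proof (intro sum.cong refl)
    fix i assume i: "i \<in> {1..2*n-1}"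
    then have "2 * real n - real i > 0" "real (2 * n - i) = 2 * real n - real i"
      by (auto simp: of_nat_diff)
    then show "wgt n (int i) = (1 / real i + 1 / real (2 * n - i)) / (2 * real n)"
      using i n by (simp add: wgt_def field_simps)
  qed
  also have "\<dots> = 2 * harm (2 * n - 1) / (2 * real n)"
  proof -
    have "(\<Sum>i=1..2*n-1. 1 / real (2 * n - i)) = (\<Sum>i=1..2*n-1. 1 / real i)"
      using n by (intro sum.reindex_bij_witness[of _ "\<lambda>i. 2 * n - i" "\<lambda>i. 2 * n - i"]) auto
    then show ?thesis
      by (simp add: sum_divide_distrib[symmetric] sum.distrib harm_def inverse_eq_divide)
  qed
  also have "harm (2 * n - 1) \<le> (harm (2 * n) :: real)" by (rule harm_mono) simp
  finally have "sum (wgt n) F \<le> harm (2 * n) / (2 * real n) + harm (2 * n) / (2 * real n) + 2 * harm (2 * n) / (2 * real n)"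
    using sum_telescope_harm[OF n, of N] by (smt (verit) divide_right_mono of_nat_0_le_iff)
  then show ?thesis by simp
qed

lemma wgt_summable: "n \<ge> 1 \<Longrightarrow> wgt n summable_on UNIV"
  by (rule nonneg_bdd_above_summable_on) (auto intro!: wgt_nonneg bdd_aboveI2 sum_wgt_le)

lemma wsum_nonneg: "0 \<le> wsum n"
  unfolding wsum_def by (intro infsum_nonneg wgt_nonneg)

lemma wsum_le:
  assumes "n \<ge> 2"
  shows "wsum n \<le> 10 * (ln (real n) / real n)"
proof -
  have "wsum n \<le> 2 * harm (2 * n) / real n"
    unfolding wsum_def using assms by (intro infsum_le_finite_sums wgt_summable sum_wgt_le) auto
  also have "harm (2 * n) \<le> 1 + ln (2 * real n)" using harm_le_ln[of "2 * n"] assms by simp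
  also have "\<dots> = 1 + ln 2 + ln (real n)" using assms by (simp add: ln_mult)
  \<comment> \<open>The constant is absorbed because ln n \<ge> ln 2 \<ge> 2/3.\<close>
  also have "\<dots> \<le> 5 * ln (real n)"
  proof -
    have "ln 2 \<le> ln (real n)" using assms by simp
    then show ?thesis using ln2_ge_two_thirds ln_2_less_1 by linarith
  qed
  finally show ?thesis by (simp add: divide_right_mono mult_left_mono)
qed

subsection \<open>Sums over index lists\<close>

definition next_indices :: "nat \<Rightarrow> int list \<Rightarrow> int set" where
  "next_indices n ns = {i. i \<noteq> 0 \<and> sum_list ns + i \<noteq> 0 \<and> sum_list ns + i \<noteq> 2 * int n}"

definition wprod :: "nat \<Rightarrow> int list \<Rightarrow> real" where
  "wprod n ns = (\<Prod>s=1..length ns. wgt n (sum_list (take s ns)))"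

lemma hill_indices_0: "hill_indices n 0 = {[]}"
  by (auto simp: hill_indices_def)

lemma hill_indices_length: "ns \<in> hill_indices n k \<Longrightarrow> length ns = k"
  by (simp add: hill_indices_def)

text \<open>Appending at the end leaves all earlier partial sums unchanged. Index set, weight and
  denominator thus each acquire one new condition or factor, which drives all recursions over
  \<open>k\<close>.\<close>

lemma hill_indices_snoc:
  "ns @ [i] \<in> hill_indices n (Suc k) \<longleftrightarrow> ns \<in> hill_indices n k \<and> i \<in> next_indices n ns"
proof (cases "length ns = k")
  case True
  have "(\<forall>s\<in>{1..Suc k}. P s) \<longleftrightarrow> (\<forall>s\<in>{1..k}. P s) \<and> P (Suc k)" for P
    by (auto simp: atLeastAtMostSuc_conv)
  moreover have "(ns @ [i]) ! (s - 1) = ns ! (s - 1)" "take s (ns @ [i]) = take s ns" if "s \<in> {1..k}" for s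
    using that True by (auto simp: nth_append)
  ultimately show ?thesis using True
    by (auto simp: hill_indices_def next_indices_def nth_append)
qed (auto simp: hill_indices_def)

lemma hill_indices_Suc:
  "hill_indices n (Suc k) = (\<lambda>(ns, i). ns @ [i]) ` (SIGMA ns:hill_indices n k. next_indices n ns)"
proof (intro equalityI subsetI)
  fix xs assume xs: "xs \<in> hill_indices n (Suc k)"
  then have "xs \<noteq> []" by (auto simp: hill_indices_def)
  then obtain ns i where "xs = ns @ [i]" by (metis append_butlast_last_id)
  then show "xs \<in> (\<lambda>(ns, i). ns @ [i]) ` (SIGMA ns:hill_indices n k. next_indices n ns)"
    using xs hill_indices_snoc by force
qed (auto simp: hill_indices_snoc)

lemma wprod_snoc: "wprod n (ns @ [i]) = wprod n ns * wgt n (sum_list ns + i)"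
proof -
  have "(\<Prod>s=1..length ns. wgt n (sum_list (take s (ns @ [i])))) = (\<Prod>s=1..length ns. wgt n (sum_list (take s ns)))"
    by (intro prod.cong) auto
  then show ?thesis by (simp add: wprod_def prod.nat_ivl_Suc' mult.commute)
qed

lemma hill_denom_snoc:
  assumes "length ns = k"
  shows "hill_denom n (Suc k) \<mu> (ns @ [i]) = hill_denom n k \<mu> ns * (\<mu> - (2 * pi * of_int (int n - (sum_list ns + i)))\<^sup>2)"
proof -
  have "(\<Prod>s=1..k. \<mu> - (2 * pi * of_int (int n - sum_list (take s (ns @ [i]))))\<^sup>2) = hill_denom n k \<mu> ns"
    unfolding hill_denom_def using assms by (intro prod.cong) auto
  then show ?thesis using assms
    by (simp add: hill_denom_def[of n "Suc k"] prod.nat_ivl_Suc' mult.commute)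
qed

lemma wprod_nonneg: "0 \<le> wprod n ns"
  unfolding wprod_def by (intro prod_nonneg) (auto intro: wgt_nonneg)

lemma summable_hill_indices_Suc:
  fixes F :: "int list \<Rightarrow> 'a::{comm_monoid_add,topological_space}"
  shows "F summable_on hill_indices n (Suc k) \<longleftrightarrow>
    (\<lambda>(ns, i). F (ns @ [i])) summable_on (SIGMA ns:hill_indices n k. next_indices n ns)"
  unfolding hill_indices_Suc
  by (subst summable_on_reindex) (auto simp: inj_on_def o_def case_prod_unfold)

lemma infsum_hill_indices_Suc:
  fixes F :: "int list \<Rightarrow> 'a::banach"
  assumes "F summable_on hill_indices n (Suc k)"
  shows "infsum F (hill_indices n (Suc k)) =
    (\<Sum>\<^sub>\<infinity>ns\<in>hill_indices n k. \<Sum>\<^sub>\<infinity>i\<in>next_indices n ns. F (ns @ [i]))"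
proof -
  have "infsum F (hill_indices n (Suc k)) =
     infsum (\<lambda>(ns, i). F (ns @ [i])) (SIGMA ns:hill_indices n k. next_indices n ns)"
    unfolding hill_indices_Suc
    by (subst infsum_reindex) (auto simp: inj_on_def o_def case_prod_unfold)
  then show ?thesis
    using assms unfolding summable_hill_indices_Suc by (simp add: infsum_Sigma'_banach)
qed

lemma wgt_reindex:
  assumes n: "n \<ge> 1" and f: "bij_betw f UNIV UNIV"
  shows "(\<lambda>i. wgt n (f i)) summable_on X" and "(\<Sum>\<^sub>\<infinity>i\<in>X. wgt n (f i)) \<le> wsum n"
proof -
  have 1: "(\<lambda>i. wgt n (f i)) summable_on UNIV"
    using summable_on_reindex_bij_betw[OF f, of "wgt n"] wgt_summable[OF n] by simp
  then show 2: "(\<lambda>i. wgt n (f i)) summable_on X" by (rule summable_on_subset_banach) simp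
  have "(\<Sum>\<^sub>\<infinity>i\<in>X. wgt n (f i)) \<le> (\<Sum>\<^sub>\<infinity>i. wgt n (f i))"
    by (rule infsum_mono2[OF 2 1]) (auto simp: wgt_nonneg)
  then show "(\<Sum>\<^sub>\<infinity>i\<in>X. wgt n (f i)) \<le> wsum n"
    unfolding wsum_def infsum_reindex_bij_betw[OF f, of "wgt n"] .
qed

lemma bij_plus_int: "bij_betw (\<lambda>i::int. s + i) UNIV UNIV"
  by (rule bij_betwI[of _ _ _ "\<lambda>i. i - s"]) auto

lemmas wgt_shift = wgt_reindex[OF _ bij_plus_int] and wgt_reflect = wgt_reindex[OF _ bij_minus_int]

text \<open>For a fixed prefix, the sum over the last index runs over a part of a translate of the
  weight sequence, so each index contributes at most a factor \<open>wsum n\<close>.\<close>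

lemma wprod_summable:
  assumes n: "n \<ge> 1"
  shows "wprod n summable_on hill_indices n k \<and> infsum (wprod n) (hill_indices n k) \<le> wsum n ^ k"
proof (induction k)
  case 0
  then show ?case by (simp add: hill_indices_0 wprod_def)
next
  case (Suc k)
  define g where "g ns = wprod n ns * (\<Sum>\<^sub>\<infinity>i\<in>next_indices n ns. wgt n (sum_list ns + i))" for ns
  have hs: "((\<lambda>i. wprod n (ns @ [i])) has_sum g ns) (next_indices n ns)" for ns
    unfolding wprod_snoc g_def by (intro has_sum_cmult_right has_sum_infsum wgt_shift n)
  have g: "0 \<le> g ns" "g ns \<le> wprod n ns * wsum n" for ns
    unfolding g_def by (auto intro!: mult_nonneg_nonneg mult_left_mono infsum_nonneg wprod_nonneg wgt_nonneg wgt_shift n)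
  have s: "(\<lambda>ns. wprod n ns * wsum n) summable_on hill_indices n k"
    using Suc by (intro summable_on_cmult_left) auto
  have gs: "g summable_on hill_indices n k"
    by (rule summable_on_comparison_test[OF s]) (use g in auto)
  have "(\<lambda>(ns, i). wprod n (ns @ [i])) summable_on (SIGMA ns:hill_indices n k. next_indices n ns)"
    by (rule summable_on_SigmaI[OF _ gs]) (use hs in \<open>auto intro: wprod_nonneg\<close>)
  then have 1: "wprod n summable_on hill_indices n (Suc k)"
    by (simp add: summable_hill_indices_Suc)
  have "infsum (wprod n) (hill_indices n (Suc k)) = infsum g (hill_indices n k)"
    unfolding infsum_hill_indices_Suc[OF 1] using hs by (intro infsum_cong infsumI)
  also have "\<dots> \<le> (\<Sum>\<^sub>\<infinity>ns\<in>hill_indices n k. wprod n ns * wsum n)"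
    by (rule infsum_mono[OF gs s]) (rule g)
  also have "\<dots> = infsum (wprod n) (hill_indices n k) * wsum n"
    by (rule infsum_cmult_left')
  also have "\<dots> \<le> wsum n ^ k * wsum n"
    using Suc by (intro mult_right_mono wsum_nonneg) auto
  finally show ?case using 1 by (simp add: mult.commute)
qed

lemma bounded_by_wprod:
  fixes F :: "int list \<Rightarrow> complex"
  assumes n: "n \<ge> 1" and B: "B \<ge> 0" and F: "\<And>ns. ns \<in> hill_indices n k \<Longrightarrow> norm (F ns) \<le> B * wprod n ns"
  shows "abs_summable F (hill_indices n k)" and "norm (infsum F (hill_indices n k)) \<le> B * wsum n ^ k"
proof -
  have s: "(\<lambda>ns. B * wprod n ns) summable_on hill_indices n k"
    using wprod_summable[OF n, of k] by (intro summable_on_cmult_right) auto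
  show as: "abs_summable F (hill_indices n k)"
    by (rule Infinite_Sum.abs_summable_on_comparison_test'[OF s F])
  have "norm (infsum F (hill_indices n k)) \<le> (\<Sum>\<^sub>\<infinity>ns\<in>hill_indices n k. B * wprod n ns)"
    by (rule norm_infsum_le[OF has_sum_infsum[OF abs_summable_summable[OF as]] has_sum_infsum[OF s] F])
  also have "\<dots> = B * infsum (wprod n) (hill_indices n k)" by (rule infsum_cmult_right')
  also have "\<dots> \<le> B * wsum n ^ k"
    using wprod_summable[OF n, of k] B by (intro mult_left_mono) auto
  finally show "norm (infsum F (hill_indices n k)) \<le> B * wsum n ^ k" .
qed

lemma inverse_hill_denom_le:
  assumes n: "n \<ge> 1" and \<mu>: "\<bar>\<mu> - (2 * pi * real n)\<^sup>2\<bar> \<le> real n"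
  shows "ns \<in> hill_indices n k \<Longrightarrow> hill_denom n k \<mu> ns \<noteq> 0 \<and> \<bar>1 / hill_denom n k \<mu> ns\<bar> \<le> wprod n ns"
proof (induction k arbitrary: ns)
  case 0
  then show ?case by (simp add: hill_indices_0 hill_denom_def wprod_def)
next
  case (Suc k)
  then obtain xs i where ns: "ns = xs @ [i]" and xs: "xs \<in> hill_indices n k" and i: "i \<in> next_indices n xs"
    unfolding hill_indices_Suc by auto
  have i': "sum_list xs + i \<noteq> 0" "sum_list xs + i \<noteq> 2 * int n" using i by (auto simp: next_indices_def)
  have len: "length xs = k" using xs by (rule hill_indices_length)
  note d = inverse_denominator_le[OF n \<mu> i']
  have "\<bar>1 / hill_denom n k \<mu> xs\<bar> * (1 / \<bar>\<mu> - (2 * pi * of_int (int n - (sum_list xs + i)))\<^sup>2\<bar>)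
     \<le> wprod n xs * wgt n (sum_list xs + i)"
    using Suc.IH[OF xs] d(2) by (intro mult_mono wprod_nonneg) auto
  then show ?case
    unfolding ns hill_denom_snoc[OF len] wprod_snoc using Suc.IH[OF xs] d(1) by (simp add: abs_mult)
qed

text \<open>Product rule with 1/d - 1/e = (\<nu> - \<mu>) / (d e). Of the two weights bounding 1/d
  and 1/e one is spent on the factor 1/n, the other keeps the sum over lists convergent.\<close>

lemma inverse_hill_denom_lipschitz:
  assumes n: "n \<ge> 1" and \<mu>: "\<bar>\<mu> - (2 * pi * real n)\<^sup>2\<bar> \<le> real n" and \<nu>: "\<bar>\<nu> - (2 * pi * real n)\<^sup>2\<bar> \<le> real n"
  shows "ns \<in> hill_indices n k \<Longrightarrow>
    \<bar>1 / hill_denom n k \<mu> ns - 1 / hill_denom n k \<nu> ns\<bar> \<le> real k * \<bar>\<mu> - \<nu>\<bar> / real n * wprod n ns"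
proof (induction k arbitrary: ns)
  case 0
  then show ?case by (simp add: hill_indices_0 hill_denom_def wprod_def)
next
  case (Suc k)
  then obtain xs i where ns: "ns = xs @ [i]" and xs: "xs \<in> hill_indices n k" and i: "i \<in> next_indices n xs"
    unfolding hill_indices_Suc by auto
  have i': "sum_list xs + i \<noteq> 0" "sum_list xs + i \<noteq> 2 * int n" using i by (auto simp: next_indices_def)
  have len: "length xs = k" using xs by (rule hill_indices_length)
  define d e where "d = \<mu> - (2 * pi * of_int (int n - (sum_list xs + i)))\<^sup>2"
    and "e = \<nu> - (2 * pi * of_int (int n - (sum_list xs + i)))\<^sup>2"
  define D E where "D = hill_denom n k \<mu> xs" and "E = hill_denom n k \<nu> xs"
  define w where "w = wgt n (sum_list xs + i)"
  have d: "d \<noteq> 0" "1 / \<bar>d\<bar> \<le> w" and e: "e \<noteq> 0" "1 / \<bar>e\<bar> \<le> w"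
    unfolding d_def e_def w_def by (intro inverse_denominator_le n \<mu> \<nu> i')+
  have E: "\<bar>1 / E\<bar> \<le> wprod n xs" "E \<noteq> 0" "D \<noteq> 0"
    unfolding D_def E_def using inverse_hill_denom_le n \<mu> \<nu> xs by auto
  have IH: "\<bar>1 / D - 1 / E\<bar> \<le> real k * \<bar>\<mu> - \<nu>\<bar> / real n * wprod n xs"
    unfolding D_def E_def by (rule Suc.IH[OF xs])
  have w: "0 \<le> w" "w \<le> 1 / real n" unfolding w_def by (intro wgt_nonneg wgt_le n)+
  have "\<bar>1 / d - 1 / e\<bar> = \<bar>\<mu> - \<nu>\<bar> * ((1 / \<bar>d\<bar>) * (1 / \<bar>e\<bar>))"
  proof -
    have "1 / d - 1 / e = (\<nu> - \<mu>) / (d * e)" using d e by (simp add: field_simps d_def e_def)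
    then show ?thesis by (simp add: abs_mult abs_minus_commute)
  qed
  also have "\<dots> \<le> \<bar>\<mu> - \<nu>\<bar> * ((1 / real n) * w)"
    using d e w by (intro mult_left_mono mult_mono) auto
  finally have de: "\<bar>1 / d - 1 / e\<bar> \<le> \<bar>\<mu> - \<nu>\<bar> / real n * w" by simp
  have "1 / (D * d) - 1 / (E * e) = (1 / D - 1 / E) * (1 / d) + (1 / E) * (1 / d - 1 / e)"
    using d e E by (simp add: field_simps)
  then have "\<bar>1 / (D * d) - 1 / (E * e)\<bar> \<le> \<bar>1 / D - 1 / E\<bar> * (1 / \<bar>d\<bar>) + \<bar>1 / E\<bar> * \<bar>1 / d - 1 / e\<bar>"
    by (metis abs_triangle_ineq abs_mult abs_divide abs_one)
  also have "\<dots> \<le> (real k * \<bar>\<mu> - \<nu>\<bar> / real n * wprod n xs) * w + wprod n xs * (\<bar>\<mu> - \<nu>\<bar> / real n * w)"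
    using IH d E de by (intro add_mono mult_mono) (auto intro!: mult_nonneg_nonneg wprod_nonneg)
  also have "\<dots> = real (Suc k) * \<bar>\<mu> - \<nu>\<bar> / real n * (wprod n xs * w)"
    using n by (simp add: field_simps)
  finally show ?case
    unfolding ns hill_denom_snoc[OF len] wprod_snoc D_def E_def d_def e_def w_def .
qed

subsection \<open>Bounds for the coefficients\<close>

definition hill_term :: "(real \<Rightarrow> real) \<Rightarrow> nat \<Rightarrow> nat \<Rightarrow> real \<Rightarrow> int list \<Rightarrow> complex" where
  "hill_term q n k \<mu> ns = (\<Prod>i\<leftarrow>ns. fourier q i) * of_real (1 / hill_denom n k \<mu> ns)"

text \<open>Common form of a_k (\<open>t = 0\<close>) and b_k (\<open>t = 2n\<close>), so that every
  estimate serves both. For \<open>k = 0\<close> it reduces to \<open>fourier q t\<close>.\<close>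

definition hill_coeff :: "(real \<Rightarrow> real) \<Rightarrow> nat \<Rightarrow> nat \<Rightarrow> int \<Rightarrow> real \<Rightarrow> complex" where
  "hill_coeff q n k t \<mu> = (\<Sum>\<^sub>\<infinity>ns\<in>hill_indices n k. hill_term q n k \<mu> ns * fourier q (t - sum_list ns))"

lemma hill_a_eq: "hill_a q n k \<mu> = hill_coeff q n k 0 \<mu>"
  by (simp add: hill_a_def hill_coeff_def hill_term_def mult_ac divide_inverse)

lemma hill_b_eq: "hill_b q n k \<mu> = hill_coeff q n k (2 * int n) \<mu>"
  by (simp add: hill_b_def hill_coeff_def hill_term_def mult_ac divide_inverse)

text \<open>The tolerance n is small enough for \<open>inverse_denominator_le\<close> and eventually
  dominates both the O(sqrt n) deviation of the eigenvalues and the bounded deviation of the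
  iterates E.\<close>

definition near :: "nat \<Rightarrow> real \<Rightarrow> bool" where
  "near n \<mu> \<longleftrightarrow> n \<ge> 1 \<and> \<bar>\<mu> - (2 * pi * real n)\<^sup>2\<bar> \<le> real n"

lemma norm_prod_list_le:
  fixes c :: "int \<Rightarrow> complex"
  assumes "\<And>i. norm (c i) \<le> C"
  shows "norm (\<Prod>i\<leftarrow>ns. c i) \<le> C ^ length ns"
proof (induction ns)
  case (Cons i ns)
  have "norm (c i) * norm (\<Prod>i\<leftarrow>ns. c i) \<le> C * C ^ length ns"
    using assms[of i] by (intro mult_mono Cons) (auto intro: order_trans[OF norm_ge_zero])
  then show ?case by (simp add: norm_mult)
qed simp

text \<open>\<open>C \<ge> 1\<close> makes the powers of \<open>C\<close> increasing, so that
  estimates for different \<open>k\<close> combine. The instance will be the L1 norm of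
  \<open>q\<close>, raised to 1 if smaller.\<close>

locale bounded_coeffs =
  fixes q :: "real \<Rightarrow> real" and C :: real
  assumes C1: "C \<ge> 1" and bound: "\<And>k. norm (fourier q k) \<le> C" and mean0: "fourier q 0 = 0"
begin

lemma C_power_nonneg: "0 \<le> C ^ k"
  using C1 by simp

lemma hill_term_le:
  assumes "near n \<mu>" "ns \<in> hill_indices n k"
  shows "norm (hill_term q n k \<mu> ns) \<le> C ^ k * wprod n ns"
proof -
  have "norm (\<Prod>i\<leftarrow>ns. fourier q i) \<le> C ^ k"
    using norm_prod_list_le[of "fourier q" C ns] bound hill_indices_length[OF assms(2)] by simp
  moreover have "\<bar>1 / hill_denom n k \<mu> ns\<bar> \<le> wprod n ns"
    using inverse_hill_denom_le assms unfolding near_def by blast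
  ultimately show ?thesis
    unfolding hill_term_def norm_mult norm_of_real by (intro mult_mono) (auto simp: C_power_nonneg)
qed

lemma hill_term_lipschitz:
  assumes "near n \<mu>" "near n \<nu>" "ns \<in> hill_indices n k"
  shows "norm (hill_term q n k \<mu> ns - hill_term q n k \<nu> ns) \<le> C ^ k * (real k * \<bar>\<mu> - \<nu>\<bar> / real n) * wprod n ns"
proof -
  have "norm (\<Prod>i\<leftarrow>ns. fourier q i) \<le> C ^ k"
    using norm_prod_list_le[of "fourier q" C ns] bound hill_indices_length[OF assms(3)] by simp
  moreover have "\<bar>1 / hill_denom n k \<mu> ns - 1 / hill_denom n k \<nu> ns\<bar> \<le> real k * \<bar>\<mu> - \<nu>\<bar> / real n * wprod n ns"
    using inverse_hill_denom_lipschitz assms unfolding near_def by blast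
  ultimately show ?thesis
    unfolding hill_term_def right_diff_distrib[symmetric] of_real_diff[symmetric] norm_mult norm_of_real mult.assoc
    by (intro mult_mono) (auto simp: C_power_nonneg)
qed

lemma mult_fourier_le: "norm x \<le> y \<Longrightarrow> norm (x * fourier q k) \<le> y * C"
  unfolding norm_mult using bound by (intro mult_mono) (auto intro: order_trans[OF norm_ge_zero])

lemma hill_coeff_summand_le:
  assumes "near n \<mu>" "ns \<in> hill_indices n k"
  shows "norm (hill_term q n k \<mu> ns * fourier q l) \<le> C ^ Suc k * wprod n ns"
  using mult_fourier_le[OF hill_term_le[OF assms]] by (simp add: mult_ac)

lemma hill_coeff_summable:
  assumes "near n \<mu>"
  shows "(\<lambda>ns. hill_term q n k \<mu> ns * fourier q (t - sum_list ns)) summable_on hill_indices n k"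
proof (rule abs_summable_summable, rule bounded_by_wprod(1)[of n "C ^ Suc k"])
  show "norm (hill_term q n k \<mu> ns * fourier q (t - sum_list ns)) \<le> C ^ Suc k * wprod n ns"
    if "ns \<in> hill_indices n k" for ns
    by (rule hill_coeff_summand_le[OF assms that])
qed (use assms C1 in \<open>simp_all add: near_def\<close>)

lemma hill_coeff_le:
  assumes "near n \<mu>"
  shows "norm (hill_coeff q n k t \<mu>) \<le> C ^ Suc k * wsum n ^ k"
  unfolding hill_coeff_def
proof (rule bounded_by_wprod(2)[of n "C ^ Suc k"])
  show "norm (hill_term q n k \<mu> ns * fourier q (t - sum_list ns)) \<le> C ^ Suc k * wprod n ns"
    if "ns \<in> hill_indices n k" for ns
    by (rule hill_coeff_summand_le[OF assms that])
qed (use assms C1 in \<open>simp_all add: near_def\<close>)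

lemma hill_coeff_lipschitz:
  assumes \<mu>: "near n \<mu>" and \<nu>: "near n \<nu>"
  shows "norm (hill_coeff q n k t \<mu> - hill_coeff q n k t \<nu>) \<le> C ^ Suc k * (real k * \<bar>\<mu> - \<nu>\<bar> / real n) * wsum n ^ k"
proof -
  define X where "X \<mu> ns = hill_term q n k \<mu> ns * fourier q (t - sum_list ns)" for \<mu> ns
  have X: "X \<mu> summable_on hill_indices n k" "X \<nu> summable_on hill_indices n k"
    unfolding X_def by (rule hill_coeff_summable[OF \<mu>], rule hill_coeff_summable[OF \<nu>])
  have "infsum (X \<mu>) (hill_indices n k) - infsum (X \<nu>) (hill_indices n k) = (\<Sum>\<^sub>\<infinity>ns\<in>hill_indices n k. X \<mu> ns - X \<nu> ns)"
    using infsum_add[OF X(1) iffD2[OF summable_on_uminus X(2)]] by (simp add: infsum_uminus)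
  then have "hill_coeff q n k t \<mu> - hill_coeff q n k t \<nu> =
    (\<Sum>\<^sub>\<infinity>ns\<in>hill_indices n k. (hill_term q n k \<mu> ns - hill_term q n k \<nu> ns) * fourier q (t - sum_list ns))"
    unfolding hill_coeff_def X_def left_diff_distrib .
  also have "norm \<dots> \<le> C ^ Suc k * (real k * \<bar>\<mu> - \<nu>\<bar> / real n) * wsum n ^ k"
  proof (rule bounded_by_wprod(2))
    fix ns assume "ns \<in> hill_indices n k"
    from mult_fourier_le[OF hill_term_lipschitz[OF \<mu> \<nu> this]]
    show "norm ((hill_term q n k \<mu> ns - hill_term q n k \<nu> ns) * fourier q (t - sum_list ns))
      \<le> C ^ Suc k * (real k * \<bar>\<mu> - \<nu>\<bar> / real n) * wprod n ns"
      by (simp add: mult_ac)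
  qed (use C1 \<mu> in \<open>auto simp: near_def\<close>)
  finally show ?thesis .
qed

definition hill_sum :: "nat \<Rightarrow> nat \<Rightarrow> int \<Rightarrow> real \<Rightarrow> complex" where
  "hill_sum n m t \<mu> = (\<Sum>k=1..m. hill_coeff q n k t \<mu>)"

lemma hill_A_eq: "hill_A q n m \<mu> = hill_sum n m 0 \<mu>"
  by (simp add: hill_A_def hill_sum_def hill_a_eq)

lemma hill_B_eq: "hill_B q n m \<mu> = hill_sum n m (2 * int n) \<mu>"
  by (simp add: hill_B_def hill_sum_def hill_b_eq)

lemma hill_sum_tail_le:
  assumes "near n \<mu>" "wsum n \<le> 1" "k \<le> m"
  shows "norm (hill_sum n m t \<mu> - hill_sum n k t \<mu>) \<le> real m * C ^ Suc m * wsum n ^ Suc k"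
proof -
  have "hill_sum n m t \<mu> = hill_sum n k t \<mu> + (\<Sum>i=Suc k..m. hill_coeff q n i t \<mu>)"
    unfolding hill_sum_def using assms(3) sum.ub_add_nat[of 1 k "\<lambda>i. hill_coeff q n i t \<mu>" "m - k"] by simp
  then have "norm (hill_sum n m t \<mu> - hill_sum n k t \<mu>) \<le> (\<Sum>i=Suc k..m. norm (hill_coeff q n i t \<mu>))"
    by (simp add: norm_sum)
  also have "\<dots> \<le> (\<Sum>i=Suc k..m. C ^ Suc m * wsum n ^ Suc k)"
  proof (rule sum_mono)
    fix i assume i: "i \<in> {Suc k..m}"
    have "norm (hill_coeff q n i t \<mu>) \<le> C ^ Suc i * wsum n ^ i" by (rule hill_coeff_le[OF assms(1)])
    also have "\<dots> \<le> C ^ Suc m * wsum n ^ Suc k"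
      using i C1 assms(2) by (intro mult_mono power_increasing power_decreasing wsum_nonneg zero_le_power) auto
    finally show "norm (hill_coeff q n i t \<mu>) \<le> C ^ Suc m * wsum n ^ Suc k" .
  qed
  also have "\<dots> = real (m - k) * (C ^ Suc m * wsum n ^ Suc k)" by simp
  also have "\<dots> \<le> real m * (C ^ Suc m * wsum n ^ Suc k)"
    using C1 wsum_nonneg[of n] by (intro mult_right_mono) auto
  finally show ?thesis by (simp add: mult_ac)
qed

lemma hill_sum_le:
  assumes "near n \<mu>" "wsum n \<le> 1"
  shows "norm (hill_sum n m t \<mu>) \<le> real m * C ^ Suc m * wsum n"
  using hill_sum_tail_le[OF assms, of 0 m t] by (simp add: hill_sum_def)

lemma hill_sum_lipschitz:
  assumes \<mu>: "near n \<mu>" and \<nu>: "near n \<nu>" and w: "wsum n \<le> 1"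
  shows "norm (hill_sum n m t \<mu> - hill_sum n m t \<nu>) \<le> (real m)\<^sup>2 * C ^ Suc m * (wsum n / real n) * \<bar>\<mu> - \<nu>\<bar>"
proof -
  have "norm (hill_sum n m t \<mu> - hill_sum n m t \<nu>) \<le> (\<Sum>k=1..m. norm (hill_coeff q n k t \<mu> - hill_coeff q n k t \<nu>))"
    unfolding hill_sum_def sum_subtractf[symmetric] by (rule norm_sum)
  also have "\<dots> \<le> (\<Sum>k=1..m. C ^ Suc m * (real m * \<bar>\<mu> - \<nu>\<bar> / real n) * wsum n)"
  proof (rule sum_mono)
    fix k assume k: "k \<in> {1..m}"
    have "norm (hill_coeff q n k t \<mu> - hill_coeff q n k t \<nu>) \<le> C ^ Suc k * (real k * \<bar>\<mu> - \<nu>\<bar> / real n) * wsum n ^ k"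
      by (rule hill_coeff_lipschitz[OF \<mu> \<nu>])
    also have "\<dots> \<le> C ^ Suc m * (real m * \<bar>\<mu> - \<nu>\<bar> / real n) * wsum n"
    proof (intro mult_mono)
      show "C ^ Suc k \<le> C ^ Suc m" using k C1 by (intro power_increasing) auto
      show "real k * \<bar>\<mu> - \<nu>\<bar> / real n \<le> real m * \<bar>\<mu> - \<nu>\<bar> / real n"
        using k by (intro divide_right_mono mult_right_mono) auto
      show "wsum n ^ k \<le> wsum n"
        using power_decreasing[of 1 k "wsum n"] k w wsum_nonneg[of n] by simp
    qed (use C1 wsum_nonneg[of n] in auto)
    finally show "norm (hill_coeff q n k t \<mu> - hill_coeff q n k t \<nu>)
      \<le> C ^ Suc m * (real m * \<bar>\<mu> - \<nu>\<bar> / real n) * wsum n" .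
  qed
  also have "\<dots> = (real m)\<^sup>2 * C ^ Suc m * (wsum n / real n) * \<bar>\<mu> - \<nu>\<bar>"
    by (simp add: power2_eq_square)
  finally show ?thesis .
qed

subsection \<open>The iteration\<close>

text \<open>The eigenvalue equation in sequence space. Summability is part of it because with merely
  bounded \<open>fourier q\<close> it is what makes the right-hand side converge.\<close>

definition sol :: "real \<Rightarrow> (int \<Rightarrow> complex) \<Rightarrow> bool" where
  "sol \<mu> u \<longleftrightarrow> abs_summable u UNIV \<and>
    (\<forall>k. of_real (\<mu> - (2 * pi * of_int k)\<^sup>2) * u k = (\<Sum>\<^sub>\<infinity>i. fourier q i * u (k - i)))"

abbreviation l1norm :: "(int \<Rightarrow> complex) \<Rightarrow> real" where
  "l1norm u \<equiv> (\<Sum>\<^sub>\<infinity>k. norm (u k))"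

lemma sol_convolution:
  assumes "sol \<mu> u"
  shows "abs_summable (\<lambda>i. fourier q i * u (k - i)) UNIV"
    and "norm (of_real (\<mu> - (2 * pi * of_int k)\<^sup>2) * u k) \<le> C * l1norm u"
proof -
  have s: "abs_summable (\<lambda>i. u (k - i)) UNIV"
    using assms by (simp add: sol_def abs_summable_reflect)
  note b = abs_summable_bounded_mult[OF bound s]
  show "abs_summable (\<lambda>i. fourier q i * u (k - i)) UNIV" by (rule b(1))
  have "(\<Sum>\<^sub>\<infinity>i. norm (u (k - i))) = l1norm u" by (rule abs_summable_reflect(2))
  then show "norm (of_real (\<mu> - (2 * pi * of_int k)\<^sup>2) * u k) \<le> C * l1norm u"
    using b(2) assms by (simp add: sol_def)
qed

text \<open>\<open>R k\<close> is the remainder after \<open>k\<close> substitutions: its last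
  factor \<open>v\<close> is the left side of the equation at the current frequency. Expanding
  \<open>v\<close> once more, the two indices leading to frequency n or -n produce the a_k and b_k
  terms. Every other index has a nonzero denominator, and dividing by it gives the summand of
  \<open>R (Suc k)\<close>.\<close>

lemma iteration_step:
  assumes \<mu>: "near n \<mu>" and u: "sol \<mu> u"
  defines "v \<equiv> \<lambda>l. of_real (\<mu> - (2 * pi * of_int l)\<^sup>2) * u l"
  defines "R \<equiv> \<lambda>k. \<Sum>\<^sub>\<infinity>ns\<in>hill_indices n k. hill_term q n k \<mu> ns * v (int n - sum_list ns)"
  shows "R k = hill_coeff q n k 0 \<mu> * u (int n) + hill_coeff q n k (2 * int n) \<mu> * u (- int n) + R (Suc k)"
    and "norm (R k) \<le> C ^ Suc k * l1norm u * wsum n ^ k"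
proof -
  have n: "n \<ge> 1" using \<mu> by (simp add: near_def)
  have M: "0 \<le> l1norm u" by (intro infsum_nonneg) auto
  have v_le: "norm (v l) \<le> C * l1norm u" for l
    unfolding v_def by (rule sol_convolution(2)[OF u])
  have Rb: "norm (hill_term q n k \<mu> ns * v l) \<le> (C ^ Suc k * l1norm u) * wprod n ns"
    if "ns \<in> hill_indices n k" for ns k l
  proof -
    have "norm (hill_term q n k \<mu> ns * v l) \<le> (C ^ k * wprod n ns) * (C * l1norm u)"
      unfolding norm_mult using hill_term_le[OF \<mu> that] v_le
      by (intro mult_mono) (auto intro!: mult_nonneg_nonneg C_power_nonneg wprod_nonneg)
    then show ?thesis by (simp add: mult_ac)
  qed
  have B: "0 \<le> C ^ Suc k * l1norm u" for k by (intro mult_nonneg_nonneg C_power_nonneg M)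
  show "norm (R k) \<le> C ^ Suc k * l1norm u * wsum n ^ k"
    unfolding R_def by (rule bounded_by_wprod(2)[OF n B Rb])
  have Rs: "(\<lambda>ns. hill_term q n (Suc k) \<mu> ns * v (int n - sum_list ns)) summable_on hill_indices n (Suc k)"
    by (rule abs_summable_summable[OF bounded_by_wprod(1)[OF n B Rb]])
  \<comment> \<open>The indices \<open>- s\<close> and \<open>2n - s\<close> are those for which the
    new frequency n - s - i equals n or -n. Dropping i = 0 is harmless since q has mean
    zero.\<close>
  have split: "v (int n - s) = fourier q (0 - s) * u (int n) + fourier q (2 * int n - s) * u (- int n)
      + (\<Sum>\<^sub>\<infinity>i\<in>{i. i \<noteq> 0 \<and> s + i \<noteq> 0 \<and> s + i \<noteq> 2 * int n}. fourier q i * u (int n - s - i))" for s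
  proof -
    let ?f = "\<lambda>i. fourier q i * u (int n - s - i)"
    let ?N = "{i. s + i \<noteq> 0 \<and> s + i \<noteq> 2 * int n}"
    have fs: "?f summable_on UNIV" by (rule abs_summable_summable[OF sol_convolution(1)[OF u]])
    have sN: "?f summable_on ?N" by (rule summable_on_subset_banach[OF fs]) simp
    have UN: "UNIV = {- s, 2 * int n - s} \<union> ?N" by auto
    have "v (int n - s) = infsum ?f UNIV" using u by (simp add: v_def sol_def)
    also have "\<dots> = infsum ?f {- s, 2 * int n - s} + infsum ?f ?N"
      by (subst UN, rule infsum_Un_disjoint) (use sN in auto)
    also have "infsum ?f {- s, 2 * int n - s} = fourier q (- s) * u (int n) + fourier q (2 * int n - s) * u (- int n)"
      using n by (simp add: algebra_simps)
    also have "infsum ?f ?N = (\<Sum>\<^sub>\<infinity>i\<in>{i. i \<noteq> 0 \<and> s + i \<noteq> 0 \<and> s + i \<noteq> 2 * int n}. ?f i)"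
      by (rule infsum_cong_neutral) (auto simp: mean0)
    finally show ?thesis by simp
  qed
  have inner: "hill_term q n k \<mu> ns * fourier q i * u (int n - sum_list ns - i) =
      hill_term q n (Suc k) \<mu> (ns @ [i]) * v (int n - sum_list (ns @ [i]))"
    if ns: "ns \<in> hill_indices n k" and i: "i \<in> next_indices n ns" for ns i
  proof -
    let ?l = "int n - (sum_list ns + i)"
    have d0: "\<mu> - (2 * pi * of_int ?l)\<^sup>2 \<noteq> 0"
      using \<mu> i by (intro inverse_denominator_le(1)) (auto simp: near_def next_indices_def)
    have D: "hill_denom n k \<mu> ns \<noteq> 0"
      using inverse_hill_denom_le[OF n _ ns] \<mu> by (auto simp: near_def)
    define d where "d = \<mu> - (2 * pi * of_int ?l)\<^sup>2"
    define P where "P = (\<Prod>i\<leftarrow>ns. fourier q i)"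
    have "hill_term q n (Suc k) \<mu> (ns @ [i]) * of_real d = P * fourier q i * of_real (1 / (hill_denom n k \<mu> ns * d) * d)"
      unfolding hill_term_def hill_denom_snoc[OF hill_indices_length[OF ns]] d_def P_def of_real_mult
      by (simp add: mult_ac)
    also have "1 / (hill_denom n k \<mu> ns * d) * d = 1 / hill_denom n k \<mu> ns"
      using d0 D unfolding d_def by (simp add: field_simps)
    finally have "hill_term q n (Suc k) \<mu> (ns @ [i]) * of_real (\<mu> - (2 * pi * of_int ?l)\<^sup>2) = hill_term q n k \<mu> ns * fourier q i"
      unfolding hill_term_def d_def P_def by (simp only: mult_ac)
    then have "hill_term q n (Suc k) \<mu> (ns @ [i]) * v ?l = hill_term q n k \<mu> ns * fourier q i * u ?l"
      unfolding v_def mult.assoc[symmetric] by (simp only:)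
    moreover have "int n - sum_list ns - i = ?l" "int n - sum_list (ns @ [i]) = ?l" by simp_all
    ultimately show ?thesis by (simp only:)
  qed
  define G where "G ns = (\<Sum>\<^sub>\<infinity>i\<in>next_indices n ns. hill_term q n (Suc k) \<mu> (ns @ [i]) * v (int n - sum_list (ns @ [i])))" for ns
  have summand: "hill_term q n k \<mu> ns * v (int n - sum_list ns) =
      hill_term q n k \<mu> ns * fourier q (0 - sum_list ns) * u (int n) +
      hill_term q n k \<mu> ns * fourier q (2 * int n - sum_list ns) * u (- int n) + G ns"
    if ns: "ns \<in> hill_indices n k" for ns
  proof -
    have "hill_term q n k \<mu> ns * (\<Sum>\<^sub>\<infinity>i\<in>next_indices n ns. fourier q i * u (int n - sum_list ns - i)) = G ns"
      unfolding G_def infsum_cmult_right'[symmetric] mult.assoc[symmetric]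
      by (intro infsum_cong inner ns)
    then show ?thesis
      unfolding split[of "sum_list ns", folded next_indices_def] distrib_left by (simp only: mult.assoc)
  qed
  have "(\<lambda>(ns, i). hill_term q n (Suc k) \<mu> (ns @ [i]) * v (int n - sum_list (ns @ [i])))
      summable_on (SIGMA ns:hill_indices n k. next_indices n ns)"
    using Rs by (simp only: summable_hill_indices_Suc)
  from summable_on_Sigma_banach[OF this] have Gs: "G summable_on hill_indices n k"
    unfolding G_def .
  define f where "f t l ns = hill_term q n k \<mu> ns * fourier q (t - sum_list ns) * u l" for t l ns
  have fs: "f t l summable_on hill_indices n k" for t l
    unfolding f_def by (rule summable_on_cmult_left[OF hill_coeff_summable[OF \<mu>]])
  have "R k = (\<Sum>\<^sub>\<infinity>ns\<in>hill_indices n k. f 0 (int n) ns + f (2 * int n) (- int n) ns + G ns)"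
    unfolding R_def f_def by (intro infsum_cong summand)
  also have "\<dots> = infsum (f 0 (int n)) (hill_indices n k) + infsum (f (2 * int n) (- int n)) (hill_indices n k) + infsum G (hill_indices n k)"
    using infsum_add[OF summable_on_add[OF fs fs] Gs] infsum_add[OF fs fs] by simp
  also have "infsum G (hill_indices n k) = R (Suc k)"
    unfolding R_def infsum_hill_indices_Suc[OF Rs] G_def ..
  finally show "R k = hill_coeff q n k 0 \<mu> * u (int n) + hill_coeff q n k (2 * int n) \<mu> * u (- int n) + R (Suc k)"
    unfolding hill_coeff_def f_def infsum_cmult_left' .
qed

text \<open>Summing \<open>iteration_step\<close> over k = 0, ..., m telescopes the remainders. The
  terms with k = 0 are q_0 = 0 and q_{2n}, so only \<open>R (Suc m)\<close> is left as
  error.\<close>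

theorem iteration:
  assumes \<mu>: "near n \<mu>" and u: "sol \<mu> u"
  shows "norm ((of_real (\<mu> - (2 * pi * real n)\<^sup>2) - hill_A q n m \<mu>) * u (int n)
      - (fourier q (2 * int n) + hill_B q n m \<mu>) * u (- int n))
    \<le> C ^ (m + 2) * wsum n ^ (m + 1) * l1norm u"
proof -
  define v where "v = (\<lambda>l. of_real (\<mu> - (2 * pi * of_int l)\<^sup>2) * u l)"
  define R where "R = (\<lambda>k. \<Sum>\<^sub>\<infinity>ns\<in>hill_indices n k. hill_term q n k \<mu> ns * v (int n - sum_list ns))"
  have step: "R k = hill_coeff q n k 0 \<mu> * u (int n) + hill_coeff q n k (2 * int n) \<mu> * u (- int n) + R (Suc k)"
    "norm (R k) \<le> C ^ Suc k * l1norm u * wsum n ^ k" for k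
    unfolding R_def v_def by (rule iteration_step[OF \<mu> u])+
  have "R 0 = (\<Sum>k=0..m. hill_coeff q n k 0 \<mu>) * u (int n) + (\<Sum>k=0..m. hill_coeff q n k (2 * int n) \<mu>) * u (- int n) + R (Suc m)"
  proof (induction m)
    case (Suc m)
    then show ?case using step(1)[of "Suc m"] by (simp add: algebra_simps)
  qed (use step(1)[of 0] in simp)
  moreover have "(\<Sum>k=0..m. hill_coeff q n k t \<mu>) = fourier q t + hill_sum n m t \<mu>" for t
    by (simp add: sum.atLeast_Suc_atMost hill_sum_def hill_coeff_def[of _ _ 0] hill_indices_0 hill_term_def hill_denom_def)
  moreover have "R 0 = of_real (\<mu> - (2 * pi * real n)\<^sup>2) * u (int n)"
    by (simp add: R_def hill_indices_0 hill_term_def hill_denom_def v_def)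
  ultimately have "(of_real (\<mu> - (2 * pi * real n)\<^sup>2) - hill_A q n m \<mu>) * u (int n)
      - (fourier q (2 * int n) + hill_B q n m \<mu>) * u (- int n) = R (Suc m)"
    unfolding hill_A_eq hill_B_eq by (simp add: mean0 algebra_simps)
  then show ?thesis using step(2)[of "Suc m"] by (simp add: mult_ac)
qed

end

subsection \<open>The two by two system\<close>

text \<open>Lagrange's identity in C^2: for nearly orthogonal vectors the determinant is nearly as
  large as possible.\<close>

lemma norm_determinant_identity:
  fixes a b c d :: complex
  shows "(norm (a * d - b * c))\<^sup>2 + (norm (a * cnj c + b * cnj d))\<^sup>2 = ((norm a)\<^sup>2 + (norm b)\<^sup>2) * ((norm c)\<^sup>2 + (norm d)\<^sup>2)"
proof -
  have "complex_of_real ((norm (a * d - b * c))\<^sup>2 + (norm (a * cnj c + b * cnj d))\<^sup>2)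
    = complex_of_real (((norm a)\<^sup>2 + (norm b)\<^sup>2) * ((norm c)\<^sup>2 + (norm d)\<^sup>2))"
    by (simp only: of_real_add of_real_mult complex_norm_square complex_cnj_diff complex_cnj_mult complex_cnj_add complex_cnj_cnj)
      (simp add: algebra_simps)
  then show ?thesis by (simp only: of_real_eq_iff)
qed

text \<open>Multiplying by the adjugate expresses (D^2 - |\<beta>|^2) a and (D^2 - |\<beta>|^2) b by
  the residuals. The factor |D| + |\<beta>| cancels against the factorization of D^2 - |\<beta>|^2.
  The 4 is 2 for the two components times 2 from the bound on \<open>M\<close>.\<close>

lemma hermitian_two_by_two:
  fixes a b \<beta> :: complex and D \<delta> M :: real
  assumes 1: "norm (of_real D * a - \<beta> * b) \<le> \<delta> * M" and 2: "norm (of_real D * b - cnj \<beta> * a) \<le> \<delta> * M"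
    and M: "0 < M" "M \<le> 2 * (norm a + norm b)"
  shows "\<bar>\<bar>D\<bar> - norm \<beta>\<bar> \<le> 4 * \<delta>"
proof -
  have key: "\<bar>D\<^sup>2 - (norm \<beta>)\<^sup>2\<bar> * norm x \<le> (\<bar>D\<bar> + norm \<beta>) * (\<delta> * M)"
    if "norm (of_real D * x - \<gamma> * y) \<le> \<delta> * M" "norm (of_real D * y - cnj \<gamma> * x) \<le> \<delta> * M" "norm \<gamma> = norm \<beta>"
    for x y \<gamma>
  proof -
    have "of_real (D\<^sup>2 - (norm \<beta>)\<^sup>2) * x = of_real D * (of_real D * x - \<gamma> * y) + \<gamma> * (of_real D * y - cnj \<gamma> * x)"
      unfolding that(3)[symmetric] of_real_diff complex_norm_square by (simp add: power2_eq_square algebra_simps)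
    then have "norm (of_real (D\<^sup>2 - (norm \<beta>)\<^sup>2) * x) \<le>
        norm (of_real D * (of_real D * x - \<gamma> * y)) + norm (\<gamma> * (of_real D * y - cnj \<gamma> * x))"
      by (simp only: norm_triangle_ineq)
    also have "\<dots> \<le> \<bar>D\<bar> * (\<delta> * M) + norm \<beta> * (\<delta> * M)"
      unfolding norm_mult norm_of_real that(3) using that(1,2) by (intro add_mono mult_left_mono) auto
    finally show ?thesis unfolding norm_mult norm_of_real by (simp add: distrib_right)
  qed
  have \<delta>: "0 \<le> \<delta>" using order_trans[OF norm_ge_zero 1] M(1) by (simp add: zero_le_mult_iff)
  have "\<bar>D\<^sup>2 - (norm \<beta>)\<^sup>2\<bar> * (norm a + norm b) \<le> 2 * ((\<bar>D\<bar> + norm \<beta>) * (\<delta> * M))"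
    using key[OF 1 2] key[of b "cnj \<beta>" a] 1 2 by (simp add: distrib_left)
  also have "\<dots> \<le> 2 * ((\<bar>D\<bar> + norm \<beta>) * (\<delta> * (2 * (norm a + norm b))))"
    using M \<delta> by (intro mult_left_mono) auto
  finally have "\<bar>D\<^sup>2 - (norm \<beta>)\<^sup>2\<bar> * (norm a + norm b) \<le> ((\<bar>D\<bar> + norm \<beta>) * (4 * \<delta>)) * (norm a + norm b)"
    by (simp add: algebra_simps)
  moreover have "norm a + norm b > 0" using less_le_trans[OF M] by simp
  ultimately have "\<bar>D\<^sup>2 - (norm \<beta>)\<^sup>2\<bar> \<le> (\<bar>D\<bar> + norm \<beta>) * (4 * \<delta>)" by (simp only: mult_le_cancel_right_pos)
  moreover have "\<bar>D\<^sup>2 - (norm \<beta>)\<^sup>2\<bar> = (\<bar>D\<bar> + norm \<beta>) * \<bar>\<bar>D\<bar> - norm \<beta>\<bar>"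
  proof -
    have "D\<^sup>2 - (norm \<beta>)\<^sup>2 = (\<bar>D\<bar> + norm \<beta>) * (\<bar>D\<bar> - norm \<beta>)"
      by (simp add: power2_eq_square algebra_simps flip: abs_mult)
    then show ?thesis by (simp add: abs_mult)
  qed
  ultimately have le: "(\<bar>D\<bar> + norm \<beta>) * \<bar>\<bar>D\<bar> - norm \<beta>\<bar> \<le> (\<bar>D\<bar> + norm \<beta>) * (4 * \<delta>)" by simp
  show ?thesis
  proof (cases "\<bar>D\<bar> + norm \<beta> = 0")
    case True
    then have "\<bar>D\<bar> = 0" "norm \<beta> = 0" by (smt (verit) norm_ge_zero)+
    then show ?thesis using \<delta> by simp
  next
    case False
    then have "\<bar>D\<bar> + norm \<beta> > 0" by (smt (verit) norm_ge_zero)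
    then show ?thesis using le by (simp only: mult_le_cancel_left_pos)
  qed
qed

text \<open>Two nearly orthogonal approximate null vectors force the matrix itself to be small.\<close>

lemma two_by_two_degenerate:
  fixes a b c d \<beta>1 \<beta>2 :: complex and D1 D2 \<delta> \<eta> M1 M2 :: real
  assumes 1: "norm (of_real D1 * a - \<beta>1 * b) \<le> \<delta> * M1" and 2: "norm (of_real D2 * c - \<beta>2 * d) \<le> \<delta> * M2"
    and close: "\<bar>D1 - D2\<bar> \<le> \<eta>" "norm (\<beta>1 - \<beta>2) \<le> \<eta>"
    and M1: "0 < M1" "M1 \<le> 2 * (norm a + norm b)" "norm b \<le> M1"
    and M2: "0 < M2" "M2 \<le> 2 * (norm c + norm d)" "norm c \<le> M2" "norm d \<le> M2"
    and orth: "norm (a * cnj c + b * cnj d) \<le> M1 * M2 / 16"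
  shows "\<bar>D1\<bar> \<le> 16 * (2 * \<delta> + 2 * \<eta>)"
proof -
  have \<delta>: "0 \<le> \<delta>" using order_trans[OF norm_ge_zero 1] M1(1) by (simp add: zero_le_mult_iff)
  have \<eta>: "0 \<le> \<eta>" using close by linarith
  have sq: "M\<^sup>2 / 8 \<le> (norm x)\<^sup>2 + (norm y)\<^sup>2" if "0 < M" "M \<le> 2 * (norm x + norm y)" for M and x y :: complex
  proof -
    have "M\<^sup>2 \<le> (2 * (norm x + norm y))\<^sup>2" using that by (intro power_mono) auto
    also have "\<dots> \<le> 8 * ((norm x)\<^sup>2 + (norm y)\<^sup>2)"
      using sum_squares_bound[of "norm x" "norm y"] by (simp add: power2_eq_square algebra_simps)
    finally show ?thesis by simp
  qed
  have "(M1\<^sup>2 / 8) * (M2\<^sup>2 / 8) \<le> ((norm a)\<^sup>2 + (norm b)\<^sup>2) * ((norm c)\<^sup>2 + (norm d)\<^sup>2)"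
    using sq[OF M1(1,2)] sq[OF M2(1,2)] by (intro mult_mono) auto
  also have "\<dots> = (norm (a * d - b * c))\<^sup>2 + (norm (a * cnj c + b * cnj d))\<^sup>2"
    by (rule norm_determinant_identity[symmetric])
  also have "\<dots> \<le> (norm (a * d - b * c))\<^sup>2 + (M1 * M2 / 16)\<^sup>2"
    using orth by (intro add_left_mono power_mono) auto
  \<comment> \<open>The left side is M1^2 M2^2 / 64, four copies of this square; near orthogonality
    consumes one of them.\<close>
  finally have "(M1 * M2 / 16)\<^sup>2 \<le> (norm (a * d - b * c))\<^sup>2"
  proof -
    have "(M1\<^sup>2 / 8) * (M2\<^sup>2 / 8) = 4 * (M1 * M2 / 16)\<^sup>2"
      by (simp add: power_mult_distrib power_divide)
    moreover have "0 \<le> (M1 * M2 / 16)\<^sup>2" by (rule zero_le_power2)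
    moreover assume "(M1\<^sup>2 / 8) * (M2\<^sup>2 / 8) \<le> (norm (a * d - b * c))\<^sup>2 + (M1 * M2 / 16)\<^sup>2"
    ultimately show ?thesis by linarith
  qed
  then have det: "M1 * M2 / 16 \<le> norm (a * d - b * c)"
    by (rule power2_le_imp_le) simp
  \<comment> \<open>The second vector is tested against the first matrix, at the price of the
    differences of the entries.\<close>
  have "norm (of_real D1 * c - \<beta>1 * d) \<le> norm (of_real D2 * c - \<beta>2 * d) + norm (of_real (D1 - D2) * c) + norm ((\<beta>1 - \<beta>2) * d)"
  proof -
    have "of_real D1 * c - \<beta>1 * d = (of_real D2 * c - \<beta>2 * d) + of_real (D1 - D2) * c - (\<beta>1 - \<beta>2) * d"
      by (simp add: algebra_simps)
    then show ?thesis
      using norm_triangle_ineq4[of "(of_real D2 * c - \<beta>2 * d) + of_real (D1 - D2) * c" "(\<beta>1 - \<beta>2) * d"]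
        norm_triangle_ineq[of "of_real D2 * c - \<beta>2 * d" "of_real (D1 - D2) * c"] by simp
  qed
  also have "\<dots> \<le> \<delta> * M2 + \<eta> * M2 + \<eta> * M2"
    unfolding norm_mult norm_of_real using 2 close M2 \<eta> by (intro add_mono mult_mono) auto
  finally have c2: "norm (of_real D1 * c - \<beta>1 * d) \<le> (\<delta> + 2 * \<eta>) * M2" by (simp add: algebra_simps)
  \<comment> \<open>Cramer's rule: with a determinant bounded below, small residuals of both vectors
    force D1 to be small.\<close>
  have "of_real D1 * (a * d - b * c) = (of_real D1 * a - \<beta>1 * b) * d - (of_real D1 * c - \<beta>1 * d) * b"
    by (simp add: algebra_simps)
  then have "\<bar>D1\<bar> * norm (a * d - b * c) = norm ((of_real D1 * a - \<beta>1 * b) * d - (of_real D1 * c - \<beta>1 * d) * b)"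
    by (metis norm_mult norm_of_real)
  also have "\<dots> \<le> norm (of_real D1 * a - \<beta>1 * b) * norm d + norm (of_real D1 * c - \<beta>1 * d) * norm b"
    unfolding norm_mult[symmetric] by (rule norm_triangle_ineq4)
  also have "\<dots> \<le> (\<delta> * M1) * M2 + ((\<delta> + 2 * \<eta>) * M2) * M1"
    using 1 c2 M1 M2 \<delta> \<eta> by (intro add_mono mult_mono) auto
  finally have "\<bar>D1\<bar> * norm (a * d - b * c) \<le> (2 * \<delta> + 2 * \<eta>) * (M1 * M2)" by (simp add: algebra_simps)
  moreover have "\<bar>D1\<bar> * (M1 * M2 / 16) \<le> \<bar>D1\<bar> * norm (a * d - b * c)"
    by (intro mult_left_mono det) simp
  ultimately have "\<bar>D1\<bar> / 16 * (M1 * M2) \<le> (2 * \<delta> + 2 * \<eta>) * (M1 * M2)" by simp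
  then have "\<bar>D1\<bar> / 16 \<le> 2 * \<delta> + 2 * \<eta>"
    using M1 M2 by (simp only: mult_le_cancel_right_pos mult_pos_pos)
  then show ?thesis by (simp add: field_simps)
qed

context bounded_coeffs
begin

section \<open>Concentration on the frequencies n and -n, and orthogonality\<close>

lemma l1norm_ge: "abs_summable u UNIV \<Longrightarrow> norm (u k) \<le> l1norm u"
  using finite_sum_le_infsum[of "\<lambda>k. norm (u k)" UNIV "{k}"] by simp

lemma sol_le:
  assumes \<mu>: "near n \<mu>" and u: "sol \<mu> u" and l: "l \<noteq> int n" "l \<noteq> - int n"
  shows "norm (u l) \<le> C * l1norm u * wgt n (int n - l)"
proof -
  define d where "d = \<mu> - (2 * pi * of_int l)\<^sup>2"
  have d: "d \<noteq> 0" "1 / \<bar>d\<bar> \<le> wgt n (int n - l)"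
    using inverse_denominator_le[of n \<mu> "int n - l"] \<mu> l by (auto simp: near_def d_def)
  have "\<bar>d\<bar> * norm (u l) \<le> C * l1norm u"
    using sol_convolution(2)[OF u, of l] unfolding d_def[symmetric] norm_mult norm_of_real .
  then have "norm (u l) \<le> C * l1norm u * (1 / \<bar>d\<bar>)"
    using d(1) by (simp add: field_simps)
  also have "\<dots> \<le> C * l1norm u * wgt n (int n - l)"
    using d(2) C1 by (intro mult_left_mono mult_nonneg_nonneg infsum_nonneg) auto
  finally show ?thesis .
qed

lemma infsum_split_pm:
  fixes f :: "int \<Rightarrow> 'b::banach"
  assumes "f summable_on UNIV" "n \<ge> (1::nat)"
  shows "infsum f UNIV = f (int n) + f (- int n) + infsum f (- {int n, - int n})"
proof -
  have "f summable_on - {int n, - int n}" by (rule summable_on_subset_banach[OF assms(1)]) simp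
  then have "infsum f ({int n, - int n} \<union> - {int n, - int n}) = infsum f {int n, - int n} + infsum f (- {int n, - int n})"
    by (intro infsum_Un_disjoint) auto
  moreover have "infsum f {int n, - int n} = f (int n) + f (- int n)" using assms(2) by simp
  ultimately show ?thesis by (simp only: Compl_partition)
qed

text \<open>The coefficients at the other frequencies carry at most the fraction
  \<open>C * wsum n\<close> of the norm. This supplies the condition M \<le> 2 (|a| + |b|) of the
  two by two lemmas.\<close>

lemma l1norm_le:
  assumes \<mu>: "near n \<mu>" and u: "sol \<mu> u" and small: "C * wsum n \<le> 1 / 2"
  shows "l1norm u \<le> 2 * (norm (u (int n)) + norm (u (- int n)))"
proof -
  have n: "n \<ge> 1" using \<mu> by (simp add: near_def)
  have us: "abs_summable u UNIV" using u by (simp add: sol_def)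
  let ?X = "- {int n, - int n}"
  have M: "0 \<le> C * l1norm u" using C1 by (intro mult_nonneg_nonneg infsum_nonneg) auto
  have "(\<Sum>\<^sub>\<infinity>l\<in>?X. norm (u l)) \<le> (\<Sum>\<^sub>\<infinity>l\<in>?X. C * l1norm u * wgt n (int n - l))"
    by (rule infsum_mono[OF summable_on_subset_banach[OF us] summable_on_cmult_right[OF wgt_reflect(1)[OF n]]])
      (auto intro: sol_le[OF \<mu> u])
  also have "\<dots> \<le> C * l1norm u * wsum n"
    unfolding infsum_cmult_right' using M by (intro mult_left_mono wgt_reflect n)
  also have "\<dots> = (C * wsum n) * l1norm u" by (simp add: mult_ac)
  also have "\<dots> \<le> 1 / 2 * l1norm u" using small by (intro mult_right_mono infsum_nonneg) auto
  finally show ?thesis using infsum_split_pm[OF us n] by simp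
qed

text \<open>As \<open>q\<close> is real, the conjugate of an eigenfunction is one too. The map
  exchanges u_n and u_{-n} up to conjugation, and so yields the second row of the system from the
  first.\<close>

lemma sol_cnj:
  assumes "sol \<mu> u"
  shows "sol \<mu> (\<lambda>k. cnj (u (- k)))" and "l1norm (\<lambda>k. cnj (u (- k))) = l1norm u"
proof -
  have us: "abs_summable u UNIV" using assms by (simp add: sol_def)
  show "l1norm (\<lambda>k. cnj (u (- k))) = l1norm u"
    using abs_summable_reflect(2)[of "\<lambda>k. norm (u k)" 0] by simp
  have eq: "of_real (\<mu> - (2 * pi * of_int k)\<^sup>2) * cnj (u (- k)) = (\<Sum>\<^sub>\<infinity>i. fourier q i * cnj (u (- (k - i))))" for k
  proof -
    have "of_real (\<mu> - (2 * pi * of_int k)\<^sup>2) * cnj (u (- k)) = cnj (of_real (\<mu> - (2 * pi * of_int (- k))\<^sup>2) * u (- k))"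
      by simp
    also have "\<dots> = cnj (\<Sum>\<^sub>\<infinity>i. fourier q i * u (- k - i))" using assms by (simp only: sol_def)
    also have "\<dots> = (\<Sum>\<^sub>\<infinity>i. cnj (fourier q i) * cnj (u (- k - i)))" by (simp only: infsum_cnj[symmetric] complex_cnj_mult)
    also have "\<dots> = (\<Sum>\<^sub>\<infinity>i. fourier q (0 - i) * cnj (u (- (k - (0 - i)))))" by (simp add: cnj_fourier)
    also have "\<dots> = (\<Sum>\<^sub>\<infinity>i. fourier q i * cnj (u (- (k - i))))"
      by (rule abs_summable_reflect(2)[of "\<lambda>i. fourier q i * cnj (u (- (k - i)))" 0])
    finally show ?thesis .
  qed
  show "sol \<mu> (\<lambda>k. cnj (u (- k)))"
    unfolding sol_def using us abs_summable_reflect(1)[of u 0] eq by simp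
qed

lemma sol_lincomb:
  assumes "sol \<mu> u" "sol \<mu> v"
  shows "sol \<mu> (\<lambda>k. a * u k + b * v k)"
  unfolding sol_def
proof (intro conjI allI)
  have us: "abs_summable u UNIV" "abs_summable v UNIV" using assms by (simp_all add: sol_def)
  show "abs_summable (\<lambda>k. a * u k + b * v k) UNIV"
  proof (rule Infinite_Sum.abs_summable_on_comparison_test')
    show "(\<lambda>k. norm a * norm (u k) + norm b * norm (v k)) summable_on UNIV"
      by (intro summable_on_add summable_on_cmult_right us)
    show "norm (a * u k + b * v k) \<le> norm a * norm (u k) + norm b * norm (v k)" for k
      unfolding norm_mult[symmetric] by (rule norm_triangle_ineq)
  qed
  fix k
  have s: "(\<lambda>i. fourier q i * u (k - i)) summable_on UNIV" "(\<lambda>i. fourier q i * v (k - i)) summable_on UNIV"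
    by (rule abs_summable_summable[OF sol_convolution(1)[OF assms(1)]], rule abs_summable_summable[OF sol_convolution(1)[OF assms(2)]])
  have "(\<Sum>\<^sub>\<infinity>i. fourier q i * (a * u (k - i) + b * v (k - i))) =
      (\<Sum>\<^sub>\<infinity>i. a * (fourier q i * u (k - i)) + b * (fourier q i * v (k - i)))"
    by (simp add: algebra_simps)
  also have "\<dots> = a * (\<Sum>\<^sub>\<infinity>i. fourier q i * u (k - i)) + b * (\<Sum>\<^sub>\<infinity>i. fourier q i * v (k - i))"
    using infsum_add[OF summable_on_cmult_right[OF s(1)] summable_on_cmult_right[OF s(2)], of a b]
    by (simp only: infsum_cmult_right')
  also have "\<dots> = a * (of_real (\<mu> - (2 * pi * of_int k)\<^sup>2) * u k) + b * (of_real (\<mu> - (2 * pi * of_int k)\<^sup>2) * v k)"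
    using assms by (simp only: sol_def)
  finally show "of_real (\<mu> - (2 * pi * of_int k)\<^sup>2) * (a * u k + b * v k) = (\<Sum>\<^sub>\<infinity>i. fourier q i * (a * u (k - i) + b * v (k - i)))"
    by (simp only: algebra_simps)
qed

text \<open>Self-adjointness: both sums below equal the double sum over \<open>q\<^sub>k\<^sub>-\<^sub>i u\<^sub>i v\<^sub>k\<^sup>*\<close>.\<close>

lemma sol_orthogonal:
  assumes u: "sol \<mu> u" and v: "sol \<nu> v" and ne: "\<mu> \<noteq> \<nu>"
  shows "(\<Sum>\<^sub>\<infinity>k. u k * cnj (v k)) = 0" and "(\<lambda>k. u k * cnj (v k)) summable_on UNIV"
proof -
  have us: "abs_summable u UNIV" "abs_summable v UNIV" using u v by (simp_all add: sol_def)
  have vc: "abs_summable (\<lambda>k. cnj (v k)) UNIV" using us by simp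
  show s: "(\<lambda>k. u k * cnj (v k)) summable_on UNIV"
    by (rule abs_summable_summable[OF abs_summable_bounded_mult(1)[OF l1norm_ge[OF us(1)] vc]])
  define F where "F k i = fourier q (k - i) * u i * cnj (v k)" for k i
  have "abs_summable (\<lambda>(k, i). F k i) (UNIV \<times> UNIV)"
  proof (rule Infinite_Sum.abs_summable_on_comparison_test')
    have "(\<lambda>(k, i). norm (v k) * norm (u i)) summable_on UNIV \<times> UNIV"
    proof (rule summable_on_SigmaI)
      show "((\<lambda>i. case (k, i) of (k, i) \<Rightarrow> norm (v k) * norm (u i)) has_sum norm (v k) * l1norm u) UNIV" for k
        by (simp add: has_sum_cmult_right has_sum_infsum us)
      show "(\<lambda>k. norm (v k) * l1norm u) summable_on UNIV" by (intro summable_on_cmult_left us)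
    qed auto
    then show "(\<lambda>x. C * (case x of (k, i) \<Rightarrow> norm (v k) * norm (u i))) summable_on UNIV \<times> UNIV"
      by (rule summable_on_cmult_right)
    have "norm (F k i) \<le> C * (norm (v k) * norm (u i))" for k i
      unfolding F_def norm_mult
      using mult_right_mono[OF bound[of "k - i"], of "norm (v k) * norm (u i)"] by (simp add: mult_ac)
    then show "norm (case x of (k, i) \<Rightarrow> F k i) \<le> C * (case x of (k, i) \<Rightarrow> norm (v k) * norm (u i))" for x
      by (cases x) auto
  qed
  then have Fs: "(\<lambda>(k, i). F k i) summable_on (UNIV \<times> UNIV)" by (rule abs_summable_summable)
  have 1: "(\<Sum>\<^sub>\<infinity>i. F k i) = of_real (\<mu> - (2 * pi * of_int k)\<^sup>2) * u k * cnj (v k)" for k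
  proof -
    have "(\<Sum>\<^sub>\<infinity>i. F k i) = (\<Sum>\<^sub>\<infinity>i. fourier q (k - i) * u (k - (k - i))) * cnj (v k)"
      unfolding F_def infsum_cmult_left' by simp
    also have "(\<Sum>\<^sub>\<infinity>i. fourier q (k - i) * u (k - (k - i))) = (\<Sum>\<^sub>\<infinity>i. fourier q i * u (k - i))"
      by (rule abs_summable_reflect(2)[of "\<lambda>i. fourier q i * u (k - i)" k])
    also have "\<dots> = of_real (\<mu> - (2 * pi * of_int k)\<^sup>2) * u k" using u by (simp only: sol_def)
    finally show ?thesis .
  qed
  have 2: "(\<Sum>\<^sub>\<infinity>k. F k i) = of_real (\<nu> - (2 * pi * of_int i)\<^sup>2) * u i * cnj (v i)" for i
  proof -
    have "(\<Sum>\<^sub>\<infinity>k. F k i) = u i * cnj (\<Sum>\<^sub>\<infinity>k. fourier q (i - k) * v (i - (i - k)))"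
      unfolding F_def infsum_cnj[symmetric] infsum_cmult_right'[symmetric] by (simp add: cnj_fourier mult_ac)
    also have "(\<Sum>\<^sub>\<infinity>k. fourier q (i - k) * v (i - (i - k))) = (\<Sum>\<^sub>\<infinity>k. fourier q k * v (i - k))"
      by (rule abs_summable_reflect(2)[of "\<lambda>k. fourier q k * v (i - k)" i])
    also have "\<dots> = of_real (\<nu> - (2 * pi * of_int i)\<^sup>2) * v i" using v by (simp only: sol_def)
    finally show ?thesis by simp
  qed
  have s1: "(\<lambda>k. of_real (\<mu> - (2 * pi * of_int k)\<^sup>2) * u k * cnj (v k)) summable_on UNIV"
    using summable_on_Sigma_banach[OF Fs] unfolding 1 .
  have "(\<lambda>(i, k). F k i) summable_on UNIV \<times> UNIV"
    using Fs by (subst (asm) summable_on_swap) (simp add: case_prod_unfold)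
  from summable_on_Sigma_banach[OF this]
  have s2: "(\<lambda>k. of_real (\<nu> - (2 * pi * of_int k)\<^sup>2) * u k * cnj (v k)) summable_on UNIV"
    unfolding 2 .
  have eq: "(\<Sum>\<^sub>\<infinity>k. of_real (\<mu> - (2 * pi * of_int k)\<^sup>2) * u k * cnj (v k)) = (\<Sum>\<^sub>\<infinity>k. of_real (\<nu> - (2 * pi * of_int k)\<^sup>2) * u k * cnj (v k))"
    using infsum_swap_banach[OF Fs] unfolding 1 2 .
  have "(\<Sum>\<^sub>\<infinity>k. of_real (\<mu> - \<nu>) * (u k * cnj (v k)) + of_real (\<nu> - (2 * pi * of_int k)\<^sup>2) * u k * cnj (v k)) =
      (\<Sum>\<^sub>\<infinity>k. of_real (\<mu> - (2 * pi * of_int k)\<^sup>2) * u k * cnj (v k))"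
    by (rule infsum_cong) (simp add: algebra_simps)
  moreover have "(\<Sum>\<^sub>\<infinity>k. of_real (\<mu> - \<nu>) * (u k * cnj (v k)) + of_real (\<nu> - (2 * pi * of_int k)\<^sup>2) * u k * cnj (v k)) =
      of_real (\<mu> - \<nu>) * (\<Sum>\<^sub>\<infinity>k. u k * cnj (v k)) + (\<Sum>\<^sub>\<infinity>k. of_real (\<nu> - (2 * pi * of_int k)\<^sup>2) * u k * cnj (v k))"
    using infsum_add[OF summable_on_cmult_right[OF s] s2, of "of_real (\<mu> - \<nu>)"] unfolding infsum_cmult_right' .
  ultimately have "of_real (\<mu> - \<nu>) * (\<Sum>\<^sub>\<infinity>k. u k * cnj (v k)) = 0" using eq by simp
  moreover have "of_real (\<mu> - \<nu>) \<noteq> (0 :: complex)" using ne by simp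
  ultimately show "(\<Sum>\<^sub>\<infinity>k. u k * cnj (v k)) = 0" by (simp only: mult_eq_0_iff) simp
qed

text \<open>The full inner product vanishes, so the two resonant terms equal minus the remaining
  ones. These carry two weights each, one of which is bounded by 1.\<close>

lemma sol_nearly_orthogonal:
  assumes \<mu>: "near n \<mu>" and \<nu>: "near n \<nu>" and u: "sol \<mu> u" and v: "sol \<nu> v" and ne: "\<mu> \<noteq> \<nu>"
  shows "norm (u (int n) * cnj (v (int n)) + u (- int n) * cnj (v (- int n))) \<le> C\<^sup>2 * wsum n * l1norm u * l1norm v"
proof -
  have n: "n \<ge> 1" using \<mu> by (simp add: near_def)
  let ?X = "- {int n, - int n}"
  have M: "0 \<le> l1norm u" "0 \<le> l1norm v" by (auto intro!: infsum_nonneg)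
  have s: "(\<lambda>k. u k * cnj (v k)) summable_on ?X"
    by (rule summable_on_subset_banach[OF sol_orthogonal(2)[OF u v ne]]) simp
  have ws: "(\<lambda>l. (C * l1norm u) * (C * l1norm v) * wgt n (int n - l)) summable_on ?X"
    by (intro summable_on_cmult_right wgt_reflect n)
  have "u (int n) * cnj (v (int n)) + u (- int n) * cnj (v (- int n)) = - (\<Sum>\<^sub>\<infinity>k\<in>?X. u k * cnj (v k))"
    using infsum_split_pm[OF sol_orthogonal(2)[OF u v ne] n] sol_orthogonal(1)[OF u v ne]
    by (simp add: add_eq_0_iff2)
  then have "norm (u (int n) * cnj (v (int n)) + u (- int n) * cnj (v (- int n))) = norm (\<Sum>\<^sub>\<infinity>k\<in>?X. u k * cnj (v k))"
    by simp
  also have "\<dots> \<le> (\<Sum>\<^sub>\<infinity>l\<in>?X. (C * l1norm u) * (C * l1norm v) * wgt n (int n - l))"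
  proof (rule norm_infsum_le[OF has_sum_infsum[OF s] has_sum_infsum[OF ws]])
    fix l assume "l \<in> ?X"
    then have l: "l \<noteq> int n" "l \<noteq> - int n" by auto
    have "wgt n (int n - l) \<le> 1"
      using wgt_le[OF n, of "int n - l"] n by (auto intro: order_trans simp: divide_le_eq)
    then have w: "wgt n (int n - l) * wgt n (int n - l) \<le> wgt n (int n - l)"
      using wgt_nonneg[of n] by (intro mult_left_le) auto
    have "norm (u l * cnj (v l)) \<le> (C * l1norm u * wgt n (int n - l)) * (C * l1norm v * wgt n (int n - l))"
      unfolding norm_mult complex_mod_cnj using sol_le[OF \<mu> u l] sol_le[OF \<nu> v l] C1 M wgt_nonneg[of n]
      by (intro mult_mono) auto
    also have "\<dots> = (C * l1norm u) * (C * l1norm v) * (wgt n (int n - l) * wgt n (int n - l))"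
      by (simp only: mult_ac)
    also have "\<dots> \<le> (C * l1norm u) * (C * l1norm v) * wgt n (int n - l)"
      using C1 M by (intro mult_left_mono w) auto
    finally show "norm (u l * cnj (v l)) \<le> (C * l1norm u) * (C * l1norm v) * wgt n (int n - l)" .
  qed
  also have "\<dots> \<le> (C * l1norm u) * (C * l1norm v) * wsum n"
    unfolding infsum_cmult_right' using C1 M by (intro mult_left_mono wgt_reflect n) auto
  also have "\<dots> = C\<^sup>2 * wsum n * l1norm u * l1norm v" by (simp add: power2_eq_square mult_ac)
  finally show ?thesis .
qed

subsection \<open>Location of the eigenvalues\<close>

text \<open>The diagonal entry D of the system, real by \<open>hill_A_real\<close>. The next
  definition is its off-diagonal entry \<beta>.\<close>

definition shift :: "nat \<Rightarrow> nat \<Rightarrow> real \<Rightarrow> real" where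
  "shift n m \<mu> = \<mu> - (2 * pi * real n)\<^sup>2 - Re (hill_A q n m \<mu>)"

definition coupling :: "nat \<Rightarrow> nat \<Rightarrow> real \<Rightarrow> complex" where
  "coupling n m \<mu> = fourier q (2 * int n) + hill_B q n m \<mu>"

definition err :: "nat \<Rightarrow> nat \<Rightarrow> real" where
  "err n m = C ^ (m + 2) * wsum n ^ (m + 1)"

lemma err_nonneg: "0 \<le> err n m"
  unfolding err_def using C1 wsum_nonneg by simp

lemma sol_system:
  assumes \<mu>: "near n \<mu>" and u: "sol \<mu> u"
  shows "norm (of_real (shift n m \<mu>) * u (int n) - coupling n m \<mu> * u (- int n)) \<le> err n m * l1norm u"
    and "norm (of_real (shift n m \<mu>) * u (- int n) - cnj (coupling n m \<mu>) * u (int n)) \<le> err n m * l1norm u"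
proof -
  have A: "of_real (\<mu> - (2 * pi * real n)\<^sup>2) - hill_A q n m \<mu> = of_real (shift n m \<mu>)"
    using hill_A_real[of q n m \<mu>] by (simp add: shift_def of_real_Re)
  show "norm (of_real (shift n m \<mu>) * u (int n) - coupling n m \<mu> * u (- int n)) \<le> err n m * l1norm u"
    using iteration[OF \<mu> u, of m] unfolding A coupling_def err_def .
  have "norm (of_real (shift n m \<mu>) * cnj (u (- int n)) - coupling n m \<mu> * cnj (u (- (- int n)))) \<le> err n m * l1norm u"
    using iteration[OF \<mu> sol_cnj(1)[OF u], of m] unfolding A coupling_def err_def sol_cnj(2)[OF u] .
  also have "of_real (shift n m \<mu>) * cnj (u (- int n)) - coupling n m \<mu> * cnj (u (- (- int n))) =
      cnj (of_real (shift n m \<mu>) * u (- int n) - cnj (coupling n m \<mu>) * u (int n))" by simp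
  finally show "norm (of_real (shift n m \<mu>) * u (- int n) - cnj (coupling n m \<mu>) * u (int n)) \<le> err n m * l1norm u"
    by (simp only: complex_mod_cnj)
qed

theorem shift_coupling:
  assumes \<mu>: "near n \<mu>" and u: "sol \<mu> u" "0 < l1norm u" and small: "C * wsum n \<le> 1 / 2"
  shows "\<bar>\<bar>shift n m \<mu>\<bar> - norm (coupling n m \<mu>)\<bar> \<le> 4 * err n m"
  by (rule hermitian_two_by_two[OF sol_system[OF \<mu> u(1)] u(2) l1norm_le[OF \<mu> u(1) small]])

text \<open>Replaces the orthogonality argument for a double eigenvalue. With u_{-n} = 0 the first
  row reads |D| |u_n| \<le> 2 err |u_n|, and \<open>shift_coupling\<close> adds 4 to the 2.\<close>

lemma double_eigenvalue:
  assumes \<mu>: "near n \<mu>" and u: "sol \<mu> u" "0 < l1norm u" and small: "C * wsum n \<le> 1 / 2" and 0: "u (- int n) = 0"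
  shows "norm (coupling n m \<mu>) \<le> 6 * err n m"
proof -
  have "\<bar>shift n m \<mu>\<bar> * norm (u (int n)) \<le> err n m * l1norm u"
    using sol_system(1)[OF \<mu> u(1), of m] by (simp add: 0 norm_mult)
  also have "\<dots> \<le> err n m * (2 * norm (u (int n)))"
    using l1norm_le[OF \<mu> u(1) small] err_nonneg by (intro mult_left_mono) (auto simp: 0)
  finally have "\<bar>shift n m \<mu>\<bar> * norm (u (int n)) \<le> (2 * err n m) * norm (u (int n))" by (simp add: mult_ac)
  moreover have "0 < norm (u (int n))" using less_le_trans[OF u(2) l1norm_le[OF \<mu> u(1) small]] by (simp add: 0)
  ultimately have "\<bar>shift n m \<mu>\<bar> \<le> 2 * err n m" by (simp only: mult_le_cancel_right_pos)
  then show ?thesis using shift_coupling[OF \<mu> u small, of m] by linarith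
qed

text \<open>If both shifts had the same sign, their difference would be at most (\<nu> - \<mu>)/4 +
  8 err by \<open>shift_coupling\<close>, but it is at least 3/4 (\<nu> - \<mu>). Then \<nu> - \<mu>
  \<le> 16 err, and \<open>two_by_two_degenerate\<close> bounds |D| by 544 err. With the 4 of
  \<open>shift_coupling\<close> this contradicts the threshold 600. As D increases from \<mu> to
  \<nu>, the smaller eigenvalue has the negative sign.\<close>

theorem eigenvalue_signs:
  assumes \<mu>: "near n \<mu>" and \<nu>: "near n \<nu>" and u: "sol \<mu> u" "0 < l1norm u" and v: "sol \<nu> v" "0 < l1norm v"
    and less: "\<mu> < \<nu>" and small: "C\<^sup>2 * wsum n \<le> 1 / 16"
    and lip: "norm (hill_A q n m \<mu> - hill_A q n m \<nu>) \<le> 1 / 4 * \<bar>\<mu> - \<nu>\<bar>"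
      "norm (hill_B q n m \<mu> - hill_B q n m \<nu>) \<le> 1 / 4 * \<bar>\<mu> - \<nu>\<bar>"
    and big: "600 * err n m < norm (coupling n m \<mu>)" "600 * err n m < norm (coupling n m \<nu>)"
  shows "\<bar>shift n m \<mu> + norm (coupling n m \<mu>)\<bar> \<le> 4 * err n m"
    and "\<bar>shift n m \<nu> - norm (coupling n m \<nu>)\<bar> \<le> 4 * err n m"
proof -
  have "C * 1 \<le> C * C" using C1 by (intro mult_left_mono) auto
  then have "C * wsum n \<le> C\<^sup>2 * wsum n" using wsum_nonneg by (intro mult_right_mono) (auto simp: power2_eq_square)
  then have small': "C * wsum n \<le> 1 / 2" using small by linarith
  let ?D1 = "shift n m \<mu>" and ?D2 = "shift n m \<nu>" and ?b1 = "coupling n m \<mu>" and ?b2 = "coupling n m \<nu>"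
  let ?e = "err n m"
  have e: "0 \<le> ?e" by (rule err_nonneg)
  have 1: "\<bar>\<bar>?D1\<bar> - norm ?b1\<bar> \<le> 4 * ?e" by (rule shift_coupling[OF \<mu> u small'])
  have 2: "\<bar>\<bar>?D2\<bar> - norm ?b2\<bar> \<le> 4 * ?e" by (rule shift_coupling[OF \<nu> v small'])
  have b12: "norm (?b1 - ?b2) \<le> 1 / 4 * (\<nu> - \<mu>)"
    using lip(2) less by (simp add: coupling_def)
  have nb: "\<bar>norm ?b1 - norm ?b2\<bar> \<le> 1 / 4 * (\<nu> - \<mu>)"
    using norm_triangle_ineq3[of ?b1 ?b2] b12 by linarith
  have "\<bar>Re (hill_A q n m \<mu>) - Re (hill_A q n m \<nu>)\<bar> \<le> 1 / 4 * (\<nu> - \<mu>)"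
    using abs_Re_le_cmod[of "hill_A q n m \<mu> - hill_A q n m \<nu>"] lip(1) less by simp
  then have D12: "\<bar>(?D2 - ?D1) - (\<nu> - \<mu>)\<bar> \<le> 1 / 4 * (\<nu> - \<mu>)"
    unfolding shift_def by linarith
  have opp: "\<not> (0 \<le> ?D1 \<and> 0 \<le> ?D2)" "\<not> (?D1 \<le> 0 \<and> ?D2 \<le> 0)"
  proof -
    have False if same: "\<bar>?D2 - ?D1\<bar> = \<bar>\<bar>?D2\<bar> - \<bar>?D1\<bar>\<bar>"
    proof -
      have D: "\<bar>?D2 - ?D1\<bar> \<le> 1 / 4 * (\<nu> - \<mu>) + 8 * ?e" using same 1 2 nb by linarith
      from abs_le_D1[OF this] abs_le_D2[OF D12] have d: "\<nu> - \<mu> \<le> 16 * ?e"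
        by (simp add: field_simps)
      then have d': "1 / 4 * (\<nu> - \<mu>) \<le> 4 * ?e" by simp
      have orth: "norm (u (int n) * cnj (v (int n)) + u (- int n) * cnj (v (- int n))) \<le> l1norm u * l1norm v / 16"
      proof -
        have "norm (u (int n) * cnj (v (int n)) + u (- int n) * cnj (v (- int n))) \<le> (C\<^sup>2 * wsum n) * (l1norm u * l1norm v)"
          using sol_nearly_orthogonal[OF \<mu> \<nu> u(1) v(1)] less by (simp add: mult.assoc)
        also have "\<dots> \<le> (1 / 16) * (l1norm u * l1norm v)"
          using small u(2) v(2) by (intro mult_right_mono) auto
        finally show ?thesis by simp
      qed
      have s: "abs_summable u UNIV" "abs_summable v UNIV" using u(1) v(1) by (simp_all add: sol_def)
      \<comment> \<open>Here \<eta> = 16 err: the shifts differ by at most 12 err, the couplings by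
        at most 4 err.\<close>
      have "\<bar>?D1\<bar> \<le> 16 * (2 * ?e + 2 * (16 * ?e))"
        by (rule two_by_two_degenerate[OF sol_system(1)[OF \<mu> u(1)] sol_system(1)[OF \<nu> v(1)] _ _
              u(2) l1norm_le[OF \<mu> u(1) small'] l1norm_ge[OF s(1)]
              v(2) l1norm_le[OF \<nu> v(1) small'] l1norm_ge[OF s(2)] l1norm_ge[OF s(2)] orth])
          (use D d' e b12 in linarith)+
      then have "\<bar>?D1\<bar> \<le> 544 * ?e" by simp
      then show False using 1 big(1) e by linarith
    qed
    moreover have "\<bar>?D2 - ?D1\<bar> = \<bar>\<bar>?D2\<bar> - \<bar>?D1\<bar>\<bar>" if "0 \<le> ?D1 \<and> 0 \<le> ?D2 \<or> ?D1 \<le> 0 \<and> ?D2 \<le> 0"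
      using that by linarith
    ultimately show "\<not> (0 \<le> ?D1 \<and> 0 \<le> ?D2)" "\<not> (?D1 \<le> 0 \<and> ?D2 \<le> 0)" by blast+
  qed
  have "?D1 < 0 \<and> 0 < ?D2"
  proof (rule ccontr)
    assume "\<not> ?thesis"
    then have "?D1 > 0 \<and> ?D2 < 0" using opp by linarith
    moreover have "- (?D2 - ?D1) + (\<nu> - \<mu>) \<le> (\<nu> - \<mu>) / 4" using abs_le_D2[OF D12] by simp
    ultimately show False using less by (simp add: field_simps)
  qed
  then show "\<bar>?D1 + norm ?b1\<bar> \<le> 4 * ?e" "\<bar>?D2 - norm ?b2\<bar> \<le> 4 * ?e"
    using 1 2 by linarith+
qed

end

subsection \<open>The first two coefficients\<close>

text \<open>Up to the factor 4 pi^2 the inverse denominators at the centre \<mu> = (2 pi n)^2, by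
  \<open>freq_diff\<close>. Division by zero again encodes the excluded indices.\<close>

definition kap :: "nat \<Rightarrow> int \<Rightarrow> complex" where
  "kap n p = 1 / (of_int p * of_int (2 * int n - p))"

lemma kap_reflect: "kap n (2 * int n - p) = kap n p"
  by (simp add: kap_def mult.commute)

lemma kap_eq_0: "kap n 0 = 0" "kap n (2 * int n) = 0"
  by (simp_all add: kap_def)

lemma norm_kap: "norm (kap n p) = wgt n p"
  by (simp add: kap_def wgt_def norm_divide norm_mult del: of_int_diff)

text \<open>
  \<open>smoothing n f\<close> has the Fourier coefficients \<open>f\<^sub>p / (p (2n - p))\<close>; the partial fractions of this factor
  produce two primitives, which gives a bound \<open>O(1/n)\<close> without a logarithm.
\<close>

definition twist :: "nat \<Rightarrow> (real \<Rightarrow> complex) \<Rightarrow> real \<Rightarrow> complex" where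
  "twist n f x = anti (\<lambda>x. f x * expi (- (2 * int n)) x) x * expi (2 * int n) x"

definition smoothing :: "nat \<Rightarrow> (real \<Rightarrow> complex) \<Rightarrow> real \<Rightarrow> complex" where
  "smoothing n f x = (pi * \<i> / n) * ((anti f x - twist n f x) +
     (fcoeff (twist n f) 0 * expi 0 x - fcoeff (anti f) (2 * int n) * expi (2 * int n) x))"

lemma continuous_on_twist: "integrable M01 f \<Longrightarrow> continuous_on {0..1} (twist n f)"
  unfolding twist_def by (intro continuous_intros M01_integrable_mult)

lemma continuous_on_smoothing: "integrable M01 f \<Longrightarrow> continuous_on {0..1} (smoothing n f)"
  unfolding smoothing_def by (intro continuous_intros continuous_on_twist)

lemma fcoeff_twist:
  assumes f: "integrable M01 f"
  shows "fcoeff (twist n f) p = fcoeff f p / (2 * pi * \<i> * of_int (p - 2 * int n))"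
proof -
  have i: "integrable M01 (\<lambda>x. f x * expi (- (2 * int n)) x)"
    by (intro M01_integrable_mult f continuous_intros)
  show ?thesis
    unfolding twist_def fcoeff_mult_expi by (subst fcoeff_anti[OF i]) (auto simp: fcoeff_mult_expi)
qed

text \<open>1/(p (2n - p)) = (1/p + 1/(2n - p)) / (2n). \<open>anti\<close> contributes nothing at p
  = 0 and \<open>twist\<close> nothing at p = 2n; the two exponentials cancel the other contribution
  there.\<close>

lemma fcoeff_smoothing:
  assumes f: "integrable M01 f" and n: "n \<ge> 1"
  shows "fcoeff (smoothing n f) p = kap n p * fcoeff f p"
proof -
  define c d where "c = fcoeff (twist n f) 0" and "d = fcoeff (anti f) (2 * int n)"
  have i: "integrable M01 (anti f)" "integrable M01 (twist n f)"
    by (intro M01_integrable_continuous continuous_intros continuous_on_twist f)+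
  have e: "integrable M01 (\<lambda>x. c * expi 0 x)" "integrable M01 (\<lambda>x. d * expi (2 * int n) x)"
    by (intro M01_integrable_continuous continuous_intros)+
  have "fcoeff (smoothing n f) p = (pi * \<i> / n) * ((fcoeff (anti f) p - fcoeff (twist n f) p) +
      (c * fcoeff (expi 0) p - d * fcoeff (expi (2 * int n)) p))"
    unfolding smoothing_def c_def[symmetric] d_def[symmetric] fcoeff_cmult
      fcoeff_add[OF Bochner_Integration.integrable_diff[OF i] Bochner_Integration.integrable_diff[OF e]]
      fcoeff_diff[OF i] fcoeff_diff[OF e] ..
  also have "\<dots> = kap n p * fcoeff f p"
  proof -
    consider "p = 0" | "p = 2 * int n" | "p \<noteq> 0" "p \<noteq> 2 * int n" by blast
    then show ?thesis
    proof cases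
      case 1
      then show ?thesis using n by (simp add: fcoeff_expi c_def fcoeff_anti[OF f] kap_eq_0)
    next
      case 2
      then show ?thesis using n by (simp add: fcoeff_expi d_def fcoeff_twist[OF f] kap_eq_0)
    next
      case 3
      define a b where "a = (of_int p :: complex)" and "b = (of_int (2 * int n - p) :: complex)"
      have "2 * int n - p \<noteq> 0" using 3 by simp
      then have ab: "a \<noteq> 0" "b \<noteq> 0" "a + b = 2 * of_nat n"
        unfolding a_def b_def of_int_eq_0_iff using 3 by simp_all
      have "fcoeff (anti f) p - fcoeff (twist n f) p = fcoeff f p / (2 * pi * \<i> * a) - fcoeff f p / (2 * pi * \<i> * (- b))"
        unfolding fcoeff_twist[OF f] using 3 by (simp add: fcoeff_anti[OF f] a_def b_def)
      also have "\<dots> = fcoeff f p * ((a + b) / (2 * pi * \<i> * (a * b)))"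
        using ab(1,2) by (simp add: field_simps)
      also have "\<dots> = fcoeff f p * (of_nat n / (pi * \<i> * (a * b)))"
        unfolding ab(3) by simp
      finally have "(pi * \<i> / n) * (fcoeff (anti f) p - fcoeff (twist n f) p) = fcoeff f p / (a * b)"
        using n by simp
      then show ?thesis using 3 by (simp add: fcoeff_expi kap_def a_def b_def)
    qed
  qed
  finally show ?thesis .
qed

lemma fcoeff_smoothing_summable:
  assumes f: "integrable M01 f" and n: "n \<ge> 1"
  shows "abs_summable (fcoeff (smoothing n f)) UNIV"
proof (rule Infinite_Sum.abs_summable_on_comparison_test')
  show "(\<lambda>p. L1 f * wgt n p) summable_on UNIV"
    by (intro summable_on_cmult_right wgt_summable n)
  show "norm (fcoeff (smoothing n f) p) \<le> L1 f * wgt n p" for p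
    unfolding fcoeff_smoothing[OF f n] norm_mult norm_kap
    using mult_right_mono[OF norm_fcoeff_le[OF f, of p] wgt_nonneg[of n p]] by (simp only: mult.commute)
qed

text \<open>Here the logarithm is saved: the sup norm is bounded through the primitives instead of
  the sum of the coefficients. The four pieces give 4 + 4 + 1 + 1, the prefactor is pi/n <
  4/n.\<close>

lemma norm_smoothing_le:
  assumes f: "integrable M01 f" and n: "n \<ge> 1" and x: "x \<in> {0..1}"
  shows "norm (smoothing n f x) \<le> 40 * L1 f / n"
proof -
  let ?I = "LINT x|M01. norm (f x)"
  have I: "0 \<le> ?I" by (rule Bochner_Integration.integral_nonneg) simp
  have i: "integrable M01 (\<lambda>x. f x * expi (- (2 * int n)) x)"
    by (intro M01_integrable_mult f continuous_intros)
  have Ii: "(LINT x|M01. norm (f x * expi (- (2 * int n)) x)) = ?I" by (simp add: norm_mult)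
  have 1: "norm (anti f x) \<le> 4 * ?I" by (rule norm_anti_le[OF f x])
  have 2: "norm (twist n f x) \<le> 4 * ?I" unfolding twist_def using norm_anti_le[OF i x] Ii by (simp add: norm_mult)
  have le: "?I * (1 / max 1 \<bar>real_of_int k\<bar>) \<le> ?I" for k
    using mult_left_mono[OF inverse_max_le_1(1)[of "real_of_int k"] I] by simp
  have 3: "norm (fcoeff (twist n f) 0 * expi 0 x) \<le> ?I"
    unfolding twist_def fcoeff_mult_expi norm_mult norm_expi
    using norm_fcoeff_anti_le[OF i, of "0 - 2 * int n"] le[of "0 - 2 * int n"] by (simp only: Ii mult_1_right)
  have 4: "norm (fcoeff (anti f) (2 * int n) * expi (2 * int n) x) \<le> ?I"
    unfolding norm_mult norm_expi
    using norm_fcoeff_anti_le[OF f, of "2 * int n"] le[of "2 * int n"] by (simp only: mult_1_right)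
  have "norm ((anti f x - twist n f x) + (fcoeff (twist n f) 0 * expi 0 x - fcoeff (anti f) (2 * int n) * expi (2 * int n) x)) \<le> 10 * ?I"
    by (rule order_trans[OF norm_triangle_ineq])
      (use 1 2 3 4 norm_triangle_ineq4[of "anti f x" "twist n f x"]
        norm_triangle_ineq4[of "fcoeff (twist n f) 0 * expi 0 x" "fcoeff (anti f) (2 * int n) * expi (2 * int n) x"] in linarith)
  then have "norm (smoothing n f x) \<le> (pi / n) * (10 * ?I)"
    unfolding smoothing_def norm_mult[of "pi * \<i> / n"] by (intro mult_mono) (auto simp: norm_divide norm_mult)
  also have "\<dots> \<le> (4 / n) * (10 * ?I)"
    using pi_less_4 I by (intro mult_right_mono divide_right_mono) auto
  finally show ?thesis by simp
qed

text \<open>Both sides are continuous with the same coefficients, so uniqueness spares the linearity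
  of the single pieces.\<close>

lemma smoothing_diff:
  assumes f: "integrable M01 f" and g: "integrable M01 g" and n: "n \<ge> 1" and x: "x \<in> {0..1}"
  shows "smoothing n f x - smoothing n g x = smoothing n (\<lambda>x. f x - g x) x"
proof -
  have fg: "integrable M01 (\<lambda>x. f x - g x)" using f g by (rule Bochner_Integration.integrable_diff)
  note c = continuous_on_smoothing[OF f, of n] continuous_on_smoothing[OF g, of n] continuous_on_smoothing[OF fg, of n]
  note i = c[THEN M01_integrable_continuous]
  have "(smoothing n f x - smoothing n g x) - smoothing n (\<lambda>x. f x - g x) x = 0"
  proof (rule fcoeff_eq_0_imp[OF _ _ x])
    show "continuous_on {0..1} (\<lambda>x. (smoothing n f x - smoothing n g x) - smoothing n (\<lambda>x. f x - g x) x)"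
      by (intro continuous_intros c)
    show "fcoeff (\<lambda>x. (smoothing n f x - smoothing n g x) - smoothing n (\<lambda>x. f x - g x) x) k = 0" for k
      unfolding fcoeff_diff[OF Bochner_Integration.integrable_diff[OF i(1,2)] i(3)] fcoeff_diff[OF i(1,2)]
        fcoeff_smoothing[OF f n] fcoeff_smoothing[OF g n] fcoeff_smoothing[OF fg n] fcoeff_diff[OF f g]
      by (simp add: algebra_simps)
  qed
  then show ?thesis by simp
qed

lemma L1_triangle:
  assumes "integrable M01 (f :: real \<Rightarrow> complex)" "integrable M01 g"
  shows "(LINT x|M01. norm (f x + g x)) \<le> L1 f + L1 g"
proof -
  have "(LINT x|M01. norm (f x + g x)) \<le> (LINT x|M01. norm (f x) + norm (g x))"
    using assms by (intro integral_mono integrable_norm Bochner_Integration.integrable_add norm_triangle_ineq)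
  then show ?thesis using assms by simp
qed

lemma smoothing_product_diff:
  assumes F: "integrable M01 F" and F': "integrable M01 F'" and f: "integrable M01 f" and g: "integrable M01 g" and n: "n \<ge> 1"
  shows "(LINT x|M01. norm (F x * smoothing n f x - F' x * smoothing n g x)) \<le>
    40 * L1 f / n * (LINT x|M01. norm (F x - F' x)) +
    40 * (LINT x|M01. norm (f x - g x)) / n * L1 F'"
proof -
  have d: "integrable M01 (\<lambda>x. F x - F' x)" "integrable M01 (\<lambda>x. f x - g x)" using F F' f g by auto
  have "(LINT x|M01. norm (F x * smoothing n f x - F' x * smoothing n g x)) =
      (LINT x|M01. norm ((F x - F' x) * smoothing n f x + F' x * smoothing n (\<lambda>x. f x - g x) x))"
    by (rule Bochner_Integration.integral_cong) (auto simp: smoothing_diff[OF f g n, symmetric] algebra_simps)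
  also have "\<dots> \<le> (LINT x|M01. norm ((F x - F' x) * smoothing n f x)) + (LINT x|M01. norm (F' x * smoothing n (\<lambda>x. f x - g x) x))"
    by (intro L1_triangle M01_integrable_mult continuous_on_smoothing d F' f)
  also have "\<dots> \<le> 40 * L1 f / n * (LINT x|M01. norm (F x - F' x)) +
    40 * (LINT x|M01. norm (f x - g x)) / n * L1 F'"
    by (intro add_mono L1_mult_le continuous_on_smoothing norm_smoothing_le d F' f n)
  finally show ?thesis .
qed

text \<open>Functions whose coefficients at 2n are, up to powers of 4 pi^2, the values of b_1
  (\<open>prod1\<close>) and b_2 (\<open>prod2\<close>) at (2 pi n)^2; see
  \<open>hill_coeff_eq_fcoeff\<close>.\<close>

definition prod1 :: "nat \<Rightarrow> (real \<Rightarrow> complex) \<Rightarrow> real \<Rightarrow> complex" where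
  "prod1 n f x = f x * smoothing n f x"

definition prod2 :: "nat \<Rightarrow> (real \<Rightarrow> complex) \<Rightarrow> real \<Rightarrow> complex" where
  "prod2 n f x = prod1 n f x * smoothing n f x"

lemma prod_integrable:
  assumes "integrable M01 f"
  shows "integrable M01 (prod1 n f)" and "integrable M01 (prod2 n f)"
proof -
  show 1: "integrable M01 (prod1 n f)" unfolding prod1_def by (intro M01_integrable_mult continuous_on_smoothing assms)
  show "integrable M01 (prod2 n f)" unfolding prod2_def by (intro M01_integrable_mult continuous_on_smoothing assms 1)
qed

lemma fcoeff_prod:
  assumes f: "integrable M01 f" and n: "n \<ge> 1"
  shows "fcoeff (prod1 n f) k = (\<Sum>\<^sub>\<infinity>i. fcoeff f i * (kap n (k - i) * fcoeff f (k - i)))"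
    and "fcoeff (prod2 n f) k = (\<Sum>\<^sub>\<infinity>i. fcoeff (prod1 n f) i * (kap n (k - i) * fcoeff f (k - i)))"
  unfolding prod1_def[abs_def] prod2_def[abs_def] fcoeff_smoothing[OF f n, symmetric]
  using prod_integrable(1)[OF f, of n, unfolded prod1_def[abs_def]]
  by (intro fcoeff_mult continuous_on_smoothing fcoeff_smoothing_summable f n; assumption)+

text \<open>Smoothing multiplies coefficients and does not enlarge the spectrum, so the bounds 2N
  and 3N do not depend on \<open>n\<close>, and the frequency 2n eventually lies beyond
  them.\<close>

lemma fcoeff_prod_trig:
  assumes f: "trig f" and N: "\<And>k. \<bar>k\<bar> > N \<Longrightarrow> fcoeff f k = 0" and n: "n \<ge> 1"
  shows "\<bar>k\<bar> > 2 * N \<Longrightarrow> fcoeff (prod1 n f) k = 0" and "\<bar>k\<bar> > 3 * N \<Longrightarrow> fcoeff (prod2 n f) k = 0"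
proof -
  note fi = trig_integrable[OF f]
  show 1: "fcoeff (prod1 n f) k = 0" if k: "\<bar>k\<bar> > 2 * N" for k
    unfolding fcoeff_prod[OF fi n]
  proof (rule infsum_0)
    fix i
    have "\<bar>i\<bar> > N \<or> \<bar>k - i\<bar> > N" using k by linarith
    then show "fcoeff f i * (kap n (k - i) * fcoeff f (k - i)) = 0" using N by auto
  qed
  show "fcoeff (prod2 n f) k = 0" if k: "\<bar>k\<bar> > 3 * N"
    unfolding fcoeff_prod(2)[OF fi n]
  proof (rule infsum_0)
    fix i
    have "\<bar>i\<bar> > 2 * N \<or> \<bar>k - i\<bar> > N" using k by linarith
    then show "fcoeff (prod1 n f) i * (kap n (k - i) * fcoeff f (k - i)) = 0" using N 1 by auto
  qed
qed

lemma L1_norm_nonneg: "0 \<le> (LINT x|M01. norm (f x :: complex))"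
  by (rule Bochner_Integration.integral_nonneg) simp

theorem prod_coefficients_small:
  assumes f: "integrable M01 f" and e: "e > 0"
  shows "\<forall>\<^sub>F n in sequentially. norm (fcoeff (prod1 n f) (2 * int n)) \<le> e / real n"
    and "\<forall>\<^sub>F n in sequentially. norm (fcoeff (prod2 n f) (2 * int n)) \<le> e / (real n)\<^sup>2"
proof -
  let ?I = "LINT x|M01. norm (f x)"
  define K where "K = 2 * ?I + 1"
  have I: "0 \<le> ?I" by (rule L1_norm_nonneg)
  have K: "K \<ge> 1" using I by (simp add: K_def)
  \<comment> \<open>4800 = 40 * 80 + 40 * 40 is the constant in \<open>d2\<close>. As K \<ge> 1, the
    same \<eta> also covers the weaker need of \<open>d1\<close>.\<close>
  define \<eta> where "\<eta> = min 1 (e / (4800 * K\<^sup>2))"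
  have \<eta>: "0 < \<eta>" "\<eta> \<le> 1" "\<eta> * (4800 * K\<^sup>2) \<le> e"
    using e K by (auto simp: \<eta>_def min_def field_simps)
  obtain T where T: "trig T" and TI: "(LINT x|M01. norm (f x - T x)) < \<eta>"
    using trig_dense[OF f] \<eta>(1) by blast
  note Ti = trig_integrable[OF T]
  have d: "integrable M01 (\<lambda>x. f x - T x)" using f Ti by auto
  have TK: "?I \<le> K" "L1 T \<le> K"
  proof -
    have "L1 T = (LINT x|M01. norm (f x + (-1) * (f x - T x)))" by simp
    also have "\<dots> \<le> ?I + (LINT x|M01. norm ((-1) * (f x - T x)))"
      by (intro L1_triangle f integrable_mult_right d)
    also have "(LINT x|M01. norm ((-1) * (f x - T x))) = (LINT x|M01. norm (f x - T x))"
      by (simp only: norm_mult norm_minus_cancel norm_one mult_1)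
    finally show "L1 T \<le> K" unfolding K_def using TI \<eta>(2) I by linarith
    show "?I \<le> K" unfolding K_def using I by linarith
  qed
  have d1: "(LINT x|M01. norm (prod1 n f x - prod1 n T x)) \<le> 80 * \<eta> * K / n" if n: "n \<ge> 1" for n
  proof -
    have "(LINT x|M01. norm (prod1 n f x - prod1 n T x)) \<le>
        40 * ?I / n * (LINT x|M01. norm (f x - T x)) + 40 * (LINT x|M01. norm (f x - T x)) / n * L1 T"
      unfolding prod1_def by (rule smoothing_product_diff[OF f Ti f Ti n])
    also have "\<dots> \<le> 40 * K / n * \<eta> + 40 * \<eta> / n * K"
      using TI TK I \<eta> K L1_norm_nonneg by (intro add_mono mult_mono divide_right_mono) auto
    finally show ?thesis by (simp add: mult_ac)
  qed
  have nT: "(LINT x|M01. norm (prod1 n T x)) \<le> 40 * K\<^sup>2 / n" if n: "n \<ge> 1" for n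
  proof -
    have "(LINT x|M01. norm (prod1 n T x)) \<le> (40 * L1 T / n) * L1 T"
      unfolding prod1_def by (intro L1_mult_le Ti continuous_on_smoothing norm_smoothing_le n)
    also have "\<dots> \<le> (40 * K / n) * K"
      using TK K L1_norm_nonneg by (intro mult_mono divide_right_mono) auto
    finally show ?thesis by (simp add: power2_eq_square)
  qed
  have d2: "(LINT x|M01. norm (prod2 n f x - prod2 n T x)) \<le> 4800 * \<eta> * K\<^sup>2 / (real n)\<^sup>2" if n: "n \<ge> 1" for n
  proof -
    have "(LINT x|M01. norm (prod2 n f x - prod2 n T x)) \<le>
        40 * ?I / n * (LINT x|M01. norm (prod1 n f x - prod1 n T x)) +
        40 * (LINT x|M01. norm (f x - T x)) / n * (LINT x|M01. norm (prod1 n T x))"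
      unfolding prod2_def by (rule smoothing_product_diff[OF prod_integrable(1)[OF f] prod_integrable(1)[OF Ti] f Ti n])
    also have "\<dots> \<le> 40 * K / n * (80 * \<eta> * K / n) + 40 * \<eta> / n * (40 * K\<^sup>2 / n)"
      using TI TK I \<eta> K d1[OF n] nT[OF n] L1_norm_nonneg by (intro add_mono mult_mono divide_right_mono) auto
    finally show ?thesis by (simp add: power2_eq_square mult_ac)
  qed
  obtain N where N: "\<And>k. \<bar>k\<bar> > N \<Longrightarrow> fcoeff T k = 0" using trig_coeffs_finite[OF T] by blast
  have ev: "\<forall>\<^sub>F n in sequentially. n \<ge> 1 \<and> 2 * int n > 3 * \<bar>N\<bar>"
    unfolding eventually_sequentially
    by (rule exI[of _ "nat (3 * \<bar>N\<bar>) + 1"]) auto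
  have Na: "\<And>k. \<bar>k\<bar> > \<bar>N\<bar> \<Longrightarrow> fcoeff T k = 0" using N by (smt (verit))
  have KK: "K \<le> K\<^sup>2" using K by (simp add: power2_eq_square)
  show "\<forall>\<^sub>F n in sequentially. norm (fcoeff (prod1 n f) (2 * int n)) \<le> e / real n"
    using ev
  proof eventually_elim
    case (elim n)
    then have n: "n \<ge> 1" by simp
    have "fcoeff (prod1 n T) (2 * int n) = 0" using elim by (intro fcoeff_prod_trig(1)[OF T Na n]) auto
    then have "fcoeff (prod1 n f) (2 * int n) = fcoeff (\<lambda>x. prod1 n f x - prod1 n T x) (2 * int n)"
      by (simp add: fcoeff_diff prod_integrable f Ti)
    also have "norm \<dots> \<le> (LINT x|M01. norm (prod1 n f x - prod1 n T x))"
      by (intro norm_fcoeff_le Bochner_Integration.integrable_diff prod_integrable f Ti)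
    also have "\<dots> \<le> 80 * \<eta> * K / n" by (rule d1[OF n])
    also have "\<dots> \<le> (\<eta> * (4800 * K\<^sup>2)) / n"
      using \<eta> K KK by (intro divide_right_mono) (auto intro!: mult_mono)
    also have "\<dots> \<le> e / n" by (intro divide_right_mono \<eta>(3)) auto
    finally show ?case .
  qed
  show "\<forall>\<^sub>F n in sequentially. norm (fcoeff (prod2 n f) (2 * int n)) \<le> e / (real n)\<^sup>2"
    using ev
  proof eventually_elim
    case (elim n)
    then have n: "n \<ge> 1" by simp
    have "fcoeff (prod2 n T) (2 * int n) = 0" using elim by (intro fcoeff_prod_trig(2)[OF T Na n]) auto
    then have "fcoeff (prod2 n f) (2 * int n) = fcoeff (\<lambda>x. prod2 n f x - prod2 n T x) (2 * int n)"
      by (simp add: fcoeff_diff prod_integrable f Ti)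
    also have "norm \<dots> \<le> (LINT x|M01. norm (prod2 n f x - prod2 n T x))"
      by (intro norm_fcoeff_le Bochner_Integration.integrable_diff prod_integrable f Ti)
    also have "\<dots> \<le> (\<eta> * (4800 * K\<^sup>2)) / (real n)\<^sup>2" using d2[OF n] by (simp add: mult_ac)
    also have "\<dots> \<le> e / (real n)\<^sup>2" by (intro divide_right_mono \<eta>(3)) auto
    finally show ?case .
  qed
qed

section \<open>The coefficients b_1 and b_2 at the centre as Fourier coefficients\<close>

lemma hill_term_snoc_centre:
  assumes "length ns = k"
  shows "hill_term q n (Suc k) ((2 * pi * real n)\<^sup>2) (ns @ [i]) =
    hill_term q n k ((2 * pi * real n)\<^sup>2) ns * (fourier q i * kap n (sum_list ns + i) / (4 * pi\<^sup>2))"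
  unfolding hill_term_def hill_denom_snoc[OF assms] freq_diff kap_def
  by (simp add: mult_ac)

lemma hill_term_Nil: "hill_term q n 0 \<mu> [] = 1"
  by (simp add: hill_term_def hill_denom_def)

lemma hill_indices_1: "hill_indices n 1 = (\<lambda>p. [p]) ` {p. p \<noteq> 0 \<and> p \<noteq> 2 * int n}"
proof -
  have "Sigma {[]} (next_indices n) = Pair [] ` {p. p \<noteq> 0 \<and> p \<noteq> 2 * int n}"
    by (auto simp: next_indices_def)
  then show ?thesis
    unfolding One_nat_def hill_indices_Suc hill_indices_0 by (simp add: image_image)
qed

lemma hill_coeff_1_centre:
  fixes q n
  defines "\<mu> \<equiv> (2 * pi * real n)\<^sup>2"
  shows "hill_coeff q n 1 (2 * int n) \<mu> = (\<Sum>\<^sub>\<infinity>p. fourier q p * (kap n p * fourier q (2 * int n - p))) / (4 * pi\<^sup>2)"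
proof -
  let ?X = "{p. p \<noteq> 0 \<and> p \<noteq> 2 * int n}"
  have "hill_coeff q n 1 (2 * int n) \<mu> = (\<Sum>\<^sub>\<infinity>p\<in>?X. hill_term q n 1 \<mu> [p] * fourier q (2 * int n - p))"
    unfolding hill_coeff_def hill_indices_1 by (subst infsum_reindex) (auto simp: inj_on_def o_def)
  also have "\<dots> = (\<Sum>\<^sub>\<infinity>p\<in>?X. fourier q p * (kap n p * fourier q (2 * int n - p)) / (4 * pi\<^sup>2))"
    by (rule infsum_cong)
      (use hill_term_snoc_centre[of "[]" 0 q n, folded \<mu>_def] in \<open>simp add: hill_term_Nil mult_ac\<close>)
  also have "\<dots> = (\<Sum>\<^sub>\<infinity>p. fourier q p * (kap n p * fourier q (2 * int n - p)) / (4 * pi\<^sup>2))"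
    by (rule infsum_cong_neutral) (auto simp: kap_eq_0)
  finally show ?thesis unfolding divide_inverse infsum_cmult_left' .
qed

context bounded_coeffs
begin

lemma hill_coeff_2_centre:
  fixes n
  assumes n: "n \<ge> 1"
  defines "\<mu> \<equiv> (2 * pi * real n)\<^sup>2"
  shows "hill_coeff q n 2 (2 * int n) \<mu> =
    (\<Sum>\<^sub>\<infinity>p. fourier q p * (kap n p * (\<Sum>\<^sub>\<infinity>i. fourier q i * (kap n (p + i) * fourier q (2 * int n - p - i))))) / (4 * pi\<^sup>2)\<^sup>2"
proof -
  have \<mu>: "near n \<mu>" using n by (simp add: near_def \<mu>_def)
  let ?X = "{p. p \<noteq> 0 \<and> p \<noteq> 2 * int n}"
  have "hill_coeff q n 2 (2 * int n) \<mu> = (\<Sum>\<^sub>\<infinity>ns\<in>hill_indices n 1. \<Sum>\<^sub>\<infinity>i\<in>next_indices n ns.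
      hill_term q n 2 \<mu> (ns @ [i]) * fourier q (2 * int n - sum_list (ns @ [i])))"
    unfolding hill_coeff_def using infsum_hill_indices_Suc[OF hill_coeff_summable[OF \<mu>, of "Suc 1" "2 * int n"]]
    by (simp add: numeral_2_eq_2)
  also have "\<dots> = (\<Sum>\<^sub>\<infinity>p\<in>?X. \<Sum>\<^sub>\<infinity>i\<in>next_indices n [p]. hill_term q n 2 \<mu> ([p] @ [i]) * fourier q (2 * int n - sum_list ([p] @ [i])))"
    unfolding hill_indices_1 by (subst infsum_reindex) (auto simp: inj_on_def o_def)
  also have "\<dots> = (\<Sum>\<^sub>\<infinity>p\<in>?X. fourier q p * (kap n p * (\<Sum>\<^sub>\<infinity>i. fourier q i * (kap n (p + i) * fourier q (2 * int n - p - i)))) / (4 * pi\<^sup>2)\<^sup>2)"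
  proof (rule infsum_cong)
    fix p
    have "(\<Sum>\<^sub>\<infinity>i\<in>next_indices n [p]. hill_term q n 2 \<mu> ([p] @ [i]) * fourier q (2 * int n - sum_list ([p] @ [i]))) =
      (\<Sum>\<^sub>\<infinity>i. (fourier q p * kap n p / (4 * pi\<^sup>2)\<^sup>2) * (fourier q i * (kap n (p + i) * fourier q (2 * int n - p - i))))"
    proof (rule infsum_cong_neutral)
      fix i assume "i \<in> UNIV - next_indices n [p]"
      then have "i = 0 \<or> p + i = 0 \<or> p + i = 2 * int n" by (auto simp: next_indices_def)
      then have "fourier q i = 0 \<or> kap n (p + i) = 0" using mean0 kap_eq_0[of n] by metis
      then show "(fourier q p * kap n p / (4 * pi\<^sup>2)\<^sup>2) * (fourier q i * (kap n (p + i) * fourier q (2 * int n - p - i))) = 0"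
        by auto
    next
      fix i
      have "hill_term q n 2 \<mu> ([p] @ [i]) = fourier q p * kap n p / (4 * pi\<^sup>2) * (fourier q i * kap n (p + i) / (4 * pi\<^sup>2))"
        using hill_term_snoc_centre[of "[]" 0 q n p, folded \<mu>_def] hill_term_snoc_centre[of "[p]" 1 q n i, folded \<mu>_def]
        by (simp add: hill_term_Nil numeral_2_eq_2)
      then show "hill_term q n 2 \<mu> ([p] @ [i]) * fourier q (2 * int n - sum_list ([p] @ [i])) =
          (fourier q p * kap n p / (4 * pi\<^sup>2)\<^sup>2) * (fourier q i * (kap n (p + i) * fourier q (2 * int n - p - i)))"
        by (simp add: power2_eq_square[of "4 * complex_of_real (pi\<^sup>2)"] diff_diff_eq mult_ac)
    qed auto
    then show "(\<Sum>\<^sub>\<infinity>i\<in>next_indices n [p]. hill_term q n 2 \<mu> ([p] @ [i]) * fourier q (2 * int n - sum_list ([p] @ [i]))) =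
        fourier q p * (kap n p * (\<Sum>\<^sub>\<infinity>i. fourier q i * (kap n (p + i) * fourier q (2 * int n - p - i)))) / (4 * pi\<^sup>2)\<^sup>2"
      unfolding infsum_cmult_right' by (simp add: mult_ac)
  qed
  also have "\<dots> = (\<Sum>\<^sub>\<infinity>p. fourier q p * (kap n p * (\<Sum>\<^sub>\<infinity>i. fourier q i * (kap n (p + i) * fourier q (2 * int n - p - i)))) / (4 * pi\<^sup>2)\<^sup>2)"
    by (rule infsum_cong_neutral) (auto simp: kap_eq_0)
  finally show ?thesis unfolding divide_inverse infsum_cmult_left' .
qed

end

text \<open>\<open>kap\<close> is symmetric under p -> 2n - p and may be attached to either factor
  of a convolution, which matches the sums for b_1 and b_2 with those of
  \<open>fcoeff_prod\<close>.\<close>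

lemma hill_coeff_eq_fcoeff:
  assumes q: "set_integrable lebesgue {0..1} q" and bc: "bounded_coeffs q C" and n: "n \<ge> 1"
  defines "f \<equiv> \<lambda>x. complex_of_real (q x)"
  shows "hill_coeff q n 1 (2 * int n) ((2 * pi * real n)\<^sup>2) = fcoeff (prod1 n f) (2 * int n) / (4 * pi\<^sup>2)"
    and "hill_coeff q n 2 (2 * int n) ((2 * pi * real n)\<^sup>2) = fcoeff (prod2 n f) (2 * int n) / (4 * pi\<^sup>2)\<^sup>2"
proof -
  have f: "integrable M01 f" unfolding f_def by (rule integrable_of_real_M01[OF q])
  have qf: "fourier q = fcoeff f" by (rule ext) (simp add: fourier_eq_fcoeff f_def)
  have kr: "kap n (2 * int n - p - i) = kap n (p + i)" for p i
    using kap_reflect[of n "p + i"] by (simp add: diff_diff_eq)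
  show "hill_coeff q n 1 (2 * int n) ((2 * pi * real n)\<^sup>2) = fcoeff (prod1 n f) (2 * int n) / (4 * pi\<^sup>2)"
    unfolding hill_coeff_1_centre qf fcoeff_prod[OF f n] kap_reflect ..
  have inner: "(\<Sum>\<^sub>\<infinity>i. fcoeff f i * (kap n (p + i) * fcoeff f (2 * int n - p - i))) = fcoeff (prod1 n f) (2 * int n - p)" for p
    unfolding fcoeff_prod(1)[OF f n] kr ..
  have "(\<Sum>\<^sub>\<infinity>p. fcoeff f p * (kap n p * fcoeff (prod1 n f) (2 * int n - p))) = fcoeff (prod2 n f) (2 * int n)"
    unfolding fcoeff_prod(2)[OF f n]
    using abs_summable_reflect(2)[of "\<lambda>p. fcoeff f p * (kap n p * fcoeff (prod1 n f) (2 * int n - p))" "2 * int n"]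
    by (simp add: mult_ac)
  then show "hill_coeff q n 2 (2 * int n) ((2 * pi * real n)\<^sup>2) = fcoeff (prod2 n f) (2 * int n) / (4 * pi\<^sup>2)\<^sup>2"
    using bounded_coeffs.hill_coeff_2_centre[OF bc n] unfolding qf inner by simp
qed

lemma of_real_primitive:
  assumes q: "set_integrable lebesgue {0..1} q" and x: "x \<in> {0..1}"
  shows "complex_of_real (primitive q x) = prim (\<lambda>x. of_real (q x)) x"
  unfolding primitive_def prim_eq_set_integral[OF x] set_lebesgue_integral_def
  by (subst integral_complex_of_real[symmetric]) (simp add: scaleR_conv_of_real)

text \<open>Since q has mean zero, \<open>anti f\<close> is Q - Q_0, with coefficients q_k / (2 pi i
  k). The product of two such factors is -1/(4 pi^2) times the kernel \<open>kap\<close>, so b_1 is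
  minus the coefficient of (Q - Q_0)^2. The constant Q_0^2 does not contribute at 2n \<noteq>
  0.\<close>

theorem hill_coeff_1_formula:
  assumes q: "set_integrable lebesgue {0..1} q" and q0: "fourier q 0 = 0" and n: "n \<ge> 1"
  shows "hill_coeff q n 1 (2 * int n) ((2 * pi * real n)\<^sup>2) =
    - fourier (primitive_sq q) (2 * int n) + 2 * fourier (primitive q) 0 * fourier (primitive q) (2 * int n)"
proof -
  define f where "f = (\<lambda>x. complex_of_real (q x))"
  have f: "integrable M01 f" unfolding f_def by (rule integrable_of_real_M01[OF q])
  have qf: "fourier q = fcoeff f" by (rule ext) (simp add: fourier_eq_fcoeff f_def)
  have f0: "fcoeff f 0 = 0" using q0 by (simp add: qf)
  define Q0 where "Q0 = fcoeff (prim f) 0"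
  have "fcoeff (anti0 f) 0 = Q0" unfolding Q0_def by (rule fcoeff_cong) (simp add: anti0_def f0)
  then have anti: "anti f x = prim f x - Q0" for x by (simp add: anti_def anti0_def f0)
  have Pc: "continuous_on {0..1} (prim f)" by (intro continuous_intros f)
  have P: "fourier (primitive q) k = fcoeff (prim f) k" for k
    unfolding fourier_eq_fcoeff f_def by (rule fcoeff_cong) (rule of_real_primitive[OF q])
  have P2: "fourier (primitive_sq q) k = fcoeff (\<lambda>x. prim f x * prim f x) k" for k
    unfolding fourier_eq_fcoeff
    by (rule fcoeff_cong) (simp add: primitive_sq_def of_real_primitive[OF q] f_def power2_eq_square)
  have "fcoeff (\<lambda>x. anti f x * anti f x) (2 * int n) = (\<Sum>\<^sub>\<infinity>k. fcoeff (anti f) k * fcoeff (anti f) (2 * int n - k))"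
    by (rule fcoeff_anti_mult[OF f _ norm_fcoeff_anti_le[OF f]]) (intro continuous_intros f)
  also have "\<dots> = (\<Sum>\<^sub>\<infinity>p. (- 1 / (4 * pi\<^sup>2)) * (fourier q p * (kap n p * fourier q (2 * int n - p))))"
  proof (rule infsum_cong)
    fix k
    show "fcoeff (anti f) k * fcoeff (anti f) (2 * int n - k) = (- 1 / (4 * pi\<^sup>2)) * (fourier q k * (kap n k * fourier q (2 * int n - k)))"
    proof (cases "k = 0 \<or> k = 2 * int n")
      case True
      then show ?thesis by (auto simp: fcoeff_anti[OF f] kap_eq_0)
    next
      case False
      define b where "b = 2 * int n - k"
      have "b \<noteq> 0" using False by (simp add: b_def)
      have "fcoeff (anti f) k * fcoeff (anti f) b = (fcoeff f k * fcoeff f b) / ((2 * pi * \<i> * k) * (2 * pi * \<i> * b))"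
        using False \<open>b \<noteq> 0\<close> by (simp add: fcoeff_anti[OF f])
      also have "(2 * pi * \<i> * k) * (2 * pi * \<i> * b) = - (4 * pi\<^sup>2) * (of_int k * of_int b)"
        by (simp add: power2_eq_square algebra_simps)
      finally show ?thesis unfolding qf kap_def b_def[symmetric] by simp
    qed
  qed
  also have "\<dots> = - hill_coeff q n 1 (2 * int n) ((2 * pi * real n)\<^sup>2)"
    unfolding infsum_cmult_right' hill_coeff_1_centre by simp
  finally have "hill_coeff q n 1 (2 * int n) ((2 * pi * real n)\<^sup>2) = - fcoeff (\<lambda>x. anti f x * anti f x) (2 * int n)"
    by simp
  also have "fcoeff (\<lambda>x. anti f x * anti f x) (2 * int n) = fcoeff (\<lambda>x. (prim f x * prim f x - (2 * Q0) * prim f x) + Q0 * Q0) (2 * int n)"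
    by (rule fcoeff_cong) (simp add: anti algebra_simps)
  also have "\<dots> = fcoeff (\<lambda>x. prim f x * prim f x) (2 * int n) - (2 * Q0) * fcoeff (prim f) (2 * int n)"
  proof -
    have i: "integrable M01 (\<lambda>x. prim f x * prim f x)" "integrable M01 (\<lambda>x. (2 * Q0) * prim f x)" "integrable M01 (\<lambda>x. Q0 * Q0)"
      by (intro M01_integrable_continuous continuous_intros f)+
    show ?thesis
      unfolding fcoeff_add[OF Bochner_Integration.integrable_diff[OF i(1,2)] i(3)] fcoeff_diff[OF i(1,2)] fcoeff_cmult fcoeff_const
      using n by simp
  qed
  finally show ?thesis by (simp add: P P2 Q0_def)
qed

subsection \<open>Eigenfunctions for the given eigenvalues\<close>

interpretation fun_vs: vector_space "\<lambda>(c::complex) (y::real \<Rightarrow> complex) x. c * y x"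
  by unfold_locales (auto simp: algebra_simps)

context bounded_coeffs
begin

lemma eigenfunction_sol:
  assumes q: "set_integrable lebesgue {0..1} q" and y: "y \<in> hill_eigenspace q \<mu>"
  shows "continuous_on {0..1} y" and "sol \<mu> (fcoeff y)"
  using hill_op_eigenfunction[OF q] y unfolding hill_eigenspace_def sol_def by blast+

lemma l1norm_pos:
  assumes u: "sol \<mu> (fcoeff y)" and y: "continuous_on {0..1} y" and x: "x \<in> {0..1}" "y x \<noteq> 0"
  shows "0 < l1norm (fcoeff y)"
proof -
  obtain k where "fcoeff y k \<noteq> 0" using fcoeff_eq_0_imp[OF y _ x(1)] x(2) by blast
  then have "0 < norm (fcoeff y k)" by simp
  also have "\<dots> \<le> l1norm (fcoeff y)" using u by (intro l1norm_ge) (simp add: sol_def)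
  finally show ?thesis .
qed

lemma eigenspace_nonzero:
  assumes "y \<in> hill_eigenspace q \<mu>" "y \<noteq> (\<lambda>x. 0)"
  shows "\<exists>x\<in>{0..1}. y x \<noteq> 0"
proof (rule ccontr)
  assume "\<not> ?thesis"
  then have "y x = 0" for x using assms(1) by (cases "x \<in> {0..1}") (auto simp: hill_eigenspace_def)
  then show False using assms(2) by auto
qed

lemma simple_eigenvalue_sol:
  assumes q: "set_integrable lebesgue {0..1} q" and mult: "hill_mult q \<mu> \<ge> 1"
  shows "\<exists>u. sol \<mu> u \<and> 0 < l1norm u"
proof -
  have "\<not> hill_eigenspace q \<mu> \<subseteq> fun_vs.span {}"
    using fun_vs.dim_le_card[of "hill_eigenspace q \<mu>" "{}"] mult by (auto simp: hill_mult_def)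
  then obtain y where y: "y \<in> hill_eigenspace q \<mu>" "y \<noteq> (\<lambda>x. 0)"
    by (auto simp: zero_fun_def)
  then show ?thesis
    using eigenspace_nonzero[OF y] eigenfunction_sol[OF q y(1)] l1norm_pos by blast
qed

text \<open>One linear condition leaves a nonzero vector in a space of dimension at least
  two.\<close>

lemma double_eigenvalue_sol:
  assumes q: "set_integrable lebesgue {0..1} q" and mult: "hill_mult q \<mu> \<ge> 2"
  shows "\<exists>u. sol \<mu> u \<and> 0 < l1norm u \<and> u k = 0"
proof -
  have "\<not> hill_eigenspace q \<mu> \<subseteq> fun_vs.span {}"
    using fun_vs.dim_le_card[of "hill_eigenspace q \<mu>" "{}"] mult by (auto simp: hill_mult_def)
  then obtain y where y: "y \<in> hill_eigenspace q \<mu>" "y \<noteq> (\<lambda>x. 0)"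
    by (auto simp: zero_fun_def)
  have "\<not> hill_eigenspace q \<mu> \<subseteq> fun_vs.span {y}"
    using fun_vs.dim_le_card[of "hill_eigenspace q \<mu>" "{y}"] mult by (auto simp: hill_mult_def)
  then obtain z where z: "z \<in> hill_eigenspace q \<mu>" "z \<notin> fun_vs.span {y}" by auto
  note Y = eigenfunction_sol[OF q y(1)] and Z = eigenfunction_sol[OF q z(1)]
  show ?thesis
  proof (cases "fcoeff y k = 0")
    case True
    then show ?thesis using eigenspace_nonzero[OF y] Y l1norm_pos by blast
  next
    case False
    \<comment> \<open>The combination cancels the k-th coefficient. As b \<noteq> 0, its vanishing
      would put z into the span of y.\<close>
    define a b where "a = fcoeff z k" and "b = - fcoeff y k"
    define w where "w = (\<lambda>x. a * y x + b * z x)"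
    have c: "continuous_on {0..1} w" unfolding w_def by (intro continuous_intros Y Z)
    have i: "integrable M01 y" "integrable M01 z" by (intro M01_integrable_continuous Y Z)+
    have W: "fcoeff w = (\<lambda>l. a * fcoeff y l + b * fcoeff z l)"
      unfolding w_def by (rule ext) (simp add: fcoeff_add fcoeff_cmult i)
    have s: "sol \<mu> (fcoeff w)" unfolding W by (rule sol_lincomb[OF Y(2) Z(2)])
    have "\<exists>x\<in>{0..1}. w x \<noteq> 0"
    proof (rule ccontr)
      assume "\<not> ?thesis"
      moreover have "w x = 0" if "x \<notin> {0..1}" for x
        using y(1) z(1) that by (auto simp: w_def hill_eigenspace_def)
      ultimately have "w x = 0" for x by (cases "x \<in> {0..1}") auto
      then have "z x = (- a / b) * y x" for x
        using False by (simp add: w_def b_def field_simps add_eq_0_iff2)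
      then have "z = (\<lambda>x. (- a / b) * y x)" by auto
      then show False
        using z(2) fun_vs.span_scale[OF fun_vs.span_base[of y "{y}"], of "- a / b"] by simp
    qed
    then have "0 < l1norm (fcoeff w)" using l1norm_pos[OF s c] by blast
    moreover have "fcoeff w k = 0" by (simp add: W a_def b_def)
    ultimately show ?thesis using s by blast
  qed
qed

text \<open>What the eigenvalue sequences provide at a single large n. The last clause supplies the
  vector for \<open>double_eigenvalue\<close>.\<close>

definition good :: "(nat \<Rightarrow> nat \<Rightarrow> real) \<Rightarrow> nat \<Rightarrow> bool" where
  "good lam n \<longleftrightarrow> lam n 1 \<le> lam n 2 \<and>
     (\<forall>j\<in>{1,2}. near n (lam n j) \<and> (\<exists>u. sol (lam n j) u \<and> 0 < l1norm u)) \<and>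
     (lam n 1 = lam n 2 \<longrightarrow> (\<exists>u. sol (lam n 1) u \<and> 0 < l1norm u \<and> u (- int n) = 0))"

lemma eventually_near:
  assumes "(\<lambda>n. lam n - (2 * pi * real n)\<^sup>2) \<in> O(\<lambda>n. sqrt (real n))"
  shows "\<forall>\<^sub>F n in sequentially. near n (lam n)"
proof -
  obtain c where "c > 0" and c: "\<forall>\<^sub>F n in sequentially. norm (lam n - (2 * pi * real n)\<^sup>2) \<le> c * norm (sqrt (real n))"
    using assms by (elim landau_o.bigE)
  have "\<forall>\<^sub>F n in sequentially. c * sqrt (real n) \<le> real n"
    using eventually_ge_at_top[of "nat \<lceil>c\<^sup>2\<rceil>"]
  proof eventually_elim
    case (elim n)
    then have "c\<^sup>2 \<le> real n" by linarith
    then have "c \<le> sqrt (real n)" by (rule real_le_rsqrt)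
    then have "c * sqrt (real n) \<le> sqrt (real n) * sqrt (real n)" by (intro mult_right_mono) auto
    then show ?case by simp
  qed
  then show ?thesis using c eventually_ge_at_top[of 1]
    by eventually_elim (auto simp: near_def)
qed

lemma eventually_good:
  assumes q: "set_integrable lebesgue {0..1} q" and seqs: "hill_eigenvalue_sequences q N0 lam"
  shows "\<forall>\<^sub>F n in sequentially. good lam n"
proof -
  obtain R where le: "\<And>n. n \<ge> N0 \<Longrightarrow> lam n 1 \<le> lam n 2"
    and R: "\<And>n j. n \<ge> N0 \<Longrightarrow> j \<in> {1,2} \<Longrightarrow> R \<le> lam n j"
    and mult: "\<And>\<mu>. \<mu> \<ge> R \<Longrightarrow> hill_mult q \<mu> = card {(n, j). N0 \<le> n \<and> j \<in> {1,2} \<and> lam n j = \<mu>}"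
    and O: "\<And>j. j \<in> {1,2} \<Longrightarrow> (\<lambda>n. lam n j - (2 * pi * real n)\<^sup>2) \<in> O(\<lambda>n. sqrt (real n))"
    using seqs unfolding hill_eigenvalue_sequences_def by blast
  have nr: "\<forall>\<^sub>F n in sequentially. near n (lam n 1) \<and> near n (lam n 2)"
    using eventually_near[OF O[of 1]] eventually_near[OF O[of 2]] by (auto intro: eventually_conj)
  then obtain N1 where N1: "\<And>n j. n \<ge> N1 \<Longrightarrow> j \<in> {1,2} \<Longrightarrow> near n (lam n j)"
    unfolding eventually_sequentially by blast
  \<comment> \<open>An infinite set has \<open>card\<close> 0, so the lower bounds on the
    multiplicity need each value to occur only finitely often. This holds because
    \<open>lam n j \<ge> n\<close> for large n.\<close>
  have fin: "finite {(n, j). N0 \<le> n \<and> j \<in> {1,2} \<and> lam n j = \<mu>}" for \<mu>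
  proof (rule finite_subset)
    let ?K = "max N1 (nat \<lceil>\<bar>\<mu>\<bar>\<rceil> + 1)"
    show "{(n, j). N0 \<le> n \<and> j \<in> {1,2} \<and> lam n j = \<mu>} \<subseteq> {..?K} \<times> {1, 2::nat}"
    proof
      fix x assume "x \<in> {(n, j). N0 \<le> n \<and> j \<in> {1,2} \<and> lam n j = \<mu>}"
      then obtain n j where x: "x = (n, j)" and j: "j \<in> {1,2}" and lam: "lam n j = \<mu>" by blast
      have "\<not> n > ?K"
      proof
        assume n: "n > ?K"
        then have nr: "near n (lam n j)" using j by (intro N1) auto
        have "real n * 2 \<le> (2 * pi * real n)\<^sup>2"
        proof -
          have "real n \<ge> 1" using n by simp
          then have "real n * 1 \<le> real n * real n" by (intro mult_left_mono) auto
          moreover have "2 * (real n * real n) \<le> (4 * pi\<^sup>2) * (real n * real n)"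
            using one_le_power[of pi 2] pi_gt3 by (intro mult_right_mono) (linarith, simp)
          ultimately show ?thesis by (simp add: power2_eq_square)
        qed
        then have "real n \<le> lam n j" using nr unfolding near_def by linarith
        moreover have "\<bar>\<mu>\<bar> < real n" using n by linarith
        ultimately show False using lam by linarith
      qed
      then show "x \<in> {..?K} \<times> {1, 2}" using x j by auto
    qed
  qed simp
  show ?thesis
    using nr eventually_ge_at_top[of N0]
  proof eventually_elim
    case (elim n)
    have m1: "hill_mult q (lam n j) \<ge> 1" if j: "j \<in> {1,2}" for j
    proof -
      have "{(n, j)} \<subseteq> {(n', j'). N0 \<le> n' \<and> j' \<in> {1,2} \<and> lam n' j' = lam n j}" using elim j by auto
      from card_mono[OF fin this] show ?thesis using mult[OF R[OF elim(2) j]] by simp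
    qed
    have m2: "hill_mult q (lam n 1) \<ge> 2" if "lam n 1 = lam n 2"
    proof -
      have "{(n, 1), (n, 2)} \<subseteq> {(n', j'). N0 \<le> n' \<and> j' \<in> {1,2} \<and> lam n' j' = lam n 1}" using elim that by auto
      from card_mono[OF fin this] show ?thesis using mult[OF R[OF elim(2), of 1]] by simp
    qed
    show ?case
      unfolding good_def using le[OF elim(2)] elim(1) simple_eigenvalue_sol[OF q m1] double_eigenvalue_sol[OF q m2, of "- int n"]
      by auto
  qed
qed

subsection \<open>Asymptotics\<close>

text \<open>The factor 10 is that of \<open>wsum_le\<close>, so that
  \<open>wsum n \<le> rate n\<close> without further constants.\<close>

definition rate :: "nat \<Rightarrow> real" where
  "rate n = 10 * (ln (real n) / real n)"

text \<open>All four follow from ln(n)^(m+1) / n -> 0, which is the power m + 1 of ln n /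
  n^(1/(m+1)) -> 0.\<close>

lemma rate_small:
  assumes "e > 0"
  shows "\<forall>\<^sub>F n in sequentially. K * rate n \<le> e"
    and "\<forall>\<^sub>F n in sequentially. K * rate n ^ 2 \<le> e / real n"
    and "\<forall>\<^sub>F n in sequentially. K * rate n ^ 3 \<le> e / (real n)\<^sup>2"
    and "\<forall>\<^sub>F n in sequentially. K * rate n ^ (m + 1) \<le> e / real n ^ m"
proof -
  have pos: "\<forall>\<^sub>F n in sequentially. real n > 0" using eventually_gt_at_top[of 0] by eventually_elim simp
  have *: "\<forall>\<^sub>F n in sequentially. K * rate n ^ (m + 1) \<le> e / real n ^ m" for m
  proof -
    have "(\<lambda>n. ln (real n) ^ (m + 1) / real n) \<longlonglongrightarrow> 0"
    proof (rule Lim_transform_eventually)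
      show "(\<lambda>n. (ln (real n) / real n powr (1 / real (m + 1))) ^ (m + 1)) \<longlonglongrightarrow> 0"
        using tendsto_power[OF lim_ln_over_power[of "1 / real (m + 1)"], of "m + 1"] by simp
      show "\<forall>\<^sub>F n in sequentially. (ln (real n) / real n powr (1 / real (m + 1))) ^ (m + 1) = ln (real n) ^ (m + 1) / real n"
        using pos
      proof eventually_elim
        case (elim n)
        have "(real n powr (1 / real (m + 1))) ^ (m + 1) = real n"
          using elim by (subst powr_power) auto
        then show ?case by (simp only: power_divide)
      qed
    qed
    then have "(\<lambda>n. K * 10 ^ (m + 1) * (ln (real n) ^ (m + 1) / real n)) \<longlonglongrightarrow> K * 10 ^ (m + 1) * 0"
      by (intro tendsto_mult_left) auto
    then have "\<forall>\<^sub>F n in sequentially. K * 10 ^ (m + 1) * (ln (real n) ^ (m + 1) / real n) < e"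
      using assms by (intro order_tendstoD) auto
    then show ?thesis
      using pos
    proof eventually_elim
      case (elim n)
      have "K * rate n ^ (m + 1) = (K * 10 ^ (m + 1) * (ln (real n) ^ (m + 1) / real n)) / real n ^ m"
        using elim(2) by (simp add: rate_def power_mult_distrib power_divide field_simps)
      also have "\<dots> \<le> e / real n ^ m" using elim by (intro divide_right_mono) auto
      finally show ?case .
    qed
  qed
  show "\<forall>\<^sub>F n in sequentially. K * rate n \<le> e" using *[of 0] by simp
  show "\<forall>\<^sub>F n in sequentially. K * rate n ^ 2 \<le> e / real n" using *[of 1] by (simp add: power2_eq_square)
  show "\<forall>\<^sub>F n in sequentially. K * rate n ^ 3 \<le> e / (real n)\<^sup>2" using *[of 2] by (simp add: numeral_3_eq_3)
  show "\<forall>\<^sub>F n in sequentially. K * rate n ^ (m + 1) \<le> e / real n ^ m" by (rule *)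
qed

lemma wsum_le_rate: "n \<ge> 2 \<Longrightarrow> wsum n \<le> rate n"
  using wsum_le by (simp add: rate_def)

lemma inverse_le_rate:
  assumes "n \<ge> 2"
  shows "1 / real n \<le> rate n"
proof -
  have "ln 2 \<le> ln (real n)" using assms by simp
  then have "1 \<le> 10 * ln (real n)" using ln2_ge_two_thirds by linarith
  then show ?thesis using assms by (simp add: rate_def divide_right_mono)
qed

lemma wsum_le_1: "C * wsum n \<le> 1 / 2 \<Longrightarrow> wsum n \<le> 1"
  using mult_right_mono[OF C1 wsum_nonneg[of n]] by simp

lemma err_le:
  assumes "wsum n \<le> 1" "k \<le> m"
  shows "err n m \<le> C ^ (m + 2) * wsum n ^ Suc k"
  unfolding err_def using assms C1 by (intro mult_left_mono power_decreasing wsum_nonneg) auto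

text \<open>q_{2n} is kept apart from the \<open>wsum\<close> term: when |q_{2n}| < \<epsilon> / n,
  the deviation improves from bounded to O(ln n / n), as \<open>coupling_lower_bound\<close>
  requires.\<close>

lemma eigenvalue_deviation:
  assumes \<mu>: "near n \<mu>" and u: "sol \<mu> u" "0 < l1norm u" and small: "C * wsum n \<le> 1 / 2"
  shows "\<bar>\<mu> - (2 * pi * real n)\<^sup>2\<bar> \<le> norm (fourier q (2 * int n)) + (2 * (real m * C ^ Suc m) + 4 * C ^ (m + 2)) * wsum n"
proof -
  have w: "wsum n \<le> 1" by (rule wsum_le_1[OF small])
  have 1: "\<bar>\<bar>shift n m \<mu>\<bar> - norm (coupling n m \<mu>)\<bar> \<le> 4 * err n m" by (rule shift_coupling[OF \<mu> u small])
  have 2: "err n m \<le> C ^ (m + 2) * wsum n" using err_le[OF w, of 0 m] by simp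
  have 3: "norm (hill_A q n m \<mu>) \<le> real m * C ^ Suc m * wsum n" "norm (hill_B q n m \<mu>) \<le> real m * C ^ Suc m * wsum n"
    unfolding hill_A_eq hill_B_eq by (rule hill_sum_le[OF \<mu> w])+
  have 4: "norm (coupling n m \<mu>) \<le> norm (fourier q (2 * int n)) + norm (hill_B q n m \<mu>)"
    unfolding coupling_def by (rule norm_triangle_ineq)
  have "\<bar>\<mu> - (2 * pi * real n)\<^sup>2\<bar> \<le> \<bar>shift n m \<mu>\<bar> + norm (hill_A q n m \<mu>)"
    unfolding shift_def using abs_Re_le_cmod[of "hill_A q n m \<mu>"] by linarith
  also have "\<dots> \<le> norm (fourier q (2 * int n)) + (real m * C ^ Suc m * wsum n + real m * C ^ Suc m * wsum n + 4 * (C ^ (m + 2) * wsum n))"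
    using 1 2 3 4 by linarith
  also have "\<dots> = norm (fourier q (2 * int n)) + (2 * (real m * C ^ Suc m) + 4 * C ^ (m + 2)) * wsum n"
    by (simp add: algebra_simps)
  finally show ?thesis .
qed

text \<open>1/2 serves \<open>l1norm_le\<close>, 1/16 near orthogonality, and 1/4 is the Lipschitz
  constant of A_m and B_m in \<open>eigenvalue_signs\<close>.\<close>

definition settled :: "(nat \<Rightarrow> nat \<Rightarrow> real) \<Rightarrow> nat \<Rightarrow> nat \<Rightarrow> bool" where
  "settled lam m n \<longleftrightarrow> good lam n \<and> n \<ge> 2 \<and> C * wsum n \<le> 1 / 2 \<and> C\<^sup>2 * wsum n \<le> 1 / 16 \<and>
     (real m)\<^sup>2 * C ^ Suc m * (wsum n / real n) \<le> 1 / 4"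

lemma eventually_settled:
  assumes "\<forall>\<^sub>F n in sequentially. good lam n"
  shows "\<forall>\<^sub>F n in sequentially. settled lam m n"
proof -
  have r: "\<forall>\<^sub>F n in sequentially. C * rate n \<le> 1 / 2" "\<forall>\<^sub>F n in sequentially. C\<^sup>2 * rate n \<le> 1 / 16"
    "\<forall>\<^sub>F n in sequentially. (real m)\<^sup>2 * C ^ Suc m * rate n \<le> 1 / 4"
    by (rule rate_small(1), simp)+
  show ?thesis
    using assms eventually_ge_at_top[of 2] r
  proof eventually_elim
    case (elim n)
    have w: "wsum n \<le> rate n" "0 \<le> wsum n" using elim wsum_le_rate wsum_nonneg by auto
    have "wsum n / real n \<le> wsum n / 1" using elim w(2) by (intro divide_left_mono) auto
    then have wn: "wsum n / real n \<le> rate n" using w by simp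
    have "C * wsum n \<le> C * rate n" "C\<^sup>2 * wsum n \<le> C\<^sup>2 * rate n"
      using C1 w by (auto intro!: mult_left_mono)
    moreover have "(real m)\<^sup>2 * C ^ Suc m * (wsum n / real n) \<le> (real m)\<^sup>2 * C ^ Suc m * rate n"
      using C1 wn by (intro mult_left_mono) auto
    ultimately show ?case unfolding settled_def using elim by (intro conjI) (assumption | linarith)+
  qed
qed

lemma settledD:
  assumes "settled lam m n"
  shows "good lam n" "n \<ge> 2" "C * wsum n \<le> 1 / 2" "C\<^sup>2 * wsum n \<le> 1 / 16" "wsum n \<le> 1" "wsum n \<le> rate n"
    and "near n \<mu> \<Longrightarrow> near n \<nu> \<Longrightarrow> norm (hill_A q n m \<mu> - hill_A q n m \<nu>) \<le> 1 / 4 * \<bar>\<mu> - \<nu>\<bar>"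
    and "near n \<mu> \<Longrightarrow> near n \<nu> \<Longrightarrow> norm (hill_B q n m \<mu> - hill_B q n m \<nu>) \<le> 1 / 4 * \<bar>\<mu> - \<nu>\<bar>"
proof -
  have *: "good lam n" "n \<ge> 2" "C * wsum n \<le> 1 / 2" "C\<^sup>2 * wsum n \<le> 1 / 16"
    and l: "(real m)\<^sup>2 * C ^ Suc m * (wsum n / real n) \<le> 1 / 4"
    using assms by (auto simp: settled_def)
  show "good lam n" "n \<ge> 2" "C * wsum n \<le> 1 / 2" "C\<^sup>2 * wsum n \<le> 1 / 16" by (fact *)+
  show w: "wsum n \<le> 1" by (rule wsum_le_1[OF *(3)])
  show "wsum n \<le> rate n" by (rule wsum_le_rate[OF *(2)])
  have "norm (hill_sum n m t \<mu> - hill_sum n m t \<nu>) \<le> 1 / 4 * \<bar>\<mu> - \<nu>\<bar>" if "near n \<mu>" "near n \<nu>" for t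
    by (rule order_trans[OF hill_sum_lipschitz[OF that w] mult_right_mono[OF l]]) simp
  then show "near n \<mu> \<Longrightarrow> near n \<nu> \<Longrightarrow> norm (hill_A q n m \<mu> - hill_A q n m \<nu>) \<le> 1 / 4 * \<bar>\<mu> - \<nu>\<bar>"
    "near n \<mu> \<Longrightarrow> near n \<nu> \<Longrightarrow> norm (hill_B q n m \<mu> - hill_B q n m \<nu>) \<le> 1 / 4 * \<bar>\<mu> - \<nu>\<bar>"
    unfolding hill_A_eq hill_B_eq by blast+
qed

lemma goodD:
  assumes "good lam n"
  shows "lam n 1 \<le> lam n 2" and "j \<in> {1,2} \<Longrightarrow> near n (lam n j)"
    and "j \<in> {1,2} \<Longrightarrow> \<exists>u. sol (lam n j) u \<and> 0 < l1norm u"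
    and "lam n 1 = lam n 2 \<Longrightarrow> \<exists>u. sol (lam n 1) u \<and> 0 < l1norm u \<and> u (- int n) = 0"
  using assms unfolding good_def by blast+

text \<open>The variation of A_m accounts for at most a quarter of the gap, so 3/4 of it is bounded
  by the moduli of the two shifts, hence by the couplings and 8 err.\<close>

lemma gap_le:
  assumes "settled lam m n"
  shows "lam n 2 - lam n 1 \<le> 2 * (norm (coupling n m (lam n 1)) + norm (coupling n m (lam n 2))) + 16 * err n m"
proof -
  note f = settledD[OF assms] and g = goodD[OF settledD(1)[OF assms]]
  have "\<bar>\<bar>shift n m (lam n j)\<bar> - norm (coupling n m (lam n j))\<bar> \<le> 4 * err n m" if j: "j \<in> {1,2}" for j
    using g(3)[OF j] shift_coupling[OF g(2)[OF j] _ _ f(3)] by blast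
  from this[of 1] this[of 2]
  have 1: "\<bar>shift n m (lam n 1)\<bar> \<le> norm (coupling n m (lam n 1)) + 4 * err n m"
    and 2: "\<bar>shift n m (lam n 2)\<bar> \<le> norm (coupling n m (lam n 2)) + 4 * err n m" by auto
  have "norm (hill_A q n m (lam n 2) - hill_A q n m (lam n 1)) \<le> 1 / 4 * \<bar>lam n 2 - lam n 1\<bar>"
    by (intro f g) auto
  then have "Re (hill_A q n m (lam n 2)) - Re (hill_A q n m (lam n 1)) \<le> (lam n 2 - lam n 1) / 4"
    using complex_Re_le_cmod[of "hill_A q n m (lam n 2) - hill_A q n m (lam n 1)"] g(1) by simp
  moreover have "lam n 2 - lam n 1 = shift n m (lam n 2) - shift n m (lam n 1) + (Re (hill_A q n m (lam n 2)) - Re (hill_A q n m (lam n 1)))"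
    by (simp add: shift_def)
  ultimately have "3 / 4 * (lam n 2 - lam n 1) \<le> norm (coupling n m (lam n 1)) + norm (coupling n m (lam n 2)) + 8 * err n m"
    using 1 2 by (simp add: field_simps)
  moreover have "0 \<le> norm (coupling n m (lam n 1)) + norm (coupling n m (lam n 2)) + 8 * err n m"
    using err_nonneg[of n m] by simp
  ultimately show ?thesis by (simp add: field_simps)
qed

text \<open>A coincidence of the eigenvalues is excluded first by \<open>double_eigenvalue\<close>;
  after that \<open>eigenvalue_signs\<close> applies.\<close>

lemma eigenvalue_location:
  assumes "settled lam m n" and big: "\<And>j. j \<in> {1,2} \<Longrightarrow> 600 * err n m < norm (coupling n m (lam n j))" and j: "j \<in> {1,2}"
  shows "\<bar>shift n m (lam n j) - (-1) ^ j * norm (coupling n m (lam n j))\<bar> \<le> 4 * err n m"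
proof -
  note f = settledD[OF assms(1)] and g = goodD[OF settledD(1)[OF assms(1)]]
  have ne: "lam n 1 \<noteq> lam n 2"
  proof
    assume "lam n 1 = lam n 2"
    then obtain u where u: "sol (lam n 1) u" "0 < l1norm u" "u (- int n) = 0" using g(4) by blast
    have "norm (coupling n m (lam n 1)) \<le> 6 * err n m" by (rule double_eigenvalue[OF _ u(1,2) f(3) u(3)]) (intro g, simp)
    then show False using big[of 1] err_nonneg[of n m] by simp
  qed
  then have less: "lam n 1 < lam n 2" using g(1) by simp
  have nr: "near n (lam n 1)" "near n (lam n 2)" by (intro g; simp)+
  obtain u v where u: "sol (lam n 1) u" "0 < l1norm u" and v: "sol (lam n 2) v" "0 < l1norm v"
    using g(3)[of 1] g(3)[of 2] by auto
  note s = eigenvalue_signs[OF nr u v less f(4) f(7)[OF nr] f(8)[OF nr] big[of 1] big[of 2]]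
  show ?thesis using j s by auto
qed

lemma err_small:
  assumes "e > 0"
  shows "\<forall>\<^sub>F n in sequentially. K * err n m \<le> e / real n ^ m"
  using rate_small(4)[OF assms, of "\<bar>K\<bar> * C ^ (m + 2)" m] eventually_ge_at_top[of 2]
proof eventually_elim
  case (elim n)
  have "K * err n m \<le> \<bar>K\<bar> * (C ^ (m + 2) * wsum n ^ (m + 1))"
    unfolding err_def using C1 wsum_nonneg by (intro mult_right_mono) auto
  also have "\<dots> \<le> \<bar>K\<bar> * (C ^ (m + 2) * rate n ^ (m + 1))"
    using C1 wsum_nonneg wsum_le_rate elim(2) by (intro mult_left_mono power_mono) auto
  also have "\<dots> \<le> e / real n ^ m" using elim(1) by (simp add: mult_ac)
  finally show ?case .
qed

lemma norm_Re_diff_le: "\<bar>Re x - Re y\<bar> \<le> norm (x - y)"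
  using abs_Re_le_cmod[of "x - y"] by simp

lemma sign_mult_diff_le: "\<bar>(-1) ^ j * norm x - (-1) ^ j * norm y\<bar> \<le> norm (x - y :: complex)"
proof -
  have "\<bar>(-1) ^ j * norm x - (-1) ^ j * norm y\<bar> = \<bar>norm x - norm y\<bar>"
    by (simp only: right_diff_distrib[symmetric] abs_mult power_abs) simp
  then show ?thesis using norm_triangle_ineq3[of x y] by simp
qed

text \<open>One step gains a factor \<open>rate n ^ 2\<close> from the Lipschitz constant, and the truncation costs \<open>rate n ^ (k + 2)\<close>.\<close>

lemma hill_E_step:
  assumes f: "settled lam m n" and j: "j \<in> {1,2}" and k: "Suc k \<le> m"
    and loc: "\<bar>shift n m (lam n j) - (-1) ^ j * norm (coupling n m (lam n j))\<bar> \<le> 4 * err n m"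
    and E: "near n (hill_E q n j k)" "\<bar>lam n j - hill_E q n j k\<bar> \<le> K * rate n ^ k"
  shows "\<bar>lam n j - hill_E q n j (Suc k)\<bar> \<le>
    (4 * C ^ (m + 2) + 2 * (real m * C ^ Suc m) + 2 * ((real (Suc k))\<^sup>2 * C ^ Suc (Suc k)) * K) * rate n ^ (k + 2)"
proof -
  note f' = settledD[OF f] and g = goodD[OF settledD(1)[OF f]]
  let ?l = "lam n j" and ?E = "hill_E q n j k" and ?k = "Suc k"
  have nr: "near n ?l" by (rule g(2)[OF j])
  have r: "0 \<le> rate n" using f'(6) wsum_nonneg[of n] by linarith
  have wr: "wsum n ^ i \<le> rate n ^ i" for i by (intro power_mono f' wsum_nonneg)
  have tail: "norm (hill_sum n m t ?l - hill_sum n ?k t ?l) \<le> real m * C ^ Suc m * rate n ^ (k + 2)" for t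
    by (rule order_trans[OF hill_sum_tail_le[OF nr f'(5) k]]) (use wr[of "k + 2"] C1 in \<open>auto intro!: mult_left_mono\<close>)
  have lip: "norm (hill_sum n ?k t ?l - hill_sum n ?k t ?E) \<le> (real ?k)\<^sup>2 * C ^ Suc ?k * K * rate n ^ (k + 2)" for t
  proof -
    have "wsum n / real n = wsum n * (1 / real n)" by simp
    also have "\<dots> \<le> rate n * rate n"
      using f'(2,6) r inverse_le_rate by (intro mult_mono) auto
    finally have w: "wsum n / real n \<le> rate n ^ 2" by (simp add: power2_eq_square)
    have "norm (hill_sum n ?k t ?l - hill_sum n ?k t ?E) \<le> (real ?k)\<^sup>2 * C ^ Suc ?k * (wsum n / real n) * \<bar>?l - ?E\<bar>"
      by (rule hill_sum_lipschitz[OF nr E(1) f'(5)])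
    also have "\<dots> \<le> (real ?k)\<^sup>2 * C ^ Suc ?k * rate n ^ 2 * (K * rate n ^ k)"
      using w E(2) C1 r by (intro mult_mono mult_left_mono) auto
    finally show ?thesis by (simp add: power_add power2_eq_square mult_ac)
  qed
  have step: "norm (hill_sum n m t ?l - hill_sum n ?k t ?E) \<le>
      (real m * C ^ Suc m + (real ?k)\<^sup>2 * C ^ Suc ?k * K) * rate n ^ (k + 2)" for t
    using norm_triangle_ineq[of "hill_sum n m t ?l - hill_sum n ?k t ?l" "hill_sum n ?k t ?l - hill_sum n ?k t ?E"]
      tail[of t] lip[of t] by (simp add: distrib_right)
  have e: "4 * err n m \<le> 4 * C ^ (m + 2) * rate n ^ (k + 2)"
  proof -
    have "err n m \<le> C ^ (m + 2) * wsum n ^ Suc ?k"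
    proof (cases "k + 2 \<le> m + 1")
      case True
      then show ?thesis using err_le[OF f'(5), of ?k m] k f'(5) C1 wsum_nonneg[of n]
        unfolding err_def by (intro mult_left_mono power_decreasing) auto
    qed (use k in simp)
    also have "\<dots> \<le> C ^ (m + 2) * rate n ^ (k + 2)" using wr[of "k + 2"] C1 by (intro mult_left_mono) auto
    finally show ?thesis by simp
  qed
  \<comment> \<open>The location error, plus the changes of A and of the coupling on passing from
    level m at the eigenvalue to level k + 1 at the previous iterate.\<close>
  have "?l - hill_E q n j ?k = (shift n m ?l - (-1) ^ j * norm (coupling n m ?l)) +
      (Re (hill_A q n m ?l) - Re (hill_A q n ?k ?E)) +
      ((-1) ^ j * norm (coupling n m ?l) - (-1) ^ j * norm (coupling n ?k ?E))"
    by (simp add: shift_def coupling_def)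
  then have "\<bar>?l - hill_E q n j ?k\<bar> \<le> \<bar>shift n m ?l - (-1) ^ j * norm (coupling n m ?l)\<bar> +
      \<bar>Re (hill_A q n m ?l) - Re (hill_A q n ?k ?E)\<bar> +
      \<bar>(-1) ^ j * norm (coupling n m ?l) - (-1) ^ j * norm (coupling n ?k ?E)\<bar>"
    by linarith
  also have "\<dots> \<le> 4 * C ^ (m + 2) * rate n ^ (k + 2) +
      norm (hill_A q n m ?l - hill_A q n ?k ?E) + norm (coupling n m ?l - coupling n ?k ?E)"
    using loc e norm_Re_diff_le[of "hill_A q n m ?l" "hill_A q n ?k ?E"]
      sign_mult_diff_le[of j "coupling n m ?l" "coupling n ?k ?E"] by linarith
  also have "\<dots> \<le> 4 * C ^ (m + 2) * rate n ^ (k + 2) +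
      (real m * C ^ Suc m + (real ?k)\<^sup>2 * C ^ Suc ?k * K) * rate n ^ (k + 2) +
      (real m * C ^ Suc m + (real ?k)\<^sup>2 * C ^ Suc ?k * K) * rate n ^ (k + 2)"
    using step[of 0] step[of "2 * int n"] by (intro add_mono) (simp_all add: hill_A_eq hill_B_eq coupling_def)
  also have "\<dots> = (4 * C ^ (m + 2) + 2 * (real m * C ^ Suc m) + 2 * ((real ?k)\<^sup>2 * C ^ Suc ?k) * K) * rate n ^ (k + 2)"
    by (simp add: algebra_simps)
  finally show ?thesis .
qed

text \<open>The induction carries only \<open>rate n ^ k\<close>, starting from the bounded
  deviation at k = 0. A step yields the exponent k + 2, of which one power is given away, except in
  the last step, which gives m + 1.\<close>

theorem hill_E_approximation:
  assumes f: "\<forall>\<^sub>F n in sequentially. settled lam m n" and j: "j \<in> {1,2}" and m: "m \<ge> 1"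
    and loc: "\<forall>\<^sub>F n in sequentially. \<bar>shift n m (lam n j) - (-1) ^ j * norm (coupling n m (lam n j))\<bar> \<le> 4 * err n m"
  shows "\<exists>K. \<forall>\<^sub>F n in sequentially. \<bar>lam n j - hill_E q n j m\<bar> \<le> K * rate n ^ (m + 1)"
proof -
  define K0 where "K0 = C + (2 * (real m * C ^ Suc m) + 4 * C ^ (m + 2))"
  have K0: "0 \<le> K0" using C1 by (simp add: K0_def)
  have dev: "\<forall>\<^sub>F n in sequentially. \<bar>lam n j - (2 * pi * real n)\<^sup>2\<bar> \<le> K0"
    using f
  proof eventually_elim
    case (elim n)
    note f' = settledD[OF elim] and g = goodD[OF settledD(1)[OF elim]]
    obtain u where u: "sol (lam n j) u" "0 < l1norm u" using g(3)[OF j] by blast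
    have "\<bar>lam n j - (2 * pi * real n)\<^sup>2\<bar> \<le> norm (fourier q (2 * int n)) + (2 * (real m * C ^ Suc m) + 4 * C ^ (m + 2)) * wsum n"
      by (rule eigenvalue_deviation[OF g(2)[OF j] u f'(3)])
    also have "\<dots> \<le> C + (2 * (real m * C ^ Suc m) + 4 * C ^ (m + 2)) * 1"
      using f'(5) C1 by (intro add_mono mult_left_mono bound) auto
    finally show ?case by (simp add: K0_def)
  qed
  have step: "\<exists>K'\<ge>0. \<forall>\<^sub>F n in sequentially. \<bar>lam n j - hill_E q n j (Suc k)\<bar> \<le> K' * rate n ^ (k + 2)"
    if k: "Suc k \<le> m" and K: "K \<ge> 0" "\<forall>\<^sub>F n in sequentially. \<bar>lam n j - hill_E q n j k\<bar> \<le> K * rate n ^ k" for k K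
  proof -
    \<comment> \<open>K bounds the distance of the iterate from the eigenvalue and K0 that of the
      eigenvalue from (2 pi n)^2, so n \<ge> K + K0 keeps the iterate \<open>near\<close>.\<close>
    have "\<forall>\<^sub>F n in sequentially. real n \<ge> K + K0"
      using eventually_ge_at_top[of "nat \<lceil>K + K0\<rceil>"] by eventually_elim linarith
    then have "\<forall>\<^sub>F n in sequentially. \<bar>lam n j - hill_E q n j (Suc k)\<bar> \<le>
      (4 * C ^ (m + 2) + 2 * (real m * C ^ Suc m) + 2 * ((real (Suc k))\<^sup>2 * C ^ Suc (Suc k)) * K) * rate n ^ (k + 2)"
      using f loc dev K(2) rate_small(1)[of 1 1, OF zero_less_one]
    proof eventually_elim
      case (elim n)
      note f' = settledD[OF elim(2)]
      have r: "0 \<le> rate n" using f'(6) wsum_nonneg[of n] by linarith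
      have "K * rate n ^ k \<le> K * 1" using K(1) r elim(6) by (intro mult_left_mono power_le_one) auto
      then have "\<bar>hill_E q n j k - (2 * pi * real n)\<^sup>2\<bar> \<le> real n" using elim by linarith
      then have "near n (hill_E q n j k)" using f'(2) by (simp add: near_def)
      then show ?case by (rule hill_E_step[OF elim(2) j k elim(3) _ elim(5)])
    qed
    moreover have "0 \<le> 4 * C ^ (m + 2) + 2 * (real m * C ^ Suc m) + 2 * ((real (Suc k))\<^sup>2 * C ^ Suc (Suc k)) * K"
      using C1 K(1) by (intro add_nonneg_nonneg mult_nonneg_nonneg) auto
    ultimately show ?thesis by blast
  qed
  have weak: "k \<le> m \<Longrightarrow> \<exists>K\<ge>0. \<forall>\<^sub>F n in sequentially. \<bar>lam n j - hill_E q n j k\<bar> \<le> K * rate n ^ k" for k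
  proof (induction k)
    case 0
    then show ?case using dev K0 by auto
  next
    case (Suc k)
    then obtain K where "K \<ge> 0" "\<forall>\<^sub>F n in sequentially. \<bar>lam n j - hill_E q n j k\<bar> \<le> K * rate n ^ k" by auto
    from step[OF Suc.prems this] obtain K' where K': "K' \<ge> 0"
      "\<forall>\<^sub>F n in sequentially. \<bar>lam n j - hill_E q n j (Suc k)\<bar> \<le> K' * rate n ^ (k + 2)" by blast
    have "\<forall>\<^sub>F n in sequentially. \<bar>lam n j - hill_E q n j (Suc k)\<bar> \<le> K' * rate n ^ Suc k"
      using K'(2) f rate_small(1)[of 1 1, OF zero_less_one]
    proof eventually_elim
      case (elim n)
      have "0 \<le> rate n" using settledD(6)[OF elim(2)] wsum_nonneg[of n] by linarith
      then have "K' * rate n ^ (k + 2) \<le> K' * rate n ^ Suc k"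
        using K'(1) elim(3) by (intro mult_left_mono power_decreasing) auto
      then show ?case using elim(1) by linarith
    qed
    then show ?case using K'(1) by blast
  qed
  obtain k where k: "m = Suc k" using m by (cases m) auto
  obtain K where "K \<ge> 0" "\<forall>\<^sub>F n in sequentially. \<bar>lam n j - hill_E q n j k\<bar> \<le> K * rate n ^ k"
    using weak[of k] k by auto
  from step[OF _ this] show ?thesis using k by auto
qed

end

text \<open>For each n the size of q_{2n} selects the case. If |q_{2n}| \<ge> \<epsilon> / n, it
  dominates and everything else is o(1/n). Otherwise the second inequality must hold, q_{2n} + b_1
  at the centre dominates, and the smallness of q_{2n} brings the eigenvalue so close to the centre
  that the remaining terms are o(1/n^2).\<close>

lemma (in bounded_coeffs) coupling_lower_bound:
  assumes q: "set_integrable lebesgue {0..1} q" and good: "\<forall>\<^sub>F n in sequentially. good lam n" and m: "m \<ge> 2" and \<epsilon>: "\<epsilon> > 0"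
    and cond: "\<And>n. n \<ge> N \<Longrightarrow> cmod (fourier q (2 * int n)) \<ge> \<epsilon> / real n \<or>
          cmod (fourier q (2 * int n) - fourier (primitive_sq q) (2 * int n)
                + 2 * fourier (primitive q) 0 * fourier (primitive q) (2 * int n)) \<ge> \<epsilon> / real n ^ 2"
  shows "\<forall>\<^sub>F n in sequentially. \<forall>j\<in>{1,2}. norm (coupling n m (lam n j)) \<ge> (\<epsilon> / 2) / real n ^ m"
proof -
  \<comment> \<open>Either case loses three portions of size e, which leaves 13/16 of \<epsilon>,
    more than the claimed half.\<close>
  define e where "e = \<epsilon> / 16"
  define P where "P = real m * C ^ Suc m"
  define K where "K = 2 * P + 4 * C ^ (m + 2)"
  have nn: "0 \<le> P" "0 \<le> K" "0 < e" using C1 \<epsilon> by (auto simp: P_def K_def e_def)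
  define f where "f = (\<lambda>x. complex_of_real (q x))"
  have f: "integrable M01 f" unfolding f_def by (rule integrable_of_real_M01[OF q])
  have bc: "bounded_coeffs q C" by (rule bounded_coeffs_axioms)
  have r1: "\<forall>\<^sub>F n in sequentially. C\<^sup>2 * (C + K) * rate n \<le> e" "\<forall>\<^sub>F n in sequentially. 1 * rate n \<le> 1"
    by (rule rate_small(1); use nn in simp)+
  have r2: "\<forall>\<^sub>F n in sequentially. (C ^ 3 + P) * rate n ^ 2 \<le> e / real n"
    "\<forall>\<^sub>F n in sequentially. C\<^sup>2 * (\<epsilon> + K) * rate n ^ 2 \<le> e / real n"
    by (rule rate_small(2)[OF nn(3)])+
  have r3: "\<forall>\<^sub>F n in sequentially. (2 * C ^ 3 * (\<epsilon> + K) + P) * rate n ^ 3 \<le> e / (real n)\<^sup>2"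
    by (rule rate_small(3)[OF nn(3)])
  show ?thesis
    using eventually_settled[OF good, of m] eventually_ge_at_top[of N] prod_coefficients_small[OF f nn(3)] r1 r2 r3
  proof eventually_elim
    case (elim n)
    note F = settledD[OF elim(1)] and G = goodD[OF settledD(1)[OF elim(1)]]
    have n1: "n \<ge> 1" "real n \<ge> 1" using F(2) by auto
    define r where "r = rate n"
    have r: "0 \<le> r" "r \<le> 1" "wsum n \<le> r" "1 / real n \<le> r"
      using F(6) wsum_nonneg[of n] elim(6) inverse_le_rate[OF F(2)] by (auto simp: r_def)
    have wr: "wsum n ^ i \<le> r ^ i" for i by (intro power_mono r wsum_nonneg)
    define \<mu>0 where "\<mu>0 = (2 * pi * real n)\<^sup>2"
    have n0: "near n \<mu>0" using n1 by (simp add: near_def \<mu>0_def)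
    define b where "b i \<mu> = hill_coeff q n i (2 * int n) \<mu>" for i \<mu>
    define Q where "Q = fourier q (2 * int n)"
    have quarter: "norm (z / complex_of_real (4 * pi\<^sup>2) ^ i) \<le> norm z" for z i
    proof -
      have "1 \<le> 4 * pi\<^sup>2" using one_le_power[of pi 2] pi_gt3 by linarith
      then have "1 \<le> (4 * pi\<^sup>2) ^ i" by (rule one_le_power)
      then have "norm z / (4 * pi\<^sup>2) ^ i \<le> norm z / 1" by (intro divide_left_mono) auto
      then show ?thesis unfolding norm_divide norm_power norm_of_real by simp
    qed
    have b1: "norm (b 1 \<mu>0) \<le> e / real n"
      unfolding b_def \<mu>0_def hill_coeff_eq_fcoeff(1)[OF q bc n1(1)] f_def[symmetric]
      using quarter[of _ 1] elim(3) by (simp only: power_one_right) (rule order_trans)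
    have b2: "norm (b 2 \<mu>0) \<le> e / (real n)\<^sup>2"
      unfolding b_def \<mu>0_def hill_coeff_eq_fcoeff(2)[OF q bc n1(1)] f_def[symmetric]
      of_real_power using quarter[of _ 2] elim(4) by (rule order_trans)
    show ?case
    proof
      fix j :: nat assume j: "j \<in> {1,2}"
      define l where "l = lam n j"
      have nr: "near n l" unfolding l_def by (rule G(2)[OF j])
      obtain u where u: "sol l u" "0 < l1norm u" using G(3)[OF j] unfolding l_def by blast
      have "\<bar>l - \<mu>0\<bar> \<le> norm Q + K * wsum n"
        unfolding \<mu>0_def Q_def K_def P_def by (rule eigenvalue_deviation[OF nr u F(3)])
      also have "\<dots> \<le> norm Q + K * r" using nn r by (intro add_left_mono mult_left_mono)
      finally have dev: "\<bar>l - \<mu>0\<bar> \<le> norm Q + K * r" .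
      define tail where "tail = hill_sum n m (2 * int n) l - hill_sum n 2 (2 * int n) l"
      have tail: "norm tail \<le> P * r ^ 3"
        unfolding tail_def P_def
        by (rule order_trans[OF hill_sum_tail_le[OF nr F(5) m]]) (use wr[of 3] C1 in \<open>auto simp: numeral_3_eq_3 intro!: mult_left_mono\<close>)
      have d1: "norm (b 1 l - b 1 \<mu>0) \<le> C\<^sup>2 * (\<bar>l - \<mu>0\<bar> / real n) * r"
        unfolding b_def
        by (rule order_trans[OF hill_coeff_lipschitz[OF nr n0]]) (use wr[of 1] C1 in \<open>auto simp: power2_eq_square intro!: mult_left_mono divide_right_mono\<close>)
      have d2: "norm (b 2 l - b 2 \<mu>0) \<le> C ^ 3 * (2 * \<bar>l - \<mu>0\<bar> / real n) * r ^ 2"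
        unfolding b_def
        by (rule order_trans[OF hill_coeff_lipschitz[OF nr n0]]) (use wr[of 2] C1 in \<open>auto simp: numeral_3_eq_3 numeral_2_eq_2 intro!: mult_left_mono divide_right_mono\<close>)
      have c2: "norm (b 2 l) \<le> C ^ 3 * r ^ 2"
        unfolding b_def
        by (rule order_trans[OF hill_coeff_le[OF nr]]) (use wr[of 2] C1 in \<open>auto simp: numeral_3_eq_3 numeral_2_eq_2 intro!: mult_left_mono\<close>)
      have B: "coupling n m l = Q + b 1 l + b 2 l + tail"
        by (simp add: coupling_def hill_B_eq tail_def b_def Q_def hill_sum_def numeral_2_eq_2)
      have pow: "x / real n ^ m \<le> x / real n ^ i" if "i \<le> m" "x \<ge> 0" for x i
        using that n1 by (intro divide_left_mono power_increasing) auto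
      have low: "norm (coupling n m l) \<ge> norm X - norm x - norm y - norm z" if "coupling n m l = X + x + y + z" for X x y z
        unfolding that using norm_triangle_ineq4[of "X + x + y + z" z] norm_triangle_ineq4[of "X + x + y" y]
          norm_triangle_ineq4[of "X + x" x] by simp
      show "norm (coupling n m (lam n j)) \<ge> (\<epsilon> / 2) / real n ^ m"
        unfolding l_def[symmetric]
      proof (cases "norm Q \<ge> \<epsilon> / real n")
        case True
        have "norm Q + K * r \<le> C + K * 1"
          using bound[of "2 * int n"] nn r by (intro add_mono mult_left_mono) (auto simp: Q_def)
        \<comment> \<open>A bounded deviation suffices here: the Lipschitz bound then changes b_1 by
          O(rate/n) = o(1/n).\<close>
        then have "\<bar>l - \<mu>0\<bar> / real n \<le> (C + K) / real n" using dev by (intro divide_right_mono) auto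
        then have "C\<^sup>2 * (\<bar>l - \<mu>0\<bar> / real n) * r \<le> C\<^sup>2 * ((C + K) / real n) * r"
          using r by (intro mult_right_mono mult_left_mono) auto
        also have "\<dots> = (C\<^sup>2 * (C + K) * r) / real n" by simp
        also have "\<dots> \<le> e / real n" using elim(5) by (intro divide_right_mono) (auto simp: r_def)
        finally have x1: "norm (b 1 l) \<le> e / real n + e / real n"
          using d1 b1 norm_triangle_sub[of "b 1 l" "b 1 \<mu>0"] by linarith
        have "P * r ^ 3 \<le> P * r ^ 2" using nn r by (intro mult_left_mono power_decreasing) auto
        moreover have "C ^ 3 * r ^ 2 + P * r ^ 2 \<le> e / real n" using elim(7) by (simp add: r_def distrib_right)
        ultimately have x2: "norm (b 2 l) + norm tail \<le> e / real n" using c2 tail by linarith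
        have "norm (coupling n m l) \<ge> \<epsilon> / real n - 3 * (e / real n)"
          using low[OF B] x1 x2 True by linarith
        moreover have "\<epsilon> / real n - 3 * (e / real n) = (13 / 16 * \<epsilon>) / real n" by (simp add: e_def field_simps)
        moreover have "(\<epsilon> / 2) / real n \<le> (13 / 16 * \<epsilon>) / real n" using \<epsilon> by (intro divide_right_mono) auto
        ultimately show "norm (coupling n m l) \<ge> (\<epsilon> / 2) / real n ^ m"
          using pow[of 1 "\<epsilon> / 2"] m \<epsilon> by simp
      next
        case False
        have "norm Q \<le> \<epsilon> * r"
        proof -
          have "norm Q \<le> \<epsilon> * (1 / real n)" using False by simp
          also have "\<dots> \<le> \<epsilon> * r" using \<epsilon> r by (intro mult_left_mono) auto
          finally show ?thesis .
        qed
        \<comment> \<open>The deviation is now O(rate), so b_1 changes by O(rate^2 / n) and b_2 by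
          O(rate^3), both o(1/n^2).\<close>
        then have dv: "\<bar>l - \<mu>0\<bar> \<le> (\<epsilon> + K) * r" using dev by (simp add: distrib_right)
        have ek: "0 \<le> \<epsilon> + K" using \<epsilon> nn by simp
        have "C\<^sup>2 * (\<bar>l - \<mu>0\<bar> / real n) * r \<le> C\<^sup>2 * (((\<epsilon> + K) * r) / real n) * r"
          using r dv by (intro mult_right_mono mult_left_mono divide_right_mono) auto
        also have "\<dots> = (C\<^sup>2 * (\<epsilon> + K) * r ^ 2) / real n" by (simp add: power2_eq_square)
        also have "\<dots> \<le> (e / real n) / real n" using elim(8) by (intro divide_right_mono) (auto simp: r_def)
        finally have x1: "norm (b 1 l - b 1 \<mu>0) \<le> e / (real n)\<^sup>2" using d1 by (simp add: power2_eq_square)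
        have "2 * \<bar>l - \<mu>0\<bar> / real n \<le> 2 * \<bar>l - \<mu>0\<bar> / 1" using n1 by (intro divide_left_mono) auto
        then have "C ^ 3 * (2 * \<bar>l - \<mu>0\<bar> / real n) * r ^ 2 \<le> C ^ 3 * (2 * ((\<epsilon> + K) * r)) * r ^ 2"
          using C1 dv by (intro mult_right_mono mult_left_mono) auto
        also have "\<dots> = 2 * C ^ 3 * (\<epsilon> + K) * r ^ 3" by (simp add: power3_eq_cube power2_eq_square)
        finally have x2: "norm (b 2 l - b 2 \<mu>0) \<le> 2 * C ^ 3 * (\<epsilon> + K) * r ^ 3" using d2 by linarith
        have x3: "2 * C ^ 3 * (\<epsilon> + K) * r ^ 3 + P * r ^ 3 \<le> e / (real n)\<^sup>2" using elim(9) by (simp add: r_def distrib_right)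
        have eq: "fourier q (2 * int n) - fourier (primitive_sq q) (2 * int n)
                + 2 * fourier (primitive q) 0 * fourier (primitive q) (2 * int n) = Q + b 1 \<mu>0"
          unfolding b_def \<mu>0_def hill_coeff_1_formula[OF q mean0 n1(1)] Q_def by simp
        then have main: "norm (Q + b 1 \<mu>0) \<ge> \<epsilon> / (real n)\<^sup>2" using cond[OF elim(2), unfolded eq, folded Q_def] False by blast
        have "coupling n m l = (Q + b 1 \<mu>0) + (b 1 l - b 1 \<mu>0) + b 2 l + tail" unfolding B by simp
        from low[OF this] have "norm (coupling n m l) \<ge> norm (Q + b 1 \<mu>0) - norm (b 1 l - b 1 \<mu>0) - norm (b 2 l) - norm tail" .
        then have "norm (coupling n m l) \<ge> \<epsilon> / (real n)\<^sup>2 - 3 * (e / (real n)\<^sup>2)"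
          using main x1 x2 x3 tail b2 norm_triangle_sub[of "b 2 l" "b 2 \<mu>0"] by linarith
        moreover have "\<epsilon> / (real n)\<^sup>2 - 3 * (e / (real n)\<^sup>2) = (13 / 16 * \<epsilon>) / (real n)\<^sup>2" by (simp add: e_def field_simps)
        moreover have "(\<epsilon> / 2) / (real n)\<^sup>2 \<le> (13 / 16 * \<epsilon>) / (real n)\<^sup>2" using \<epsilon> by (intro divide_right_mono) auto
        ultimately show "norm (coupling n m l) \<ge> (\<epsilon> / 2) / real n ^ m"
          using pow[of 2 "\<epsilon> / 2"] m \<epsilon> by simp
      qed
    qed
  qed
qed

section \<open>Assembly of the asymptotic statements\<close>

lemma bounded_coeffs_fourier:
  assumes q: "set_integrable lebesgue {0..1} q" and mean: "(LINT x:{0..1}|lebesgue. q x) = 0"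
  shows "bounded_coeffs q (max 1 (LINT x|M01. norm (complex_of_real (q x))))"
proof
  fix k
  show "norm (fourier q k) \<le> max 1 (LINT x|M01. norm (complex_of_real (q x)))"
    using norm_fcoeff_le[OF integrable_of_real_M01[OF q], of k] by (simp add: fourier_eq_fcoeff)
next
  have "fourier q 0 = complex_of_real (LINT x|M01. q x)"
    by (simp add: fourier_eq_fcoeff fcoeff_def)
  then show "fourier q 0 = 0" using mean by (simp add: integral_M01)
qed simp

theorem theorem9:
  fixes q :: "real \<Rightarrow> real" and lam :: "nat \<Rightarrow> nat \<Rightarrow> real" and N0 m :: nat
  assumes "set_integrable lebesgue {0..1} q"
    and "\<forall>x. q (x + 1) = q x"
    and "(LINT x:{0..1}|lebesgue. q x) = 0"
    and "m \<ge> 2"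
    and "hill_eigenvalue_sequences q N0 lam"
  shows
    "((\<exists>\<epsilon>>0. \<exists>N. \<forall>n\<ge>N. \<forall>j\<in>{1,2}.
          cmod (fourier q (2 * int n) + hill_B q n m (lam n j)) \<ge> \<epsilon> / real n ^ m) \<or>
      (\<exists>\<epsilon>>0. \<exists>N. \<forall>n\<ge>N.
          cmod (fourier q (2 * int n)) \<ge> \<epsilon> / real n \<or>
          cmod (fourier q (2 * int n) - fourier (primitive_sq q) (2 * int n)
                + 2 * fourier (primitive q) 0 * fourier (primitive q) (2 * int n)) \<ge> \<epsilon> / real n ^ 2)
      \<longrightarrow>
      (\<forall>j\<in>{1,2}. (\<lambda>n. lam n j - hill_E q n j m) \<in> O(\<lambda>n. (ln (real n) / real n) ^ (m + 1))) \<and>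
      (\<lambda>n. (lam n 2 - lam n 1) - (hill_E q n 2 m - hill_E q n 1 m))
         \<in> O(\<lambda>n. (ln (real n) / real n) ^ (m + 1)))
     \<and>
     ((\<forall>j\<in>{1,2}. (\<lambda>n. cmod (fourier q (2 * int n) + hill_B q n m (lam n j)))
         \<in> O(\<lambda>n. 1 / real n ^ m))
      \<longrightarrow> (\<lambda>n. lam n 2 - lam n 1) \<in> O(\<lambda>n. 1 / real n ^ m))
     \<and>
     ((\<forall>j\<in>{1,2}. (\<lambda>n. cmod (fourier q (2 * int n) + hill_B q n m (lam n j)))
         \<in> o(\<lambda>n. 1 / real n ^ m))
      \<longrightarrow> (\<lambda>n. lam n 2 - lam n 1) \<in> o(\<lambda>n. 1 / real n ^ m))"
proof -
  define C where "C = max 1 (LINT x|M01. norm (complex_of_real (q x)))"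
  interpret bounded_coeffs q C
    unfolding C_def by (rule bounded_coeffs_fourier[OF assms(1,3)])
  have good: "\<forall>\<^sub>F n in sequentially. good lam n" by (rule eventually_good[OF assms(1,5)])
  note settled = eventually_settled[OF good, of m]
  have coupling: "fourier q (2 * int n) + hill_B q n m \<mu> = coupling n m \<mu>" for n \<mu>
    by (simp add: coupling_def)
  \<comment> \<open>Both kinds of hypotheses in part (a) enter only through an eventual lower bound
    for the coupling.\<close>
  have a: "(\<forall>j\<in>{1,2}. (\<lambda>n. lam n j - hill_E q n j m) \<in> O(\<lambda>n. (ln (real n) / real n) ^ (m + 1))) \<and>
      (\<lambda>n. (lam n 2 - lam n 1) - (hill_E q n 2 m - hill_E q n 1 m)) \<in> O(\<lambda>n. (ln (real n) / real n) ^ (m + 1))"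
    if \<epsilon>: "\<epsilon> > 0" and low: "\<forall>\<^sub>F n in sequentially. \<forall>j\<in>{1,2}. norm (coupling n m (lam n j)) \<ge> \<epsilon> / real n ^ m" for \<epsilon>
  proof -
    have loc: "\<forall>\<^sub>F n in sequentially. \<bar>shift n m (lam n j) - (-1) ^ j * norm (coupling n m (lam n j))\<bar> \<le> 4 * err n m"
      if j: "j \<in> {1,2}" for j
      using settled low err_small[OF half_gt_zero[OF \<epsilon>], of 600 m] eventually_gt_at_top[of 0]
    proof eventually_elim
      case (elim n)
      \<comment> \<open>\<open>err_small\<close> is applied with \<epsilon> / 2 to make the
        comparison with the threshold strict.\<close>
      have "(\<epsilon> / 2) / real n ^ m < \<epsilon> / real n ^ m" using \<epsilon> elim by (intro divide_strict_right_mono) auto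
      then have "600 * err n m < norm (coupling n m (lam n i))" if "i \<in> {1,2}" for i
        using elim that by force
      then show ?case by (intro eigenvalue_location[OF elim(1) _ j])
    qed
    have O: "(\<lambda>n. lam n j - hill_E q n j m) \<in> O(\<lambda>n. (ln (real n) / real n) ^ (m + 1))" if j: "j \<in> {1,2}" for j
    proof -
      obtain K where K: "\<forall>\<^sub>F n in sequentially. \<bar>lam n j - hill_E q n j m\<bar> \<le> K * rate n ^ (m + 1)"
        using hill_E_approximation[OF settled j _ loc[OF j]] assms(4) by auto
      show ?thesis
      proof (rule bigoI)
        show "\<forall>\<^sub>F n in sequentially. norm (lam n j - hill_E q n j m) \<le> (\<bar>K\<bar> * 10 ^ (m + 1)) * norm ((ln (real n) / real n) ^ (m + 1))"
          using K
        proof eventually_elim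
          case (elim n)
          have "K * rate n ^ (m + 1) \<le> \<bar>K * rate n ^ (m + 1)\<bar>" by simp
          also have "\<dots> = (\<bar>K\<bar> * 10 ^ (m + 1)) * norm ((ln (real n) / real n) ^ (m + 1))"
            by (simp only: rate_def power_mult_distrib abs_mult real_norm_def) simp
          finally show ?case using elim by simp
        qed
      qed
    qed
    have "(\<lambda>n. (lam n 2 - hill_E q n 2 m) - (lam n 1 - hill_E q n 1 m)) \<in> O(\<lambda>n. (ln (real n) / real n) ^ (m + 1))"
      by (intro sum_in_bigo O) auto
    then have "(\<lambda>n. (lam n 2 - lam n 1) - (hill_E q n 2 m - hill_E q n 1 m)) \<in> O(\<lambda>n. (ln (real n) / real n) ^ (m + 1))"
      by (simp add: algebra_simps)
    then show ?thesis using O by blast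
  qed
  \<comment> \<open>The majorant from \<open>gap_le\<close>. Its error part is o(n^(-m)), so it
    inherits O or o from the couplings.\<close>
  define gapb where "gapb n = 2 * (norm (coupling n m (lam n 1)) + norm (coupling n m (lam n 2))) + 16 * err n m" for n
  have gap: "(\<lambda>n. lam n 2 - lam n 1) \<in> O(gapb)"
  proof (rule bigoI)
    show "\<forall>\<^sub>F n in sequentially. norm (lam n 2 - lam n 1) \<le> 1 * norm (gapb n)"
      using settled
    proof eventually_elim
      case (elim n)
      then show ?case using gap_le[OF elim] goodD(1)[OF settledD(1)[OF elim]] by (simp add: gapb_def)
    qed
  qed
  have err: "(\<lambda>n. 16 * err n m) \<in> o(\<lambda>n. 1 / real n ^ m)"
  proof (rule landau_o.smallI)
    fix c :: real assume "c > 0"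
    from err_small[OF this, of 16 m] show "\<forall>\<^sub>F n in sequentially. norm (16 * err n m) \<le> c * norm (1 / real n ^ m)"
      by eventually_elim (use err_nonneg in auto)
  qed
  have bO: "(\<lambda>n. lam n 2 - lam n 1) \<in> O(\<lambda>n. 1 / real n ^ m)"
    if "\<forall>j\<in>{1,2}. (\<lambda>n. norm (coupling n m (lam n j))) \<in> O(\<lambda>n. 1 / real n ^ m)"
  proof -
    have "gapb \<in> O(\<lambda>n. 1 / real n ^ m)"
      unfolding gapb_def[abs_def] using that landau_o.small_imp_big[OF err]
      by (intro sum_in_bigo landau_o.big.cmult_in_iff[THEN iffD2]) auto
    then show ?thesis by (rule landau_o.big_trans[OF gap])
  qed
  have bo: "(\<lambda>n. lam n 2 - lam n 1) \<in> o(\<lambda>n. 1 / real n ^ m)"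
    if "\<forall>j\<in>{1,2}. (\<lambda>n. norm (coupling n m (lam n j))) \<in> o(\<lambda>n. 1 / real n ^ m)"
  proof -
    have "gapb \<in> o(\<lambda>n. 1 / real n ^ m)"
      unfolding gapb_def[abs_def] using that err
      by (intro sum_in_smallo landau_o.small.cmult_in_iff[THEN iffD2]) auto
    then show ?thesis by (rule landau_o.big_small_trans[OF gap])
  qed
  show ?thesis
    unfolding coupling
  proof (intro conjI impI)
    assume "(\<exists>\<epsilon>>0. \<exists>N. \<forall>n\<ge>N. \<forall>j\<in>{1,2}. norm (coupling n m (lam n j)) \<ge> \<epsilon> / real n ^ m) \<or>
      (\<exists>\<epsilon>>0. \<exists>N. \<forall>n\<ge>N.
          cmod (fourier q (2 * int n)) \<ge> \<epsilon> / real n \<or>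
          cmod (fourier q (2 * int n) - fourier (primitive_sq q) (2 * int n)
                + 2 * fourier (primitive q) 0 * fourier (primitive q) (2 * int n)) \<ge> \<epsilon> / real n ^ 2)"
    then have "\<exists>\<epsilon>>0. \<forall>\<^sub>F n in sequentially. \<forall>j\<in>{1,2}. norm (coupling n m (lam n j)) \<ge> \<epsilon> / real n ^ m"
    proof
      assume "\<exists>\<epsilon>>0. \<exists>N. \<forall>n\<ge>N. \<forall>j\<in>{1,2}. norm (coupling n m (lam n j)) \<ge> \<epsilon> / real n ^ m"
      then show ?thesis unfolding eventually_sequentially by blast
    next
      assume "\<exists>\<epsilon>>0. \<exists>N. \<forall>n\<ge>N.
          cmod (fourier q (2 * int n)) \<ge> \<epsilon> / real n \<or>
          cmod (fourier q (2 * int n) - fourier (primitive_sq q) (2 * int n)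
                + 2 * fourier (primitive q) 0 * fourier (primitive q) (2 * int n)) \<ge> \<epsilon> / real n ^ 2"
      then obtain \<epsilon> N where \<epsilon>: "\<epsilon> > 0" and N: "\<And>n. n \<ge> N \<Longrightarrow>
          cmod (fourier q (2 * int n)) \<ge> \<epsilon> / real n \<or>
          cmod (fourier q (2 * int n) - fourier (primitive_sq q) (2 * int n)
                + 2 * fourier (primitive q) 0 * fourier (primitive q) (2 * int n)) \<ge> \<epsilon> / real n ^ 2" by blast
      show ?thesis
        using coupling_lower_bound[OF assms(1) good assms(4) \<epsilon> N] \<epsilon> by (intro exI[of _ "\<epsilon> / 2"]) auto
    qed
    then show "\<forall>j\<in>{1,2}. (\<lambda>n. lam n j - hill_E q n j m) \<in> O(\<lambda>n. (ln (real n) / real n) ^ (m + 1))"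
      "(\<lambda>n. (lam n 2 - lam n 1) - (hill_E q n 2 m - hill_E q n 1 m)) \<in> O(\<lambda>n. (ln (real n) / real n) ^ (m + 1))"
      using a by blast+
  qed (use bO bo in blast)+
qed

end
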